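(* Let $m\ge 2$ and $r>1$ be fixed integers. Then there exist infinitely many integers $t$ (equivalently, infinitely many blocks of $m$ consecutive integers $t,t+1,\dots,t+m-1$) such that for every $i=0,1,\dots,m-1$ the Pólya group $\mathrm{Po}(K_{t+i})$ contains a subgroup isomorphic to $(\mathbb{Z}/7\mathbb{Z})^{r}$. Equivalently, all $m$ consecutive Pólya groups in the block have $7$-rank at least $r$.
   Context: For $t\in\mathbb{Z}$ the Hashimoto--Hoshi polynomial is $f_t(X)=X^7+a_6X^6+a_5X^5+a_4X^4+a_3X^3+a_2X^2+a_1X+a_0$, where $a_6=-(t^3+t^2+5t+6)$, $a_5=3(3t^3+3t^2+8t+4)$, $a_4=t^7+t^6+9t^5-5t^4-15t^3-22t^2-36t-8$, $a_3=-t(t^7+5t^6+12t^5+24t^4-6t^3+2t^2-20t-16)$, $a_2=t^2(2t^6+7t^5+19t^4+14t^3+2t^2+8t-8)$, $a_1=-t^4(t^4+4t^3+8t^2+4)$, $a_0=t^7$. For each $t$ let $\theta_t$ be a (fixed) root of $f_t$ in $\mathbb{C}$ and $K_t=\mathbb{Q}(\theta_t)$; these are the Hashimoto--Hoshi fields. For a number field $K$ with ring of integers $\mathcal{O}_K$, let $\mathrm{Int}(\mathcal{O}_K)=\{f\in K[X]: f(\mathcal{O}_K)\subseteq\mathcal{O}_K\}$. For $n\ge1$ let $\mathfrak{J}_n(K)$ be the fractional ideal of $\mathcal{O}_K$ consisting of $0$ and the leading coefficients of all polynomials in $\mathrm{Int}(\mathcal{O}_K)$ of degree $n$. The Pólya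 group $\mathrm{Po}(K)$ is the subgroup of the class group $\mathrm{Cl}(K)$ generated by the classes of $\mathfrak{J}_n(K)$, $n\ge1$. For a prime $p$, the $p$-rank of a finite abelian group $G$ is the largest integer $\ell$ such that $G$ contains a subgroup isomorphic to $(\mathbb{Z}/p\mathbb{Z})^\ell$. *)

theory Defs
  imports
    Complex_Main
    "HOL-Computational_Algebra.Polynomial"
    "HOL-Algebra.Generated_Groups"
    "HOL-Algebra.Generated_Fields"
    "HOL-Algebra.Ideal_Product"
    "HOL-Algebra.Product_Groups"
    "HOL-Algebra.Algebraic_Closure_Type"
begin

text \<open>
  Number fields are represented as subfields of the complex numbers, that is, as sets
  \<open>K :: complex set\<close>. Fields generated by elements and products of ideals are taken in the
  ambient field of all complex numbers, viewed as a HOL-Algebra ring.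
\<close>

abbreviation C_ring :: "complex ring" where
  "C_ring \<equiv> ring_of_type_algebra"

definition hashimoto_hoshi_poly :: "int \<Rightarrow> int poly" where
  "hashimoto_hoshi_poly t =
    [: t^7,
       - (t^4) * (t^4 + 4*t^3 + 8*t^2 + 4),
       t^2 * (2*t^6 + 7*t^5 + 19*t^4 + 14*t^3 + 2*t^2 + 8*t - 8),
       - t * (t^7 + 5*t^6 + 12*t^5 + 24*t^4 - 6*t^3 + 2*t^2 - 20*t - 16),
       t^7 + t^6 + 9*t^5 - 5*t^4 - 15*t^3 - 22*t^2 - 36*t - 8,
       3 * (3*t^3 + 3*t^2 + 8*t + 4),
       - (t^3 + t^2 + 5*t + 6),
       1 :]"

definition rat_adjoin :: "complex \<Rightarrow> complex set" where
  "rat_adjoin \<theta> = generate_field C_ring {\<theta>}"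

definition ring_of_integers :: "complex set \<Rightarrow> complex set" where
  "ring_of_integers K = {x \<in> K. algebraic_int x}"

text \<open>
  The names \<open>degree\<close> and \<open>lead_coeff\<close> also exist in HOL-Algebra for polynomials represented as
  lists; the qualified names below refer to the type of polynomials.
\<close>

definition int_valued_polys :: "complex set \<Rightarrow> complex poly set" where
  "int_valued_polys K =
    {f. (\<forall>i. Polynomial.coeff f i \<in> K) \<and>
        (\<forall>x \<in> ring_of_integers K. poly f x \<in> ring_of_integers K)}"

definition char_ideal :: "complex set \<Rightarrow> nat \<Rightarrow> complex set" where
  "char_ideal K n =
    insert 0 {Polynomial.lead_coeff f | f. f \<in> int_valued_polys K \<and> Polynomial.degree f = n}"

text \<open>Fractional ideals are required to be nonzero, so that they form a group.\<close>

definition fractional_ideal :: "complex set \<Rightarrow> complex set \<Rightarrow> bool" where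
  "fractional_ideal K I \<longleftrightarrow>
    I \<subseteq> K \<and> 0 \<in> I \<and> I \<noteq> {0} \<and>
    (\<forall>x \<in> I. \<forall>y \<in> I. x + y \<in> I) \<and>
    (\<forall>a \<in> ring_of_integers K. \<forall>x \<in> I. a * x \<in> I) \<and>
    (\<exists>d \<in> ring_of_integers K. d \<noteq> 0 \<and> (\<forall>x \<in> I. d * x \<in> ring_of_integers K))"

definition fractional_ideal_group :: "complex set \<Rightarrow> complex set monoid" where
  "fractional_ideal_group K =
    \<lparr> carrier = {I. fractional_ideal K I},
      monoid.mult = ideal_prod C_ring,
      one = ring_of_integers K \<rparr>"

definition principal_fractional_ideals :: "complex set \<Rightarrow> complex set set" where
  "principal_fractional_ideals K = {(*) x ` ring_of_integers K | x. x \<in> K \<and> x \<noteq> 0}"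

definition class_group :: "complex set \<Rightarrow> complex set set monoid" where
  "class_group K = fractional_ideal_group K Mod principal_fractional_ideals K"

definition ideal_class :: "complex set \<Rightarrow> complex set \<Rightarrow> complex set set" where
  "ideal_class K I = principal_fractional_ideals K #>\<^bsub>fractional_ideal_group K\<^esub> I"

definition polya_group :: "complex set \<Rightarrow> complex set set monoid" where
  "polya_group K =
    (class_group K)\<lparr>carrier :=
       generate (class_group K) {ideal_class K (char_ideal K n) | n. n \<ge> 1}\<rparr>"

definition contains_elementary :: "('a, 'b) monoid_scheme \<Rightarrow> nat \<Rightarrow> nat \<Rightarrow> bool" where
  "contains_elementary G p l \<longleftrightarrow>
    (\<exists>H. subgroup H G \<and>
         G\<lparr>carrier := H\<rparr> \<cong> product_group {..<l} (\<lambda>_. integer_mod_group p))"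

text \<open>Meaningful only if the set of admissible \<open>l\<close> is bounded, as it is for finite \<open>G\<close>.\<close>

definition p_rank :: "nat \<Rightarrow> ('a, 'b) monoid_scheme \<Rightarrow> nat" where
  "p_rank p G = (GREATEST l. contains_elementary G p l)"

end

theory Submission
  imports Defs "Jordan_Normal_Form.Char_Poly"
    "HOL-Computational_Algebra.Computational_Algebra"
    "HOL-Number_Theory.Residues"
begin

text \<open>
  Let \<open>q\<close> be a prime not dividing \<open>14\<close> that divides
  \<open>g(t) = t\<^sup>6 + 2t\<^sup>5 + 11t\<^sup>4 + t\<^sup>3 + 16t\<^sup>2 + 4t + 8\<close> exactly once. Then
  \<open>7\<theta>\<^sub>t - (t\<^sup>3 + t\<^sup>2 + 5t + 6)\<close> is a root of a polynomial that is Eisenstein at \<open>q\<close>, so \<open>q\<close> is totally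
  ramified: \<open>q\<O> = Q\<^sup>7\<close>. Comparing the characteristic ideals of degree \<open>q - 1\<close> and \<open>q\<close> shows that the
  class of \<open>Q\<close> belongs to the Polya group.

  The field is cyclic over the rationals, say with Galois group generated by \<open>\<sigma>\<close>. A relation
  \<open>\<Prod>Q\<^sub>p ^ a\<^sub>p = (x)\<close> between such classes produces the unit \<open>\<sigma>(x)/x\<close> of norm \<open>1\<close>. Counting units of
  bounded logarithmic size shows that the units of norm \<open>1\<close> modulo those of the form \<open>\<sigma>(u)/u\<close>, \<open>u\<close> a
  unit of norm \<open>1\<close>, fall into at most \<open>7\<close> classes. Hence the relations have rank at most one
  modulo \<open>7\<close>, and among \<open>r + 1\<close> ramified primes there are \<open>r\<close> with independent classes.

  Infinitely many primes divide values of \<open>g\<close>, and each divides some value exactly once. By the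
  Chinese remainder theorem modulo squares of distinct primes one can therefore prescribe \<open>r + 1\<close> such
  primes for each of \<open>t, \<dots>, t + m - 1\<close>.
\<close>

section \<open>Algebraic integers\<close>

text \<open>The bound \<open>7\<close> comes from the group ring. On units of norm \<open>1\<close>
  the ring Z[x]/(1 + x + ... + x^6) acts, x acting as \<open>\<sigma>\<close>, and there
  \<open>7\<close> is a unit times (x - 1)^6. So six applications of u \<mapsto> \<sigma>(u)/u,
  twisted by that unit, amount to the seventh power. Given k inequivalent representatives, words of
  length six turn each unit of logarithmic size at most R into k^6 different units of size at most 7
  R + B, whereas the number of units of size at most R is bounded by a constant times (2 R + 1)^6,
  because the seven logarithms sum to zero. Iteration forces k^6 <= 7^6. Only an upper bound for the
  number of units enters, so no basis of the unit group has to be produced. The other obstacle is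
  cyclicity. The candidate for the next conjugate is a rational function of a root, and every claim
  about it reduces to polynomial identities or to the nonvanishing at the root of polynomials of
  degree below seven, which an Eisenstein prime supplies. Taking t >= 1 keeps the decisive
  coefficients nonzero.\<close>

definition zspan :: "'i set \<Rightarrow> ('i \<Rightarrow> complex) \<Rightarrow> complex set" where
  "zspan I v = {\<Sum>i\<in>I. of_int (c i) * v i | c :: 'i \<Rightarrow> int. True}"

lemma zspan_add: "a \<in> zspan I v \<Longrightarrow> b \<in> zspan I v \<Longrightarrow> a + b \<in> zspan I v"
proof -
  assume "a \<in> zspan I v" "b \<in> zspan I v"
  then obtain c d :: "_ \<Rightarrow> int"
    where "a = (\<Sum>i\<in>I. of_int (c i) * v i)" "b = (\<Sum>i\<in>I. of_int (d i) * v i)"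
    by (auto simp: zspan_def)
  hence "a + b = (\<Sum>i\<in>I. of_int (c i + d i) * v i)"
    by (simp add: sum.distrib algebra_simps)
  thus ?thesis unfolding zspan_def mem_Collect_eq by (intro exI[of _ "\<lambda>i. c i + d i"]) simp
qed

lemma zspan_scale: "a \<in> zspan I v \<Longrightarrow> of_int z * a \<in> zspan I v"
proof -
  assume "a \<in> zspan I v"
  then obtain c :: "_ \<Rightarrow> int" where "a = (\<Sum>i\<in>I. of_int (c i) * v i)"
    by (auto simp: zspan_def)
  hence "of_int z * a = (\<Sum>i\<in>I. of_int (z * c i) * v i)"
    by (simp add: sum_distrib_left algebra_simps)
  thus ?thesis unfolding zspan_def mem_Collect_eq by (intro exI[of _ "\<lambda>i. z * c i"]) simp
qed

lemma zspan_0: "0 \<in> zspan I v"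
  unfolding zspan_def mem_Collect_eq by (intro exI[of _ "\<lambda>_. 0"]) simp

lemma zspan_gen: "finite I \<Longrightarrow> i \<in> I \<Longrightarrow> v i \<in> zspan I v"
proof -
  assume "finite I" "i \<in> I"
  hence "(\<Sum>k\<in>I. of_int (if k = i then 1 else 0) * v k) = (\<Sum>k\<in>{i}. v k)"
    by (intro sum.mono_neutral_cong_right) auto
  thus ?thesis unfolding zspan_def mem_Collect_eq
    by (intro exI[of _ "\<lambda>k. if k = i then 1 else 0"]) simp
qed

lemma zspan_sum: "(\<And>j. j \<in> J \<Longrightarrow> g j \<in> zspan I v) \<Longrightarrow> (\<Sum>j\<in>J. g j) \<in> zspan I v"
  by (induction J rule: infinite_finite_induct) (auto intro: zspan_0 zspan_add)

lemma zspan_mult_closed: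
  assumes "\<And>i. i \<in> I \<Longrightarrow> x * v i \<in> zspan I v" "a \<in> zspan I v"
  shows "x * a \<in> zspan I v"
proof -
  obtain c :: "_ \<Rightarrow> int" where a: "a = (\<Sum>i\<in>I. of_int (c i) * v i)"
    using assms(2) by (auto simp: zspan_def)
  have "x * a = (\<Sum>i\<in>I. of_int (c i) * (x * v i))"
    by (simp add: a sum_distrib_left algebra_simps)
  also have "\<dots> \<in> zspan I v"
    by (intro zspan_sum zspan_scale assms)
  finally show ?thesis .
qed

text \<open>Integer expansions of the products \<open>x * v i\<close> form an integer matrix with
  eigenvalue \<open>x\<close>; the \<open>v i\<close> are the coordinates of an eigenvector, nonzero
  thanks to \<open>v i0\<close>. The characteristic polynomial is monic with integer
  coefficients.\<close>

lemma algebraic_int_if_stable: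
  assumes fin: "finite I" and nz: "i0 \<in> I" "v i0 \<noteq> 0"
    and st: "\<And>i. i \<in> I \<Longrightarrow> x * v i \<in> zspan I v"
  shows "algebraic_int x"
proof -
  define m where "m = card I"
  obtain e where e: "bij_betw e {0..<m} I"
    using ex_bij_betw_nat_finite[OF fin] by (auto simp: m_def)
  have "\<forall>i\<in>I. \<exists>c :: _ \<Rightarrow> int. x * v i = (\<Sum>k\<in>I. of_int (c k) * v k)"
    using st by (auto simp: zspan_def)
  then obtain c :: "_ \<Rightarrow> _ \<Rightarrow> int"
    where c: "\<And>i. i \<in> I \<Longrightarrow> x * v i = (\<Sum>k\<in>I. of_int (c i k) * v k)"
    by metis
  define A where "A = mat m m (\<lambda>(i, j). c (e i) (e j))"
  define Ac :: "complex mat" where "Ac = map_mat of_int A"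
  define w where "w = vec m (\<lambda>i. v (e i))"
  have A: "A \<in> carrier_mat m m" "Ac \<in> carrier_mat m m"
    by (simp_all add: A_def Ac_def)
  have "Ac *\<^sub>v w = x \<cdot>\<^sub>v w"
  proof (rule eq_vecI)
    fix i assume "i < dim_vec (x \<cdot>\<^sub>v w)"
    hence i: "i < m" by (simp add: w_def)
    hence "e i \<in> I" using e by (auto simp: bij_betw_def)
    have "(Ac *\<^sub>v w) $ i = (\<Sum>j = 0..<m. of_int (c (e i) (e j)) * v (e j))"
      using i by (simp add: Ac_def A_def w_def scalar_prod_def)
    also have "\<dots> = (\<Sum>k\<in>I. of_int (c (e i) k) * v k)"
      by (rule sum.reindex_bij_betw[OF e])
    also have "\<dots> = (x \<cdot>\<^sub>v w) $ i"
      using c[OF \<open>e i \<in> I\<close>] i by (simp add: w_def)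
    finally show "(Ac *\<^sub>v w) $ i = (x \<cdot>\<^sub>v w) $ i" .
  qed (simp add: Ac_def A_def w_def)
  moreover have "w \<noteq> 0\<^sub>v m"
  proof -
    obtain k where "k < m" "e k = i0"
      using e nz(1) by (auto simp: bij_betw_def)
    hence "w $ k \<noteq> 0\<^sub>v m $ k" using nz by (simp add: w_def)
    thus ?thesis by auto
  qed
  ultimately have "eigenvector Ac w x"
    by (simp add: eigenvector_def Ac_def A_def w_def)
  hence "poly (char_poly Ac) x = 0"
    using eigenvalue_root_char_poly[OF A(2)] by (auto simp: eigenvalue_def)
  moreover have "char_poly Ac = map_poly of_int (char_poly A)"
    unfolding Ac_def by (rule of_int_hom.char_poly_hom[OF A(1)])
  moreover have "Polynomial.lead_coeff (char_poly A) = 1"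
    using degree_monic_char_poly[OF A(1)] by simp
  ultimately show ?thesis
    by (auto simp: algebraic_int_altdef_ipoly)
qed

lemma algebraic_int_powerE:
  fixes x :: complex
  assumes "algebraic_int x"
  obtains m and c :: "nat \<Rightarrow> int" where "m > 0" "x ^ m = (\<Sum>k<m. of_int (c k) * x ^ k)"
proof -
  obtain p where p: "poly (map_poly of_int p) x = 0" "Polynomial.lead_coeff p = 1"
    using assms by (auto simp: algebraic_int_altdef_ipoly)
  define m where "m = Polynomial.degree p"
  have "m > 0"
  proof (rule Nat.gr0I)
    assume "m = 0"
    then obtain c where "p = [:c:]" by (auto simp: m_def elim: degree_eq_zeroE)
    with p show False by simp
  qed
  moreover have "x ^ m = (\<Sum>k<m. of_int (- Polynomial.coeff p k) * x ^ k)"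
  proof -
    have "0 = (\<Sum>k\<le>m. of_int (Polynomial.coeff p k) * x ^ k)"
      using p by (simp add: poly_altdef m_def coeff_map_poly degree_map_poly)
    also have "{..m} = insert m {..<m}" by auto
    also have "(\<Sum>k\<in>\<dots>. of_int (Polynomial.coeff p k) * x ^ k) =
        x ^ m + (\<Sum>k<m. of_int (Polynomial.coeff p k) * x ^ k)"
      using p(2) by (simp add: m_def)
    finally have "x ^ m = - (\<Sum>k<m. of_int (Polynomial.coeff p k) * x ^ k)"
      using eq_neg_iff_add_eq_0 by metis
    thus ?thesis by (simp add: sum_negf)
  qed
  ultimately show ?thesis by (rule that)
qed

lemma algebraic_int_powerI:
  fixes x :: complex and c :: "nat \<Rightarrow> int"
  assumes "m > 0" "x ^ m = (\<Sum>k<m. of_int (c k) * x ^ k)"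
  shows "algebraic_int x"
proof (rule algebraic_int_if_stable[of "{..<m}" 0 "\<lambda>i. x ^ i"])
  fix i assume i: "i \<in> {..<m}"
  show "x * x ^ i \<in> zspan {..<m} (\<lambda>i. x ^ i)"
  proof (cases "Suc i < m")
    case True
    thus ?thesis using zspan_gen[of "{..<m}" "Suc i" "\<lambda>i. x ^ i"] by simp
  next
    case False
    hence "Suc i = m" using i by auto
    hence "x * x ^ i = (\<Sum>k<m. of_int (c k) * x ^ k)" by (metis assms(2) power_Suc)
    thus ?thesis by (auto intro!: zspan_sum zspan_scale zspan_gen)
  qed
qed (use assms in auto)

context
  fixes x y :: complex
  assumes x: "algebraic_int x" and y: "algebraic_int y"
begin

text \<open>The monomials \<open>x ^ i * y ^ j\<close> below the degrees of two monic relations span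
  a module stable under \<open>x\<close> and \<open>y\<close>, hence under their sum and
  product.\<close>

private lemma stable_module:
  obtains I :: "(nat \<times> nat) set" and v i0 where "finite I" "i0 \<in> I" "v i0 \<noteq> 0"
    "\<And>a. a \<in> zspan I v \<Longrightarrow> x * a \<in> zspan I v" "\<And>a. a \<in> zspan I v \<Longrightarrow> y * a \<in> zspan I v"
proof -
  obtain m and c :: "nat \<Rightarrow> int" where m: "m > 0" "x ^ m = (\<Sum>k<m. of_int (c k) * x ^ k)"
    using x by (rule algebraic_int_powerE)
  obtain n and d :: "nat \<Rightarrow> int" where n: "n > 0" "y ^ n = (\<Sum>k<n. of_int (d k) * y ^ k)"
    using y by (rule algebraic_int_powerE)
  define I where "I = {..<m} \<times> {..<n}"
  define v where "v = (\<lambda>(i, j). x ^ i * y ^ j)"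
  have fin: "finite I" by (simp add: I_def)
  have gen: "x ^ i * y ^ j \<in> zspan I v" if "i < m" "j < n" for i j
    using zspan_gen[OF fin, of "(i, j)" v] that by (simp add: I_def v_def)
  have "x * (x ^ i * y ^ j) \<in> zspan I v" if "i < m" "j < n" for i j
  proof (cases "Suc i < m")
    case True
    thus ?thesis using gen[of "Suc i" j] that by (simp add: mult.assoc)
  next
    case False
    hence "x * (x ^ i * y ^ j) = x ^ m * y ^ j"
      using that by (metis Suc_lessI mult.assoc power_Suc)
    also have "\<dots> = (\<Sum>k<m. of_int (c k) * (x ^ k * y ^ j))"
      by (simp add: m sum_distrib_right mult.assoc)
    also have "\<dots> \<in> zspan I v"
      using that by (intro zspan_sum zspan_scale gen) auto
    finally show ?thesis .
  qed
  hence "x * a \<in> zspan I v" if "a \<in> zspan I v" for a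
    by (intro zspan_mult_closed[OF _ that]) (auto simp: I_def v_def)
  moreover have "y * (x ^ i * y ^ j) \<in> zspan I v" if "i < m" "j < n" for i j
  proof (cases "Suc j < n")
    case True
    thus ?thesis using gen[of i "Suc j"] that by (simp add: mult_ac)
  next
    case False
    hence "y * (x ^ i * y ^ j) = x ^ i * y ^ n"
      using that by (metis Suc_lessI mult.left_commute power_Suc)
    also have "\<dots> = (\<Sum>k<n. of_int (d k) * (x ^ i * y ^ k))"
      by (simp add: n sum_distrib_left mult_ac)
    also have "\<dots> \<in> zspan I v"
      using that by (intro zspan_sum zspan_scale gen) auto
    finally show ?thesis .
  qed
  hence "y * a \<in> zspan I v" if "a \<in> zspan I v" for a
    by (intro zspan_mult_closed[OF _ that]) (auto simp: I_def v_def)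
  ultimately show ?thesis
    using that[OF fin, of "(0, 0)" v] m n by (simp add: I_def v_def)
qed

lemma algebraic_int_add: "algebraic_int (x + y)"
proof -
  obtain I v and i0 :: "nat \<times> nat" where *: "finite I" "i0 \<in> I" "v i0 \<noteq> 0"
    "\<And>a. a \<in> zspan I v \<Longrightarrow> x * a \<in> zspan I v" "\<And>a. a \<in> zspan I v \<Longrightarrow> y * a \<in> zspan I v"
    using stable_module by metis
  thus ?thesis
    by (intro algebraic_int_if_stable[of I i0 v]) (auto simp: distrib_right intro!: zspan_add zspan_gen)
qed

lemma algebraic_int_mult: "algebraic_int (x * y)"
proof -
  obtain I v and i0 :: "nat \<times> nat" where *: "finite I" "i0 \<in> I" "v i0 \<noteq> 0"
    "\<And>a. a \<in> zspan I v \<Longrightarrow> x * a \<in> zspan I v" "\<And>a. a \<in> zspan I v \<Longrightarrow> y * a \<in> zspan I v"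
    using stable_module by metis
  thus ?thesis
    by (intro algebraic_int_if_stable[of I i0 v]) (auto simp: mult.assoc intro!: zspan_gen)
qed

end

lemma algebraic_int_diff: "algebraic_int x \<Longrightarrow> algebraic_int y \<Longrightarrow> algebraic_int (x - y)"
  for x y :: complex
  using algebraic_int_add[of x "- y"] algebraic_int_minus[of y] by simp

lemma algebraic_int_power: "algebraic_int x \<Longrightarrow> algebraic_int (x ^ k)" for x :: complex
  by (induction k) (auto intro: algebraic_int_mult algebraic_int_1)

lemma algebraic_int_sum: "(\<And>i. i \<in> I \<Longrightarrow> algebraic_int (g i)) \<Longrightarrow> algebraic_int (\<Sum>i\<in>I. g i)"
  for g :: "_ \<Rightarrow> complex"
  by (induction I rule: infinite_finite_induct) (auto intro: algebraic_int_add)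

text \<open>A monic relation of degree \<open>m\<close> for \<open>x ^ k\<close> is one of degree
  \<open>k * m\<close> for \<open>x\<close>. This is how integrality passes from a seventh power to
  its root.\<close>

lemma algebraic_int_of_power:
  assumes "algebraic_int (x ^ k)" "k > 0" shows "algebraic_int (x :: complex)"
proof -
  obtain p where p: "poly (map_poly of_int p) (x ^ k) = 0" "Polynomial.lead_coeff p = 1"
    using assms(1) by (auto simp: algebraic_int_altdef_ipoly)
  obtain m and c :: "nat \<Rightarrow> int" where m: "m > 0" "(x ^ k) ^ m = (\<Sum>i<m. of_int (c i) * (x ^ k) ^ i)"
    using assms(1) by (rule algebraic_int_powerE)
  show ?thesis
  proof (rule algebraic_int_if_stable[of "{..<k * m}" 0 "\<lambda>i. x ^ i"])
    fix i assume i: "i \<in> {..<k * m}"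
    show "x * x ^ i \<in> zspan {..<k * m} (\<lambda>i. x ^ i)"
    proof (cases "Suc i < k * m")
      case True
      thus ?thesis using zspan_gen[of "{..<k * m}" "Suc i" "\<lambda>i. x ^ i"] by simp
    next
      case False
      hence "Suc i = k * m" using i by auto
      hence "x * x ^ i = (x ^ k) ^ m" by (metis power_Suc power_mult)
      also have "\<dots> = (\<Sum>i<m. of_int (c i) * x ^ (k * i))"
        by (simp add: m power_mult)
      also have "\<dots> \<in> zspan {..<k * m} (\<lambda>i. x ^ i)"
        using assms(2) by (intro zspan_sum zspan_scale zspan_gen) auto
      finally show ?thesis .
    qed
  qed (use assms m in auto)
qed

lemma of_int_quotient_algebraic_int:
  assumes "algebraic_int (of_int a / of_int b :: complex)" "b \<noteq> 0"
  shows "b dvd a"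
proof -
  have "(of_int a / of_int b :: complex) \<in> \<int>"
    by (rule rational_algebraic_int_is_int[OF assms(1)]) auto
  then obtain z where "of_int a / of_int b = (of_int z :: complex)" by (auto elim: Ints_cases)
  hence "of_int a = (of_int (b * z) :: complex)" using assms(2) by (simp add: field_simps)
  hence "a = b * z" by (simp only: of_int_eq_iff)
  thus ?thesis by simp
qed

section \<open>Cyclic number fields\<close>

text \<open>\<open>f\<close> lists the coefficients expressing \<open>\<theta> ^ n\<close> by lower
  powers. Galois theory enters only through \<open>\<sigma>\<close>, a ring endomorphism of
  \<open>K\<close> for which the orbit of \<open>\<theta>\<close> has exactly \<open>n\<close>
  elements.\<close>

locale cyclic_field =
  fixes n :: nat and f :: "nat \<Rightarrow> int" and \<theta> :: complex and K :: "complex set"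
    and \<sigma> :: "complex \<Rightarrow> complex"
  assumes n_pos: "n > 0"
    and root: "\<theta> ^ n = (\<Sum>i<n. of_int (f i) * \<theta> ^ i)"
    and indep: "\<And>(c :: nat \<Rightarrow> rat) i. (\<Sum>i<n. of_rat (c i) * \<theta> ^ i) = 0 \<Longrightarrow> i < n \<Longrightarrow> c i = 0"
    and K_eq: "K = {\<Sum>i<n. of_rat (c i) * \<theta> ^ i | c :: nat \<Rightarrow> rat. True}"
    and K_mult: "x \<in> K \<Longrightarrow> y \<in> K \<Longrightarrow> x * y \<in> K"
    and K_inverse: "x \<in> K \<Longrightarrow> inverse x \<in> K"
    and \<theta>_in_K: "\<theta> \<in> K"
    and \<sigma>_closed: "x \<in> K \<Longrightarrow> \<sigma> x \<in> K"
    and \<sigma>_add: "x \<in> K \<Longrightarrow> y \<in> K \<Longrightarrow> \<sigma> (x + y) = \<sigma> x + \<sigma> y"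
    and \<sigma>_mult: "x \<in> K \<Longrightarrow> y \<in> K \<Longrightarrow> \<sigma> (x * y) = \<sigma> x * \<sigma> y"
    and \<sigma>_1: "\<sigma> 1 = 1"
    and \<sigma>_period: "(\<sigma> ^^ n) \<theta> = \<theta>"
    and \<sigma>_distinct: "0 < i \<Longrightarrow> i < n \<Longrightarrow> (\<sigma> ^^ i) \<theta> \<noteq> \<theta>"
begin

lemma K_add: "x \<in> K \<Longrightarrow> y \<in> K \<Longrightarrow> x + y \<in> K"
proof -
  assume "x \<in> K" "y \<in> K"
  then obtain c d :: "nat \<Rightarrow> rat" where "x = (\<Sum>i<n. of_rat (c i) * \<theta> ^ i)" "y = (\<Sum>i<n. of_rat (d i) * \<theta> ^ i)"
    by (auto simp: K_eq)
  hence "x + y = (\<Sum>i<n. of_rat (c i + d i) * \<theta> ^ i)"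
    by (simp add: of_rat_add algebra_simps sum.distrib)
  thus ?thesis unfolding K_eq mem_Collect_eq by (intro exI[of _ "\<lambda>i. c i + d i"]) simp
qed

lemma K_rat: "of_rat r \<in> K"
proof -
  have "(\<Sum>i<n. of_rat (if i = 0 then r else 0) * \<theta> ^ i) = (\<Sum>i\<in>{0}. of_rat r * \<theta> ^ i)"
    using n_pos by (intro sum.mono_neutral_cong_right) auto
  thus ?thesis unfolding K_eq mem_Collect_eq by (intro exI[of _ "\<lambda>i. if i = 0 then r else 0"]) simp
qed

lemma K_Rats: "x \<in> \<rat> \<Longrightarrow> x \<in> K"
  using K_rat by (auto elim: Rats_cases)

lemma K_of_int [simp]: "of_int z \<in> K" and K_of_nat [simp]: "of_nat k \<in> K"
  and K_0 [simp]: "0 \<in> K" and K_1 [simp]: "1 \<in> K"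
  by (auto intro: K_Rats)

lemma K_uminus: "x \<in> K \<Longrightarrow> - x \<in> K"
  using K_mult[OF K_rat[of "-1"], of x] by simp

lemma K_diff: "x \<in> K \<Longrightarrow> y \<in> K \<Longrightarrow> x - y \<in> K"
  using K_add[of x "- y"] K_uminus[of y] by simp

lemma K_divide: "x \<in> K \<Longrightarrow> y \<in> K \<Longrightarrow> x / y \<in> K"
  using K_mult[of x "inverse y"] K_inverse[of y] by (simp add: field_simps)

lemma K_power: "x \<in> K \<Longrightarrow> x ^ k \<in> K"
  by (induction k) (auto intro: K_mult)

lemma K_powi: "x \<in> K \<Longrightarrow> x powi k \<in> K"
  by (auto simp: power_int_def intro: K_power K_inverse)

lemma K_sum: "(\<And>i. i \<in> I \<Longrightarrow> g i \<in> K) \<Longrightarrow> (\<Sum>i\<in>I. g i) \<in> K"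
  by (induction I rule: infinite_finite_induct) (auto intro: K_add)

lemma K_prod: "(\<And>i. i \<in> I \<Longrightarrow> g i \<in> K) \<Longrightarrow> (\<Prod>i\<in>I. g i) \<in> K"
  by (induction I rule: infinite_finite_induct) (auto intro: K_mult)

subsection \<open>Conjugates, norm and trace\<close>

definition conj :: "nat \<Rightarrow> complex \<Rightarrow> complex" where "conj i = \<sigma> ^^ i"

lemma conj_0 [simp]: "conj 0 x = x" and conj_1: "conj (Suc 0) x = \<sigma> x"
  by (simp_all add: conj_def)

lemma conj_Suc: "conj (Suc i) x = \<sigma> (conj i x)"
  by (simp add: conj_def)

lemma conj_conj: "conj i (conj j x) = conj (i + j) x"
  by (simp add: conj_def funpow_add)

lemma conj_closed: "x \<in> K \<Longrightarrow> conj i x \<in> K"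
  by (induction i) (auto simp: conj_Suc intro: \<sigma>_closed)

lemma conj_add: "x \<in> K \<Longrightarrow> y \<in> K \<Longrightarrow> conj i (x + y) = conj i x + conj i y"
  by (induction i) (auto simp: conj_Suc \<sigma>_add conj_closed)

lemma conj_mult: "x \<in> K \<Longrightarrow> y \<in> K \<Longrightarrow> conj i (x * y) = conj i x * conj i y"
  by (induction i) (auto simp: conj_Suc \<sigma>_mult conj_closed)

lemma conj_one [simp]: "conj i 1 = 1"
  by (induction i) (auto simp: conj_Suc \<sigma>_1)

lemma conj_zero [simp]: "conj i 0 = 0"
  using conj_add[of 0 0 i] by simp

lemma conj_uminus: "x \<in> K \<Longrightarrow> conj i (- x) = - conj i x"
  using conj_add[of x "- x" i] K_uminus by (simp add: eq_neg_iff_add_eq_0 add.commute)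

lemma conj_of_nat [simp]: "conj i (of_nat k) = of_nat k"
  by (induction k) (auto simp: conj_add)

lemma conj_of_int [simp]: "conj i (of_int k) = of_int k"
proof (cases "k \<ge> 0")
  case True
  thus ?thesis using conj_of_nat[of i "nat k"] by simp
next
  case False
  thus ?thesis using conj_of_nat[of i "nat (- k)"] conj_uminus[of "of_int k" i] K_rat[of "of_int k"] by simp
qed

lemma conj_rat [simp]: "conj i (of_rat r) = of_rat r"
proof -
  obtain a b where r: "quotient_of r = (a, b)" by force
  have b: "b > 0" using quotient_of_denom_pos[OF r] .
  have rr: "r = of_int a / of_int b" using quotient_of_div[OF r] by simp
  have "of_rat r * of_int b = (of_int a :: complex)"
    using b by (simp add: rr of_rat_divide)
  hence "conj i (of_rat r) * of_int b = of_int a"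
    using conj_mult[of "of_rat r" "of_int b" i] K_rat by simp
  thus ?thesis using b by (simp add: rr of_rat_divide field_simps)
qed

lemma conj_power: "x \<in> K \<Longrightarrow> conj i (x ^ k) = conj i x ^ k"
  by (induction k) (auto simp: conj_mult K_power)

lemma conj_sum: "(\<And>j. j \<in> J \<Longrightarrow> g j \<in> K) \<Longrightarrow> conj i (\<Sum>j\<in>J. g j) = (\<Sum>j\<in>J. conj i (g j))"
  by (induction J rule: infinite_finite_induct) (auto simp: conj_add K_sum)

lemma conj_prod: "(\<And>j. j \<in> J \<Longrightarrow> g j \<in> K) \<Longrightarrow> conj i (\<Prod>j\<in>J. g j) = (\<Prod>j\<in>J. conj i (g j))"
  by (induction J rule: infinite_finite_induct) (auto simp: conj_mult K_prod)

lemma conj_coords: "conj i (\<Sum>k<m. of_rat (c k) * \<theta> ^ k) = (\<Sum>k<m. of_rat (c k) * conj i \<theta> ^ k)"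
  by (subst conj_sum) (simp_all add: conj_mult conj_power K_mult K_rat K_power \<theta>_in_K)

lemma conj_n: "x \<in> K \<Longrightarrow> conj n x = x"
proof -
  assume "x \<in> K"
  then obtain c :: "nat \<Rightarrow> rat" where c: "x = (\<Sum>i<n. of_rat (c i) * \<theta> ^ i)"
    by (auto simp: K_eq)
  have "conj n \<theta> = \<theta>" using \<sigma>_period by (simp add: conj_def)
  thus ?thesis by (simp add: c conj_coords)
qed

lemma conj_eq_0_iff: "x \<in> K \<Longrightarrow> conj i x = 0 \<longleftrightarrow> x = 0"
proof
  assume x: "x \<in> K" "conj i x = 0"
  have "conj (j * n) x = x" for j
    by (induction j) (use x in \<open>auto simp: conj_n conj_conj[symmetric]\<close>)
  \<comment> \<open>The index \<open>i\<close> may exceed \<open>n\<close>, so \<open>conj i\<close>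
    is undone by \<open>conj (i * n - i)\<close> rather than by \<open>conj (n - i)\<close>.\<close>
  moreover have "i \<le> i * n" using n_pos by simp
  hence "conj (i * n) x = conj (i * n - i) (conj i x)" by (simp add: conj_conj)
  ultimately show "x = 0" using x by simp
qed auto

lemma conj_inverse: "x \<in> K \<Longrightarrow> conj i (inverse x) = inverse (conj i x)"
proof (cases "x = 0")
  assume x: "x \<in> K" "x \<noteq> 0"
  have "conj i x * conj i (inverse x) = 1"
    using x by (subst conj_mult[symmetric]) (auto intro: K_inverse)
  thus ?thesis by (metis inverse_unique)
qed auto

lemma inj_conj_\<theta>: "inj_on (\<lambda>i. conj i \<theta>) {..<n}"
proof -
  have "conj i \<theta> \<noteq> conj j \<theta>" if "i < j" "j < n" for i j
  proof
    assume eq: "conj i \<theta> = conj j \<theta>"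
    have "\<theta> = conj (n - i) (conj i \<theta>)"
      using that conj_n[OF \<theta>_in_K] by (simp add: conj_conj)
    also have "\<dots> = conj (j - i) (conj n \<theta>)"
      using that by (simp add: eq conj_conj add.commute)
    finally have "conj (j - i) \<theta> = \<theta>"
      using conj_n[OF \<theta>_in_K] by simp
    moreover have "0 < j - i" "j - i < n" using that by auto
    ultimately show False
      using \<sigma>_distinct[of "j - i"] by (simp add: conj_def)
  qed
  thus ?thesis by (intro linorder_inj_onI) auto
qed

text \<open>If \<open>x\<close> is fixed, the polynomial whose coefficients are the coordinates of
  \<open>x\<close> takes the value \<open>x\<close> at all \<open>n\<close> conjugates of
  \<open>\<theta>\<close>. Its degree is below \<open>n\<close>, so it is constant, with a rational
  constant term.\<close>

lemma fixed_imp_Rats: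
  assumes "x \<in> K" "\<sigma> x = x"
  shows "x \<in> \<rat>"
proof -
  obtain c :: "nat \<Rightarrow> rat" where c: "x = (\<Sum>i<n. of_rat (c i) * \<theta> ^ i)"
    using assms by (auto simp: K_eq)
  define p where "p = (\<Sum>i<n. Polynomial.monom (of_rat (c i)) i) - [:x:]"
  have fixed: "conj i x = x" for i
    by (induction i) (simp_all add: conj_Suc assms)
  have "poly p (conj i \<theta>) = 0" for i
  proof -
    have "x = (\<Sum>k<n. of_rat (c k) * conj i \<theta> ^ k)"
      using conj_coords[where i = i and m = n and c = c] fixed[of i] c by simp
    thus ?thesis by (simp add: p_def poly_sum poly_monom)
  qed
  hence sub: "(\<lambda>i. conj i \<theta>) ` {..<n} \<subseteq> {z. poly p z = 0}" by auto
  have "Polynomial.degree (\<Sum>i<n. Polynomial.monom (complex_of_rat (c i)) i) < n"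
    using n_pos by (intro degree_sum_less) (auto intro: le_less_trans[OF degree_monom_le])
  hence deg: "Polynomial.degree p < n"
    using n_pos unfolding p_def by (intro degree_diff_less) auto
  have "p = 0"
  proof (rule ccontr)
    assume "p \<noteq> 0"
    hence "card ((\<lambda>i. conj i \<theta>) ` {..<n}) \<le> Polynomial.degree p"
      using card_mono[OF poly_roots_finite sub] card_poly_roots_bound[of p] by fastforce
    thus False using deg inj_conj_\<theta> by (simp add: card_image)
  qed
  hence "Polynomial.coeff p 0 = 0" by simp
  hence "x = of_rat (c 0)"
    using n_pos by (simp add: p_def coeff_sum coeff_monom sum.delta)
  thus ?thesis by simp
qed

definition norm_K :: "complex \<Rightarrow> complex" where "norm_K x = (\<Prod>i<n. conj i x)"
definition trace_K :: "complex \<Rightarrow> complex" where "trace_K x = (\<Sum>i<n. conj i x)"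

lemma norm_K_mult: "x \<in> K \<Longrightarrow> y \<in> K \<Longrightarrow> norm_K (x * y) = norm_K x * norm_K y"
  by (simp add: norm_K_def conj_mult prod.distrib)

lemma norm_K_eq_0_iff: "x \<in> K \<Longrightarrow> norm_K x = 0 \<longleftrightarrow> x = 0"
  using n_pos by (auto simp: norm_K_def conj_eq_0_iff)

lemma norm_K_1 [simp]: "norm_K 1 = 1"
  by (simp add: norm_K_def)

lemma sum_conj_shift: "x \<in> K \<Longrightarrow> (\<Sum>i<n. conj (Suc i) x) = (\<Sum>i<n. conj i x)"
proof -
  assume "x \<in> K"
  have "(\<Sum>i<n. conj (Suc i) x) + x = (\<Sum>i<Suc n. conj i x)"
    by (simp only: sum.lessThan_Suc_shift conj_0 add.commute)
  thus ?thesis using conj_n[OF \<open>x \<in> K\<close>] by simp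
qed

lemma prod_conj_shift: "x \<in> K \<Longrightarrow> (\<Prod>i<n. conj (Suc i) x) = (\<Prod>i<n. conj i x)"
proof (cases "x = 0")
  assume "x \<in> K" "x \<noteq> 0"
  have "(\<Prod>i<n. conj (Suc i) x) * x = (\<Prod>i<Suc n. conj i x)"
    by (simp only: prod.lessThan_Suc_shift conj_0 mult.commute)
  thus ?thesis using conj_n[OF \<open>x \<in> K\<close>] \<open>x \<noteq> 0\<close> by simp
qed auto

lemma trace_K_Rats: "x \<in> K \<Longrightarrow> trace_K x \<in> \<rat>"
  using sum_conj_shift[of x] unfolding trace_K_def
  by (intro fixed_imp_Rats) (auto intro!: K_sum conj_closed simp: conj_sum[of _ _ "Suc 0", unfolded conj_1] conj_closed conj_Suc)

lemma norm_K_Rats: "x \<in> K \<Longrightarrow> norm_K x \<in> \<rat>"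
  using prod_conj_shift[of x] unfolding norm_K_def
  by (intro fixed_imp_Rats) (auto intro!: K_prod conj_closed simp: conj_prod[of _ _ "Suc 0", unfolded conj_1] conj_closed conj_Suc)

lemma norm_K_conj: "x \<in> K \<Longrightarrow> norm_K (\<sigma> x) = norm_K x"
  using prod_conj_shift[of x] by (simp add: norm_K_def conj_def funpow_swap1)

subsection \<open>Integers of the field\<close>

abbreviation \<O> :: "complex set" where "\<O> \<equiv> ring_of_integers K"

lemma O_iff: "x \<in> \<O> \<longleftrightarrow> x \<in> K \<and> algebraic_int x"
  by (simp add: ring_of_integers_def)

lemma O_K: "x \<in> \<O> \<Longrightarrow> x \<in> K"
  by (simp add: O_iff)

lemma O_add: "x \<in> \<O> \<Longrightarrow> y \<in> \<O> \<Longrightarrow> x + y \<in> \<O>"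
  and O_mult: "x \<in> \<O> \<Longrightarrow> y \<in> \<O> \<Longrightarrow> x * y \<in> \<O>"
  and O_diff: "x \<in> \<O> \<Longrightarrow> y \<in> \<O> \<Longrightarrow> x - y \<in> \<O>"
  and O_uminus: "x \<in> \<O> \<Longrightarrow> - x \<in> \<O>"
  and O_power: "x \<in> \<O> \<Longrightarrow> x ^ k \<in> \<O>"
  and O_int [simp]: "of_int z \<in> \<O>"
  and O_nat [simp]: "of_nat k \<in> \<O>"
  and O_0 [simp]: "0 \<in> \<O>"
  and O_1 [simp]: "1 \<in> \<O>"
  by (simp_all add: O_iff algebraic_int_of_int algebraic_int_of_nat algebraic_int_1
      K_add K_mult K_diff K_uminus K_power algebraic_int_add algebraic_int_mult
      algebraic_int_diff algebraic_int_power)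

lemma O_sum: "(\<And>i. i \<in> I \<Longrightarrow> g i \<in> \<O>) \<Longrightarrow> (\<Sum>i\<in>I. g i) \<in> \<O>"
  by (induction I rule: infinite_finite_induct) (auto intro: O_add)

lemma O_prod: "(\<And>i. i \<in> I \<Longrightarrow> g i \<in> \<O>) \<Longrightarrow> (\<Prod>i\<in>I. g i) \<in> \<O>"
  by (induction I rule: infinite_finite_induct) (auto intro: O_mult)

lemma \<theta>_in_O: "\<theta> \<in> \<O>"
  using algebraic_int_powerI[OF n_pos root] by (simp add: O_iff \<theta>_in_K)

lemma O_Rats_imp_Ints: "x \<in> \<O> \<Longrightarrow> x \<in> \<rat> \<Longrightarrow> x \<in> \<int>"
  by (simp add: O_iff rational_algebraic_int_is_int)

lemma conj_O: "x \<in> \<O> \<Longrightarrow> conj i x \<in> \<O>"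
proof -
  assume x: "x \<in> \<O>"
  then obtain m and c :: "nat \<Rightarrow> int" where m: "m > 0" "x ^ m = (\<Sum>k<m. of_int (c k) * x ^ k)"
    using algebraic_int_powerE[of x] by (metis O_iff)
  have xK: "x \<in> K" using x by (simp add: O_K)
  have "conj i x ^ m = conj i (x ^ m)" by (simp add: conj_power xK)
  also have "\<dots> = (\<Sum>k<m. conj i (of_int (c k) * x ^ k))"
    unfolding m(2) using xK by (intro conj_sum) (auto intro!: K_mult K_power)
  also have "\<dots> = (\<Sum>k<m. of_int (c k) * conj i x ^ k)"
    using xK by (intro sum.cong) (auto simp: conj_mult conj_power K_power)
  finally show ?thesis
    using algebraic_int_powerI[OF m(1)] xK by (simp add: O_iff conj_closed)
qed

lemma norm_K_Ints: "x \<in> \<O> \<Longrightarrow> norm_K x \<in> \<int>"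
  by (intro O_Rats_imp_Ints norm_K_Rats O_K) (auto simp: norm_K_def intro!: O_prod conj_O)

lemma trace_K_Ints: "x \<in> \<O> \<Longrightarrow> trace_K x \<in> \<int>"
  by (intro O_Rats_imp_Ints trace_K_Rats O_K) (auto simp: trace_K_def intro!: O_sum conj_O)

text \<open>Every integer divides its norm, the cofactor being the product of the other conjugates.\<close>

lemma norm_K_multiple: "x \<in> \<O> \<Longrightarrow> \<exists>y\<in>\<O>. norm_K x = x * y"
proof -
  assume x: "x \<in> \<O>"
  obtain m where m: "n = Suc m" using n_pos gr0_conv_Suc by auto
  have "(\<Prod>i<n. conj i x) = x * (\<Prod>i<m. conj (Suc i) x)"
    by (simp only: m prod.lessThan_Suc_shift conj_0)
  hence "norm_K x = x * (\<Prod>i<m. conj (Suc i) x)" by (simp only: norm_K_def)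
  thus ?thesis using x by (auto intro!: O_prod conj_O)
qed

subsection \<open>The dual basis\<close>

definition F :: "nat \<Rightarrow> int" where "F j = (if j = n then 1 else - f j)"

lemma F_root: "(\<Sum>j\<le>n. of_int (F j) * conj i \<theta> ^ j) = 0"
proof -
  have "conj i \<theta> ^ n = conj i (\<theta> ^ n)"
    by (simp add: conj_power \<theta>_in_K)
  also have "\<theta> ^ n = (\<Sum>k<n. of_rat (of_int (f k)) * \<theta> ^ k)"
    using root by simp
  finally have r: "conj i \<theta> ^ n = (\<Sum>k<n. of_int (f k) * conj i \<theta> ^ k)"
    unfolding conj_coords by simp
  have "(\<Sum>j\<le>n. of_int (F j) * conj i \<theta> ^ j)
      = (\<Sum>j<n. of_int (F j) * conj i \<theta> ^ j) + conj i \<theta> ^ n"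
    by (simp add: F_def flip: lessThan_Suc_atMost)
  also have "(\<Sum>j<n. of_int (F j) * conj i \<theta> ^ j) = - (\<Sum>k<n. of_int (f k) * conj i \<theta> ^ k)"
    by (simp add: F_def flip: sum_negf)
  finally show ?thesis using r by simp
qed

text \<open>The coefficient of \<open>v ^ k\<close> in (F(v) - F(u)) / (v - u), where F is the monic
  polynomial with coefficients \<open>F j\<close>. Divided by F'(\<theta>), the
  \<open>h k \<theta>\<close> form Euler's basis dual to the powers of
  \<open>\<theta>\<close>.\<close>

definition h :: "nat \<Rightarrow> complex \<Rightarrow> complex" where
  "h k u = (\<Sum>j\<in>{k<..n}. of_int (F j) * u ^ (j - 1 - k))"

lemma h_sum_swap:
  "(\<Sum>k<n. h k u * v ^ k) = (\<Sum>j\<le>n. of_int (F j) * (\<Sum>k<j. v ^ k * u ^ (j - 1 - k)))"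
proof -
  have "(\<Sum>k<n. h k u * v ^ k) =
      (\<Sum>k\<in>{..<n}. \<Sum>j | j \<in> {..n} \<and> k < j. of_int (F j) * (v ^ k * u ^ (j - 1 - k)))"
    unfolding h_def sum_distrib_right
    by (intro sum.cong) (auto simp: mult_ac)
  also have "\<dots> = (\<Sum>j\<in>{..n}. \<Sum>k | k \<in> {..<n} \<and> k < j. of_int (F j) * (v ^ k * u ^ (j - 1 - k)))"
    by (rule sum.swap_restrict) auto
  also have "\<dots> = (\<Sum>j\<le>n. of_int (F j) * (\<Sum>k<j. v ^ k * u ^ (j - 1 - k)))"
    unfolding sum_distrib_left by (intro sum.cong) auto
  finally show ?thesis .
qed

lemma h_conj:
  assumes "0 < i" "i < n"
  shows "(\<Sum>k<n. h k (conj i \<theta>) * \<theta> ^ k) = 0"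
proof -
  define u where "u = conj i \<theta>"
  have "(u - \<theta>) * (\<Sum>k<n. h k u * \<theta> ^ k) =
      (\<Sum>j\<le>n. of_int (F j) * ((\<theta> - u) * (\<Sum>k<j. u ^ (j - Suc k) * \<theta> ^ k)) * (- 1))"
    unfolding h_sum_swap sum_distrib_left by (intro sum.cong) (auto simp: algebra_simps simp flip: sum_negf)
  also have "\<dots> = (\<Sum>j\<le>n. of_int (F j) * (\<theta> ^ j - u ^ j) * (- 1))"
    by (simp only: power_diff_sumr2)
  also have "\<dots> = (\<Sum>j\<le>n. of_int (F j) * u ^ j) - (\<Sum>j\<le>n. of_int (F j) * \<theta> ^ j)"
    by (simp add: algebra_simps sum_subtractf)
  also have "\<dots> = 0"
    using F_root[of i] F_root[of 0] by (simp add: u_def)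
  finally show ?thesis
    using \<sigma>_distinct[OF assms] by (simp add: u_def conj_def)
qed

text \<open>The divided difference on the diagonal, that is, F'(\<theta>).\<close>

definition \<delta> :: complex where "\<delta> = (\<Sum>k<n. h k \<theta> * \<theta> ^ k)"

lemma h_O: "h k \<theta> \<in> \<O>"
  by (auto simp: h_def intro!: O_sum O_mult O_power \<theta>_in_O)

lemma \<delta>_K: "\<delta> \<in> K"
  unfolding \<delta>_def by (intro K_sum K_mult K_power \<theta>_in_K O_K[OF h_O])

text \<open>Written out, \<open>\<delta>\<close> is a combination of powers of
  \<open>\<theta>\<close> below \<open>n\<close> with coefficient \<open>n\<close> at exponent
  \<open>n - 1\<close>, so linear independence excludes zero.\<close>

lemma \<delta>_nonzero: "\<delta> \<noteq> 0"
proof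
  assume "\<delta> = 0"
  have "\<delta> = (\<Sum>j\<le>n. of_int (F j) * (of_nat j * \<theta> ^ (j - 1)))"
    unfolding \<delta>_def h_sum_swap
  proof (intro sum.cong refl arg_cong2[where f = "(*)"])
    fix j assume "j \<in> {..n}"
    have "(\<Sum>k<j. \<theta> ^ k * \<theta> ^ (j - 1 - k)) = (\<Sum>k<j. \<theta> ^ (j - 1))"
      by (intro sum.cong) (auto simp flip: power_add)
    thus "(\<Sum>k<j. \<theta> ^ k * \<theta> ^ (j - 1 - k)) = of_nat j * \<theta> ^ (j - 1)" by simp
  qed
  also have "{..n} = {..<Suc n}" by auto
  also have "(\<Sum>j<Suc n. of_int (F j) * (of_nat j * \<theta> ^ (j - 1))) =
      (\<Sum>i<n. of_rat (of_int (F (Suc i)) * of_nat (Suc i)) * \<theta> ^ i)"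
    unfolding sum.lessThan_Suc_shift by (simp add: of_rat_mult of_rat_add algebra_simps)
  finally have "of_int (F (Suc (n - 1))) * of_nat (Suc (n - 1)) = (0 :: rat)"
    using indep[of "\<lambda>i. of_int (F (Suc i)) * of_nat (Suc i)" "n - 1"] n_pos \<open>\<delta> = 0\<close> by simp
  thus False using n_pos by (simp add: F_def)
qed

text \<open>After exchanging the sums, the conjugate with index \<open>i\<close> contributes a
  divided difference of F between two distinct roots, which is zero, except for
  \<open>i = 0\<close>, where the term is \<open>x * \<delta>\<close>.\<close>

lemma dual_basis: "x \<in> K \<Longrightarrow> x * \<delta> = (\<Sum>k<n. trace_K (x * h k \<theta>) * \<theta> ^ k)"
proof -
  assume x: "x \<in> K"
  have ch: "conj i (h k \<theta>) = h k (conj i \<theta>)" for i k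
    unfolding h_def by (subst conj_sum) (auto intro!: K_mult K_power \<theta>_in_K simp: conj_mult conj_power K_power \<theta>_in_K)
  have "(\<Sum>k<n. trace_K (x * h k \<theta>) * \<theta> ^ k) = (\<Sum>k<n. \<Sum>i<n. conj i x * (h k (conj i \<theta>) * \<theta> ^ k))"
    unfolding trace_K_def sum_distrib_right using x
    by (intro sum.cong) (auto simp: conj_mult O_K h_O ch mult_ac)
  also have "\<dots> = (\<Sum>i<n. conj i x * (\<Sum>k<n. h k (conj i \<theta>) * \<theta> ^ k))"
    by (subst sum.swap) (simp add: sum_distrib_left)
  also have "\<dots> = (\<Sum>i\<in>{0}. conj i x * (\<Sum>k<n. h k (conj i \<theta>) * \<theta> ^ k))"
    using n_pos by (intro sum.mono_neutral_right) (auto simp: h_conj)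
  also have "\<dots> = x * \<delta>" by (simp add: \<delta>_def)
  finally show ?thesis ..
qed

abbreviation Z\<theta> :: "complex set" where "Z\<theta> \<equiv> zspan {..<n} (\<lambda>i. \<theta> ^ i)"

lemma \<theta>_Z\<theta>: "a \<in> Z\<theta> \<Longrightarrow> \<theta> * a \<in> Z\<theta>"
proof (rule zspan_mult_closed)
  fix i assume i: "i \<in> {..<n}"
  show "\<theta> * \<theta> ^ i \<in> Z\<theta>"
  proof (cases "Suc i < n")
    case True
    thus ?thesis using zspan_gen[of "{..<n}" "Suc i" "\<lambda>i. \<theta> ^ i"] by simp
  next
    case False
    hence "Suc i = n" using i by auto
    hence "\<theta> * \<theta> ^ i = (\<Sum>i<n. of_int (f i) * \<theta> ^ i)" by (metis root power_Suc)
    thus ?thesis by (auto intro!: zspan_sum zspan_scale zspan_gen)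
  qed
qed

lemma Z\<theta>_mult: "a \<in> Z\<theta> \<Longrightarrow> b \<in> Z\<theta> \<Longrightarrow> a * b \<in> Z\<theta>"
proof -
  assume a: "a \<in> Z\<theta>" and b: "b \<in> Z\<theta>"
  have pw: "\<theta> ^ k * b \<in> Z\<theta>" for k
    by (induction k) (auto simp: b mult.assoc intro: \<theta>_Z\<theta>)
  obtain c :: "nat \<Rightarrow> int" where "a = (\<Sum>i<n. of_int (c i) * \<theta> ^ i)"
    using a by (auto simp: zspan_def)
  hence "a * b = (\<Sum>i<n. of_int (c i) * (\<theta> ^ i * b))"
    by (simp add: sum_distrib_right mult.assoc)
  also have "\<dots> \<in> Z\<theta>" by (intro zspan_sum zspan_scale pw)
  finally show ?thesis .
qed

lemma Z\<theta>_O: "a \<in> Z\<theta> \<Longrightarrow> a \<in> \<O>"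
  by (auto simp: zspan_def intro!: O_sum O_mult O_power \<theta>_in_O)

lemma K_denominator: "x \<in> K \<Longrightarrow> \<exists>d::int. d > 0 \<and> of_int d * x \<in> Z\<theta>"
proof -
  assume "x \<in> K"
  then obtain c :: "nat \<Rightarrow> rat" where c: "x = (\<Sum>i<n. of_rat (c i) * \<theta> ^ i)"
    by (auto simp: K_eq)
  define e where "e i = snd (quotient_of (c i))" for i
  have e: "e i > 0" for i
    by (simp add: e_def quotient_of_denom_pos')
  have ec: "of_int (e i) * c i = of_int (fst (quotient_of (c i)))" for i
    using quotient_of_div[of "c i" "fst (quotient_of (c i))" "e i"] e[of i]
    by (simp add: e_def field_simps)
  define d where "d = (\<Prod>i<n. e i)"
  have "of_int d * x \<in> Z\<theta>"
  proof -
    have "of_int d * (of_rat (c i) * \<theta> ^ i) \<in> Z\<theta>" if "i < n" for i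
    proof -
      have "d = (\<Prod>j\<in>{..<n}-{i}. e j) * e i"
        using that by (simp add: d_def prod.remove[of _ i] mult.commute)
      hence "of_int d * c i = of_int ((\<Prod>j\<in>{..<n}-{i}. e j) * fst (quotient_of (c i)))"
        by (simp add: mult.assoc ec)
      hence "of_int d * of_rat (c i) = (of_int ((\<Prod>j\<in>{..<n}-{i}. e j) * fst (quotient_of (c i))) :: complex)"
        by (metis of_rat_mult of_rat_of_int_eq)
      hence "of_int d * (of_rat (c i) * \<theta> ^ i) = of_int ((\<Prod>j\<in>{..<n}-{i}. e j) * fst (quotient_of (c i))) * \<theta> ^ i"
        by (simp only: mult.assoc[symmetric])
      moreover have "\<theta> ^ i \<in> Z\<theta>" using that by (intro zspan_gen) auto
      ultimately show ?thesis by (metis zspan_scale)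
    qed
    thus ?thesis by (auto simp: c sum_distrib_left intro!: zspan_sum)
  qed
  moreover have "d > 0" by (simp add: d_def e prod_pos)
  ultimately show ?thesis by blast
qed

text \<open>The traces against the \<open>h k \<theta>\<close> are rational integers, so
  \<open>x * \<delta>\<close> lies in \<open>Z\<theta>\<close> for all \<open>x\<close> in
  \<open>\<O>\<close>; one denominator of \<open>inverse \<delta>\<close> then serves every
  \<open>x\<close>.\<close>

lemma O_denominator: "\<exists>d::int. d > 0 \<and> (\<forall>x\<in>\<O>. of_int d * x \<in> Z\<theta>)"
proof -
  obtain d :: int where d: "d > 0" "of_int d * inverse \<delta> \<in> Z\<theta>"
    using K_denominator[OF K_inverse[OF \<delta>_K]] by blast
  have "of_int d * x \<in> Z\<theta>" if x: "x \<in> \<O>" for x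
  proof -
    have "trace_K (x * h k \<theta>) * \<theta> ^ k \<in> Z\<theta>" if "k < n" for k
    proof -
      obtain z where "trace_K (x * h k \<theta>) = of_int z"
        using trace_K_Ints[OF O_mult[OF x h_O]] by (rule Ints_cases)
      moreover have "\<theta> ^ k \<in> Z\<theta>" using that by (intro zspan_gen) auto
      ultimately show ?thesis by (simp only: zspan_scale)
    qed
    hence "x * \<delta> \<in> Z\<theta>"
      using x by (auto simp: dual_basis O_K intro!: zspan_sum)
    hence "(of_int d * inverse \<delta>) * (x * \<delta>) \<in> Z\<theta>" by (rule Z\<theta>_mult[OF d(2)])
    also have "(of_int d * inverse \<delta>) * (x * \<delta>) = of_int d * x"
      using \<delta>_nonzero by (simp add: field_simps)
    finally show ?thesis .
  qed
  thus ?thesis using d by blast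
qed

text \<open>By \<open>dual_basis\<close> an element is determined by its traces against the
  \<open>h k \<theta>\<close>. For integers of \<open>K\<close> with bounded conjugates these are
  rational integers in a bounded range.\<close>

lemma finite_bounded_integers:
  fixes B :: real
  shows "finite {x \<in> \<O>. \<forall>i<n. cmod (conj i x) \<le> B}" (is "finite ?S")
proof -
  define M where "M = (\<Sum>k<n. \<Sum>i<n. \<bar>B\<bar> * cmod (conj i (h k \<theta>)))"
  define T where "T = {z :: complex. z \<in> \<int> \<and> cmod z \<le> M}"
  have "T \<subseteq> of_int ` {- \<lceil>M\<rceil>..\<lceil>M\<rceil>}"
  proof
    fix z assume "z \<in> T"
    then obtain k where k: "z = of_int k" "\<bar>real_of_int k\<bar> \<le> M"
      by (auto simp: T_def elim!: Ints_cases)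
    hence "\<bar>k\<bar> \<le> \<lceil>M\<rceil>" by linarith
    hence "k \<in> {- \<lceil>M\<rceil>..\<lceil>M\<rceil>}" by auto
    thus "z \<in> of_int ` {- \<lceil>M\<rceil>..\<lceil>M\<rceil>}" using k by blast
  qed
  hence "finite T" by (rule finite_subset) auto
  have tr: "trace_K (x * h k \<theta>) \<in> T" if "x \<in> ?S" "k < n" for x k
  proof -
    have "cmod (trace_K (x * h k \<theta>)) \<le> (\<Sum>i<n. cmod (conj i (x * h k \<theta>)))"
      unfolding trace_K_def by (rule norm_sum)
    also have "\<dots> \<le> (\<Sum>i<n. \<bar>B\<bar> * cmod (conj i (h k \<theta>)))"
    proof (rule sum_mono)
      fix i assume "i \<in> {..<n}"
      hence "cmod (conj i x) \<le> \<bar>B\<bar>" using that by fastforce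
      thus "cmod (conj i (x * h k \<theta>)) \<le> \<bar>B\<bar> * cmod (conj i (h k \<theta>))"
        using that by (simp add: conj_mult O_K h_O norm_mult mult_right_mono)
    qed
    also have "\<dots> \<le> M"
      unfolding M_def using that
      by (intro member_le_sum[where f = "\<lambda>k. \<Sum>i<n. \<bar>B\<bar> * cmod (conj i (h k \<theta>))"]) (auto intro!: sum_nonneg)
    finally show ?thesis using that by (auto simp: T_def O_mult h_O intro!: trace_K_Ints)
  qed
  define \<phi> where "\<phi> x = (\<lambda>k\<in>{..<n}. trace_K (x * h k \<theta>))" for x
  have "\<phi> ` ?S \<subseteq> ({..<n} \<rightarrow>\<^sub>E T)"
  proof
    fix z assume "z \<in> \<phi> ` ?S"
    then obtain x where x: "x \<in> ?S" "z = \<phi> x" by blast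
    show "z \<in> {..<n} \<rightarrow>\<^sub>E T"
      unfolding x(2) \<phi>_def by (intro restrict_PiE_iff[THEN iffD2] ballI tr[OF x(1)]) simp
  qed
  hence "finite (\<phi> ` ?S)"
    using \<open>finite T\<close> by (meson finite_PiE finite_lessThan finite_subset)
  moreover have "inj_on \<phi> ?S"
  proof
    fix x y assume xy: "x \<in> ?S" "y \<in> ?S" "\<phi> x = \<phi> y"
    have "trace_K (x * h k \<theta>) = trace_K (y * h k \<theta>)" if "k < n" for k
      using fun_cong[OF xy(3), of k] that by (simp add: \<phi>_def)
    hence "x * \<delta> = y * \<delta>" using xy by (simp add: dual_basis O_K)
    thus "x = y" using \<delta>_nonzero by simp
  qed
  ultimately show ?thesis by (rule finite_imageD)
qed

end

section \<open>Fractional ideals and finiteness of the class group\<close>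

lemma C_ring_simps [simp]:
  "monoid.mult C_ring = (*)" "add C_ring = (+)" "carrier C_ring = UNIV"
  "one C_ring = 1" "zero C_ring = 0"
  by (simp_all add: ring_of_type_algebra_def)

abbreviation iprod :: "complex set \<Rightarrow> complex set \<Rightarrow> complex set" where
  "iprod I J \<equiv> ideal_prod C_ring I J"

lemma iprod_mult: "a \<in> I \<Longrightarrow> b \<in> J \<Longrightarrow> a * b \<in> iprod I J"
  using ideal_prod.prod[of a I b J C_ring] by simp

lemma iprod_add: "x \<in> iprod I J \<Longrightarrow> y \<in> iprod I J \<Longrightarrow> x + y \<in> iprod I J"
  using ideal_prod.sum[of x C_ring I J y] by simp

lemma iprod_induct [consumes 1, case_names mult add]:
  assumes "x \<in> iprod I J" "\<And>a b. a \<in> I \<Longrightarrow> b \<in> J \<Longrightarrow> P (a * b)"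
    "\<And>x y. x \<in> iprod I J \<Longrightarrow> y \<in> iprod I J \<Longrightarrow> P x \<Longrightarrow> P y \<Longrightarrow> P (x + y)"
  shows "P x"
  using assms(1) by (induction rule: ideal_prod.induct) (auto intro: assms)

lemma iprod_least:
  assumes "\<And>a b. a \<in> I \<Longrightarrow> b \<in> J \<Longrightarrow> a * b \<in> S" "\<And>x y. x \<in> S \<Longrightarrow> y \<in> S \<Longrightarrow> x + y \<in> S"
  shows "iprod I J \<subseteq> S"
proof
  fix x assume "x \<in> iprod I J"
  thus "x \<in> S" by (induction rule: iprod_induct) (auto intro: assms)
qed

lemma iprod_commute: "iprod I J = iprod J I"
proof -
  have "iprod I J \<subseteq> iprod J I" for I J
  proof (rule iprod_least)
    fix a b assume "a \<in> I" "b \<in> J"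
    thus "a * b \<in> iprod J I" using iprod_mult[of b J a I] by (simp add: mult.commute)
  qed (rule iprod_add)
  thus ?thesis by blast
qed

lemma iprod_assoc: "iprod (iprod I J) L = iprod I (iprod J L)"
proof -
  have sub: "iprod (iprod I J) L \<subseteq> iprod I (iprod J L)" for I J L
  proof (rule iprod_least)
    fix x c assume x: "x \<in> iprod I J" and c: "c \<in> L"
    show "x * c \<in> iprod I (iprod J L)"
      using x by (induction rule: iprod_induct)
        (auto simp: mult.assoc distrib_right intro!: iprod_mult iprod_add c)
  qed (rule iprod_add)
  have "iprod I (iprod J L) = iprod (iprod L J) I" by (simp add: iprod_commute)
  also have "\<dots> \<subseteq> iprod L (iprod J I)" by (rule sub)
  also have "\<dots> = iprod (iprod I J) L" by (simp add: iprod_commute)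
  finally show ?thesis using sub by blast
qed

lemma iprod_scale: "iprod ((*) x ` I) J = (*) x ` iprod I J"
proof
  show "iprod ((*) x ` I) J \<subseteq> (*) x ` iprod I J"
  proof (rule iprod_least)
    fix a b assume "a \<in> (*) x ` I" "b \<in> J"
    then obtain a' where "a' \<in> I" "a = x * a'" by blast
    thus "a * b \<in> (*) x ` iprod I J"
      using iprod_mult[OF \<open>a' \<in> I\<close> \<open>b \<in> J\<close>] by (auto simp: mult.assoc)
  next
    fix u v assume "u \<in> (*) x ` iprod I J" "v \<in> (*) x ` iprod I J"
    then obtain u' v' where "u' \<in> iprod I J" "v' \<in> iprod I J" "u = x * u'" "v = x * v'" by blast
    thus "u + v \<in> (*) x ` iprod I J"
      using iprod_add[of u' I J v'] by (auto simp flip: distrib_left)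
  qed
  show "(*) x ` iprod I J \<subseteq> iprod ((*) x ` I) J"
  proof
    fix u assume "u \<in> (*) x ` iprod I J"
    then obtain u' where u: "u' \<in> iprod I J" "u = x * u'" by blast
    have "x * u' \<in> iprod ((*) x ` I) J" using u(1)
    proof (induction rule: iprod_induct)
      case (mult a b)
      hence "(x * a) * b \<in> iprod ((*) x ` I) J" by (intro iprod_mult) auto
      thus ?case by (simp only: mult.assoc)
    next
      case (add a b)
      thus ?case by (simp add: distrib_left iprod_add)
    qed
    thus "u \<in> iprod ((*) x ` I) J" using u by simp
  qed
qed

lemma scale_scale: "(*) x ` (*) y ` I = (*) (x * y) ` (I :: complex set)"
  by (simp add: image_image mult.assoc)

context cyclic_field
begin

section \<open>Fractional ideals as finitely generated additive groups\<close>

abbreviation frac :: "complex set \<Rightarrow> bool" where "frac \<equiv> fractional_ideal K"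
abbreviation FG :: "complex set monoid" where "FG \<equiv> fractional_ideal_group K"

lemma fracD:
  assumes "frac I"
  shows "I \<subseteq> K" "0 \<in> I" "I \<noteq> {0}" "x \<in> I \<Longrightarrow> y \<in> I \<Longrightarrow> x + y \<in> I" "a \<in> \<O> \<Longrightarrow> x \<in> I \<Longrightarrow> a * x \<in> I"
  using assms unfolding fractional_ideal_def by blast+

lemma frac_diff: "frac I \<Longrightarrow> x \<in> I \<Longrightarrow> y \<in> I \<Longrightarrow> x - y \<in> I"
  using fracD(4)[of I x "(-1) * y"] fracD(5)[of I "-1" y] O_int[of "-1"] by simp

lemma frac_sum: "frac I \<Longrightarrow> (\<And>i. i \<in> A \<Longrightarrow> g i \<in> I) \<Longrightarrow> (\<Sum>i\<in>A. g i) \<in> I"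
  by (induction A rule: infinite_finite_induct) (auto intro: fracD)

lemma frac_nonzero: "frac I \<Longrightarrow> \<exists>x\<in>I. x \<noteq> 0"
proof (rule ccontr)
  assume I: "frac I" and "\<not> (\<exists>x\<in>I. x \<noteq> 0)"
  hence "I = {0}" using fracD(2)[OF I] by auto
  thus False using fracD(3)[OF I] by simp
qed

lemma frac_denominator: "frac I \<Longrightarrow> \<exists>d\<in>\<O>. d \<noteq> 0 \<and> (\<forall>x\<in>I. d * x \<in> \<O>)"
  unfolding fractional_ideal_def by (elim conjE)

lemma fracI:
  assumes "I \<subseteq> K" "0 \<in> I" "\<exists>x\<in>I. x \<noteq> 0" "\<And>x y. x \<in> I \<Longrightarrow> y \<in> I \<Longrightarrow> x + y \<in> I"
    "\<And>a x. a \<in> \<O> \<Longrightarrow> x \<in> I \<Longrightarrow> a * x \<in> I" "d \<in> \<O>" "d \<noteq> 0" "\<And>x. x \<in> I \<Longrightarrow> d * x \<in> \<O>"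
  shows "frac I"
  unfolding fractional_ideal_def
proof (intro conjI ballI)
  show "I \<noteq> {0}" using assms(3) by auto
  show "\<exists>d\<in>\<O>. d \<noteq> 0 \<and> (\<forall>x\<in>I. d * x \<in> \<O>)" using assms(6-8) by blast
qed (fact assms)+

lemma frac_O: "frac \<O>"
  by (rule fracI[where d = 1]) (auto simp: O_K O_add O_mult intro: bexI[of _ 1])

lemma frac_iprod:
  assumes I: "frac I" and J: "frac J"
  shows "frac (iprod I J)"
proof -
  obtain d where d: "d \<in> \<O>" "d \<noteq> 0" "\<And>x. x \<in> I \<Longrightarrow> d * x \<in> \<O>" using frac_denominator[OF I] by blast
  obtain e where e: "e \<in> \<O>" "e \<noteq> 0" "\<And>x. x \<in> J \<Longrightarrow> e * x \<in> \<O>" using frac_denominator[OF J] by blast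
  obtain a b where ab: "a \<in> I" "a \<noteq> 0" "b \<in> J" "b \<noteq> 0" using frac_nonzero I J by blast
  show ?thesis
  proof (rule fracI[where d = "d * e"])
    show "iprod I J \<subseteq> K"
      using fracD(1)[OF I] fracD(1)[OF J] by (intro iprod_least) (auto intro: K_add K_mult)
    show "0 \<in> iprod I J"
      using iprod_mult[OF fracD(2)[OF I] fracD(2)[OF J]] by simp
    show "\<exists>x\<in>iprod I J. x \<noteq> 0"
      using iprod_mult[of a I b J] ab by (intro bexI[of _ "a * b"]) auto
    show "a * x \<in> iprod I J" if "a \<in> \<O>" "x \<in> iprod I J" for a x
      using that(2)
    proof (induction rule: iprod_induct)
      case (mult x y)
      thus ?case using iprod_mult[OF fracD(5)[OF I that(1)], of x y J] by (simp add: mult.assoc)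
    qed (simp add: distrib_left iprod_add)
    show "d * e * x \<in> \<O>" if "x \<in> iprod I J" for x
      using that
    proof (induction rule: iprod_induct)
      case (mult x y)
      have "d * e * (x * y) = (d * x) * (e * y)" by simp
      thus ?case using mult d e by (metis O_mult)
    qed (simp add: distrib_left O_add)
  qed (use d e O_mult iprod_add in auto)
qed

lemma frac_scale:
  assumes I: "frac I" and x: "x \<in> K" "x \<noteq> 0"
  shows "frac ((*) x ` I)"
proof -
  obtain d where d: "d \<in> \<O>" "d \<noteq> 0" "\<And>x. x \<in> I \<Longrightarrow> d * x \<in> \<O>" using frac_denominator[OF I] by blast
  obtain e :: int where e: "e > 0" "of_int e * x \<in> Z\<theta>" using K_denominator[OF x(1)] by blast
  have ex: "of_int e * x \<in> \<O>" using Z\<theta>_O[OF e(2)] .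
  obtain a where a: "a \<in> I" "a \<noteq> 0" using frac_nonzero I by blast
  show ?thesis
  proof (rule fracI[where d = "of_int e * d"])
    show "(*) x ` I \<subseteq> K" using fracD(1)[OF I] x by (auto intro: K_mult)
    show "0 \<in> (*) x ` I" using fracD(2)[OF I] by force
    show "\<exists>y\<in>(*) x ` I. y \<noteq> 0" using a x by auto
    show "y + z \<in> (*) x ` I" if "y \<in> (*) x ` I" "z \<in> (*) x ` I" for y z
      using that fracD(4)[OF I] by (auto simp flip: distrib_left)
    show "b * y \<in> (*) x ` I" if b: "b \<in> \<O>" and y: "y \<in> (*) x ` I" for b y
    proof -
      obtain z where z: "z \<in> I" "y = x * z" using y by blast
      have "b * y = x * (b * z)" by (simp add: z)
      thus ?thesis using fracD(5)[OF I b z(1)] by blast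
    qed
    show "of_int e * d * y \<in> \<O>" if y: "y \<in> (*) x ` I" for y
    proof -
      obtain z where z: "z \<in> I" "y = x * z" using y by blast
      have "of_int e * d * y = (of_int e * x) * (d * z)" by (simp add: z)
      thus ?thesis using O_mult[OF ex d(3)[OF z(1)]] by (simp only:)
    qed
  qed (use d e in \<open>auto intro: O_mult\<close>)
qed

lemma iprod_O: "frac I \<Longrightarrow> iprod \<O> I = I"
proof
  assume I: "frac I"
  show "iprod \<O> I \<subseteq> I" by (rule iprod_least) (auto intro: fracD[OF I])
  show "I \<subseteq> iprod \<O> I"
  proof
    fix x assume "x \<in> I"
    thus "x \<in> iprod \<O> I" using iprod_mult[OF O_1, of x I] by simp
  qed
qed

lemma iprod_principal: "frac I \<Longrightarrow> iprod ((*) x ` \<O>) I = (*) x ` I"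
  by (simp add: iprod_scale iprod_O)

lemma frac_integer_denominator: "frac I \<Longrightarrow> \<exists>d::int. d > 0 \<and> (\<forall>x\<in>I. of_int d * x \<in> \<O>)"
proof -
  assume I: "frac I"
  then obtain d where d: "d \<in> \<O>" "d \<noteq> 0" "\<And>x. x \<in> I \<Longrightarrow> d * x \<in> \<O>"
    using frac_denominator[OF I] by blast
  obtain y where y: "y \<in> \<O>" "norm_K d = d * y" using norm_K_multiple[OF d(1)] by blast
  obtain z where z: "norm_K d = of_int z" using norm_K_Ints[OF d(1)] by (rule Ints_cases)
  have "z \<noteq> 0" using norm_K_eq_0_iff[OF O_K[OF d(1)]] d(2) z by auto
  \<comment> \<open>The norm \<open>z\<close> is a multiple of \<open>d\<close> and so clears
    denominators as well; it is squared to become positive.\<close>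
  have "of_int (z * z) * x \<in> \<O>" if "x \<in> I" for x
  proof -
    have "of_int (z * z) * x = of_int z * y * (d * x)"
      using y z by (simp add: mult_ac)
    thus ?thesis using O_mult[OF O_mult[OF O_int y(1)] d(3)[OF that]] by (simp only:)
  qed
  moreover have "z * z > 0" using \<open>z \<noteq> 0\<close> by (simp add: zero_less_mult_iff) linarith
  ultimately show ?thesis by blast
qed

lemma frac_contains_integer: "frac I \<Longrightarrow> \<exists>m::int. m > 0 \<and> of_int m \<in> I"
proof -
  assume I: "frac I"
  obtain d :: int where d: "d > 0" "\<And>x. x \<in> I \<Longrightarrow> of_int d * x \<in> \<O>"
    using frac_integer_denominator[OF I] by blast
  obtain a where a: "a \<in> I" "a \<noteq> 0" using frac_nonzero[OF I] by blast
  have da: "of_int d * a \<in> \<O>" using d a by blast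
  obtain y where y: "y \<in> \<O>" "norm_K (of_int d * a) = of_int d * a * y" using norm_K_multiple[OF da] by blast
  obtain z where z: "norm_K (of_int d * a) = of_int z" using norm_K_Ints[OF da] by (rule Ints_cases)
  have "z \<noteq> 0" using norm_K_eq_0_iff[OF O_K[OF da]] a d z by auto
  have "of_int (z * z) = (of_int z * of_int d * y) * a"
    using y z by (simp add: mult_ac)
  hence "of_int (z * z) \<in> I"
    using fracD(5)[OF I O_mult[OF O_mult[OF O_int O_int] y(1)] a(1)] by (simp only:)
  moreover have "z * z > 0" using \<open>z \<noteq> 0\<close> by (simp add: zero_less_mult_iff) linarith
  ultimately show ?thesis by blast
qed

text \<open>Reducing coordinates modulo \<open>m\<close>: every element is congruent to one of finitely many.\<close>

lemma reduce_coords: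
  fixes c :: "nat \<Rightarrow> int" and L :: int
  shows "(\<Sum>i<n. of_int (c i) * \<theta> ^ i)
    = (\<Sum>i<n. of_int (c i mod L) * \<theta> ^ i) + of_int L * (\<Sum>i<n. of_int (c i div L) * \<theta> ^ i)"
proof -
  have "(of_int (c i) :: complex) = of_int (c i mod L) + of_int L * of_int (c i div L)" for i
    by (metis mod_mult_div_eq of_int_add of_int_mult)
  thus ?thesis by (simp add: sum_distrib_left sum.distrib algebra_simps)
qed

text \<open>\<open>I\<close> contains the elements \<open>of_int m * \<theta> ^ i\<close>, and
  scaled by \<open>e\<close> it lies in \<open>Z\<theta>\<close>. Reducing coordinates modulo
  \<open>e * m\<close> leaves finitely many residues; those in \<open>I\<close>, together with these
  elements, generate \<open>I\<close>.\<close>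

lemma frac_finitely_generated:
  assumes I: "frac I"
  shows "\<exists>S. finite S \<and> S \<subseteq> I \<and> I \<subseteq> zspan S id"
proof -
  obtain d :: int where d: "d > 0" "\<And>x. x \<in> I \<Longrightarrow> of_int d * x \<in> \<O>"
    using frac_integer_denominator[OF I] by blast
  obtain D :: int where D: "D > 0" "\<And>x. x \<in> \<O> \<Longrightarrow> of_int D * x \<in> Z\<theta>"
    using O_denominator by blast
  obtain m :: int where m: "m > 0" "of_int m \<in> I"
    using frac_contains_integer[OF I] by blast
  define e where "e = D * d"
  have e: "e > 0" using D d by (simp add: e_def)
  have ex: "of_int e * x \<in> Z\<theta>" if "x \<in> I" for x
    using D(2)[OF d(2)[OF that]] by (simp add: e_def mult.assoc)
  define L where "L = e * m"
  have L: "L > 0" using e m by (simp add: L_def)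
  define R where "R = (\<lambda>c. (\<Sum>i<n. of_int (c i) * \<theta> ^ i) / of_int e) ` ({..<n} \<rightarrow>\<^sub>E {0..<L})"
  define S where "S = (R \<inter> I) \<union> (\<lambda>i. of_int m * \<theta> ^ i) ` {..<n}"
  have "finite R" unfolding R_def by (intro finite_imageI finite_PiE) auto
  hence fin: "finite S" by (simp add: S_def)
  have "of_int m * \<theta> ^ i \<in> I" for i
    using fracD(5)[OF I O_power[OF \<theta>_in_O] m(2)] by (simp add: mult.commute)
  hence sub: "S \<subseteq> I" by (auto simp: S_def)
  have "x \<in> zspan S id" if x: "x \<in> I" for x
  proof -
    obtain c :: "nat \<Rightarrow> int" where c: "of_int e * x = (\<Sum>i<n. of_int (c i) * \<theta> ^ i)"
      using ex[OF x] by (auto simp: zspan_def)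
    define y where "y = (\<Sum>i<n. of_int ((\<lambda>i\<in>{..<n}. c i mod L) i) * \<theta> ^ i) / of_int e"
    have ex_eq: "of_int e * x = of_int e * y + of_int L * (\<Sum>i<n. of_int (c i div L) * \<theta> ^ i)"
      using reduce_coords[of c L] e by (simp add: c y_def)
    hence xy: "x = y + (\<Sum>i<n. of_int (c i div L) * (of_int m * \<theta> ^ i))"
    proof -
      have "of_int e * x = of_int e * (y + (\<Sum>i<n. of_int (c i div L) * (of_int m * \<theta> ^ i)))"
        unfolding ex_eq by (simp add: L_def distrib_left sum_distrib_left mult_ac)
      thus ?thesis using e by simp
    qed
    have gS: "of_int m * \<theta> ^ i \<in> S" if "i < n" for i using that by (auto simp: S_def)
    have w: "(\<Sum>i<n. of_int (c i div L) * (of_int m * \<theta> ^ i)) \<in> zspan S id"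
    proof (intro zspan_sum)
      fix i assume "i \<in> {..<n}"
      hence "of_int m * \<theta> ^ i \<in> zspan S id" using zspan_gen[OF fin gS, of i id] by simp
      thus "of_int (c i div L) * (of_int m * \<theta> ^ i) \<in> zspan S id" by (rule zspan_scale)
    qed
    have wI: "(\<Sum>i<n. of_int (c i div L) * (of_int m * \<theta> ^ i)) \<in> I"
    proof (intro frac_sum[OF I])
      fix i assume "i \<in> {..<n}"
      hence "of_int m * \<theta> ^ i \<in> I" using sub gS by blast
      thus "of_int (c i div L) * (of_int m * \<theta> ^ i) \<in> I" by (rule fracD(5)[OF I O_int])
    qed
    have "y \<in> I" using xy frac_diff[OF I x wI] by simp
    moreover have "y \<in> R" unfolding R_def y_def using L by (intro imageI restrict_PiE_iff[THEN iffD2]) auto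
    ultimately have "y \<in> S" by (simp add: S_def)
    hence "y \<in> zspan S id" using zspan_gen[OF fin, of y id] by simp
    thus ?thesis unfolding xy using w by (rule zspan_add)
  qed
  thus ?thesis using fin sub by blast
qed

text \<open>Multiplication by \<open>b\<close> preserves a nonzero finitely generated additive
  group, so \<open>algebraic_int_if_stable\<close> applies.\<close>

lemma multiplier_integral:
  assumes I: "frac I" and b: "b \<in> K" "\<And>x. x \<in> I \<Longrightarrow> b * x \<in> I"
  shows "b \<in> \<O>"
proof -
  obtain S where S: "finite S" "S \<subseteq> I" "I \<subseteq> zspan S id"
    using frac_finitely_generated[OF I] by blast
  have "\<exists>s\<in>S. s \<noteq> 0"
  proof (rule ccontr)
    assume "\<not> ?thesis"
    hence "zspan S id \<subseteq> {0}" by (auto simp: zspan_def intro!: sum.neutral)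
    thus False using S frac_nonzero[OF I] by blast
  qed
  then obtain s where "s \<in> S" "s \<noteq> 0" by blast
  have "algebraic_int b"
  proof (rule algebraic_int_if_stable[of S s id])
    fix u assume "u \<in> S"
    hence "b * u \<in> I" using S(2) b(2)[of u] by blast
    thus "b * id u \<in> zspan S id" using S(3) by auto
  qed (use S(1) \<open>s \<in> S\<close> \<open>s \<noteq> 0\<close> in simp_all)
  thus ?thesis using b by (simp add: O_iff)
qed

subsection \<open>Cancellation\<close>

definition ospan :: "complex set \<Rightarrow> complex set" where
  "ospan S = {\<Sum>s\<in>S. g s * s | g. \<forall>s. g s \<in> \<O>}"

lemma ospan_add: "x \<in> ospan S \<Longrightarrow> y \<in> ospan S \<Longrightarrow> x + y \<in> ospan S"
proof -
  assume "x \<in> ospan S" "y \<in> ospan S"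
  then obtain g k where "\<forall>s. g s \<in> \<O>" "\<forall>s. k s \<in> \<O>" "x = (\<Sum>s\<in>S. g s * s)" "y = (\<Sum>s\<in>S. k s * s)"
    by (auto simp: ospan_def)
  thus ?thesis unfolding ospan_def mem_Collect_eq
    by (intro exI[of _ "\<lambda>s. g s + k s"]) (simp add: O_add sum.distrib distrib_right)
qed

lemma ospan_scale: "x \<in> ospan S \<Longrightarrow> a \<in> \<O> \<Longrightarrow> a * x \<in> ospan S"
proof -
  assume "x \<in> ospan S" "a \<in> \<O>"
  then obtain g where "\<forall>s. g s \<in> \<O>" "x = (\<Sum>s\<in>S. g s * s)"
    by (auto simp: ospan_def)
  thus ?thesis unfolding ospan_def mem_Collect_eq using \<open>a \<in> \<O>\<close>
    by (intro exI[of _ "\<lambda>s. a * g s"]) (simp add: O_mult sum_distrib_left mult.assoc)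
qed

lemma ospan_insertE:
  assumes "x \<in> ospan (insert s S)" "finite S" "s \<notin> S"
  obtains a t where "a \<in> \<O>" "t \<in> ospan S" "x = a * s + t"
proof -
  obtain g where g: "\<forall>s. g s \<in> \<O>" "x = (\<Sum>s\<in>insert s S. g s * s)"
    using assms by (auto simp: ospan_def)
  have "(\<Sum>s\<in>S. g s * s) \<in> ospan S" using g by (auto simp: ospan_def)
  thus ?thesis using that[of "g s"] g assms by simp
qed

lemma zspan_subset_ospan: "zspan S id \<subseteq> ospan S"
proof
  fix x assume "x \<in> zspan S id"
  then obtain c :: "complex \<Rightarrow> int" where "x = (\<Sum>s\<in>S. of_int (c s) * s)" by (auto simp: zspan_def)
  thus "x \<in> ospan S" unfolding ospan_def mem_Collect_eq by (intro exI[of _ "\<lambda>s. of_int (c s)"]) simp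
qed

text \<open>Nakayama's lemma, eliminating one generator at a time.\<close>

lemma nakayama:
  assumes A: "frac A" and B: "frac B" "B \<subseteq> \<O>" and AB: "iprod A B = A"
  shows "finite S \<Longrightarrow> S \<subseteq> A \<Longrightarrow> c \<in> \<O> \<Longrightarrow> 1 - c \<in> B \<Longrightarrow> (\<And>a. a \<in> A \<Longrightarrow> c * a \<in> ospan S) \<Longrightarrow> 1 \<in> B"
proof (induction S arbitrary: c rule: finite_induct)
  case empty
  obtain a where "a \<in> A" "a \<noteq> 0" using frac_nonzero[OF A] by blast
  hence "c = 0" using empty.prems(4)[of a] by (simp add: ospan_def)
  thus ?case using empty.prems by simp
next
  case (insert s S)
  have "\<exists>b\<in>B. \<exists>t\<in>ospan S. c * x = b * s + t" if "x \<in> iprod A B" for x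
    using that
  proof (induction rule: iprod_induct)
    case (mult a b)
    obtain g t where g: "g \<in> \<O>" "t \<in> ospan S" "c * a = g * s + t"
      using insert.prems(4)[OF mult(1)] insert.hyps by (auto elim: ospan_insertE)
    have "c * (a * b) = g * b * s + b * t"
      using g(3) by (simp add: mult.assoc[symmetric]) (simp add: algebra_simps)
    moreover have "g * b \<in> B" using fracD(5)[OF B(1) g(1) mult(2)] .
    moreover have "b * t \<in> ospan S" using mult(2) B(2) g(2) by (intro ospan_scale) auto
    ultimately show ?case by blast
  next
    case (add x y)
    then obtain b t b' t' where *: "b \<in> B" "t \<in> ospan S" "c * x = b * s + t"
      "b' \<in> B" "t' \<in> ospan S" "c * y = b' * s + t'" by blast
    have "c * (x + y) = (b + b') * s + (t + t')" using * by (simp add: algebra_simps)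
    moreover have "b + b' \<in> B" "t + t' \<in> ospan S"
      using * by (auto intro: fracD(4)[OF B(1)] ospan_add)
    ultimately show ?case by blast
  qed
  then obtain b t where b: "b \<in> B" "t \<in> ospan S" "c * s = b * s + t"
    using insert.prems(1) AB by blast
  have bO: "b \<in> \<O>" using b B by blast
  show ?case
  \<comment> \<open>The relation \<open>(c - b) * s = t\<close> puts a multiple of \<open>s\<close>
    into the span of the other generators, and \<open>c - b\<close> is still congruent to
    \<open>1\<close> modulo \<open>B\<close>, so the new multiplier keeps the invariant.\<close>
  proof (rule insert.IH[of "(c - b) * c"])
    show "S \<subseteq> A" using insert.prems by simp
    show "(c - b) * c \<in> \<O>" using insert.prems(2) bO by (intro O_mult O_diff)
    have "(1 + c) * (1 - c) \<in> B" "c * b \<in> B"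
      using insert.prems(2,3) b by (auto intro!: fracD(5)[OF B(1)] O_add)
    from fracD(4)[OF B(1) this] show "1 - (c - b) * c \<in> B" by (simp add: algebra_simps)
    fix a assume a: "a \<in> A"
    obtain g t' where g: "g \<in> \<O>" "t' \<in> ospan S" "c * a = g * s + t'"
      using insert.prems(4)[OF a] insert.hyps by (auto elim: ospan_insertE)
    have "(c - b) * c * a = g * ((c - b) * s) + (c - b) * t'"
      using g(3) by (simp add: mult.assoc) (simp add: algebra_simps)
    also have "(c - b) * s = t" using b(3) by (simp add: algebra_simps)
    finally show "(c - b) * c * a \<in> ospan S"
      using g b bO insert.prems(2) by (simp add: ospan_add ospan_scale O_diff)
  qed
qed

text \<open>Elements of \<open>B\<close> multiply \<open>A\<close> into itself, so they are
  integral; Nakayama's lemma with multiplier \<open>1\<close> gives \<open>1 \<in> B\<close>.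
  Together with the finiteness of classes this will make ideals invertible.\<close>

lemma iprod_cancel:
  assumes A: "frac A" and B: "frac B" and AB: "iprod A B = A"
  shows "B = \<O>"
proof
  show sub: "B \<subseteq> \<O>"
  proof
    fix b assume b: "b \<in> B"
    show "b \<in> \<O>"
    proof (rule multiplier_integral[OF A])
      show "b \<in> K" using fracD(1)[OF B] b by blast
      fix x assume "x \<in> A"
      hence "x * b \<in> iprod A B" using b by (rule iprod_mult)
      thus "b * x \<in> A" unfolding AB by (simp add: mult.commute)
    qed
  qed
  obtain S where S: "finite S" "S \<subseteq> A" "A \<subseteq> zspan S id"
    using frac_finitely_generated[OF A] by blast
  have "1 \<in> B"
  proof (rule nakayama[OF A B sub AB, of S 1])
    show "1 * a \<in> ospan S" if "a \<in> A" for a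
      using that S(3) zspan_subset_ospan[of S] by auto
  qed (use S fracD(2)[OF B] in simp_all)
  thus "\<O> \<subseteq> B" using fracD(5)[OF B _ \<open>1 \<in> B\<close>] by force
qed

subsection \<open>Finitely many classes\<close>

lemma cmod_of_rat: "cmod (of_rat r) = \<bar>of_rat r\<bar>"
proof -
  obtain a b where "quotient_of r = (a, b)" by force
  hence "r = of_int a / of_int b" using quotient_of_div by blast
  thus ?thesis by (simp add: of_rat_divide norm_divide)
qed

text \<open>Dirichlet's box principle: among the multiples of \<open>\<gamma>\<close> by
  \<open>0, ..., m ^ n\<close>, two have coordinates with fractional parts in the same cell of side
  \<open>1 / m\<close>. Their difference is within \<open>C / m\<close> of some
  \<open>\<omega>\<close> at every conjugate, and \<open>m\<close> exceeds \<open>C\<close>.\<close>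

lemma approximation:
  "\<exists>M::nat. M > 0 \<and> (\<forall>\<gamma>\<in>K. \<exists>k\<in>{1..M}. \<exists>\<omega>\<in>\<O>. cmod (norm_K (of_nat k * \<gamma> - \<omega>)) < 1)"
proof -
  define C where "C = (\<Sum>j<n. \<Sum>i<n. cmod (conj j \<theta>) ^ i)"
  define m where "m = nat \<lceil>C\<rceil> + 1"
  have m: "m > 0" "C < of_nat m" by (auto simp: m_def) linarith
  have "\<exists>k\<in>{1..m ^ n}. \<exists>\<omega>\<in>\<O>. cmod (norm_K (of_nat k * \<gamma> - \<omega>)) < 1" if "\<gamma> \<in> K" for \<gamma>
  proof -
    obtain c :: "nat \<Rightarrow> rat" where c: "\<gamma> = (\<Sum>i<n. of_rat (c i) * \<theta> ^ i)"
      using \<open>\<gamma> \<in> K\<close> unfolding K_eq by blast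
    define cell where "cell k = (\<lambda>i\<in>{..<n}. \<lfloor>of_nat m * Archimedean_Field.frac (of_nat k * c i)\<rfloor>)" for k :: nat
    have cell: "cell k \<in> {..<n} \<rightarrow>\<^sub>E {0..<int m}" for k
    proof -
      have "\<lfloor>of_nat m * Archimedean_Field.frac (of_nat k * c i)\<rfloor> \<in> {0..<int m}" for i
        using frac_lt_1[of "of_nat k * c i"] frac_ge_0[of "of_nat k * c i"] m(1)
        by (auto simp: floor_less_iff)
      thus ?thesis by (auto simp: cell_def)
    qed
    have "\<not> inj_on cell {0..m ^ n}"
    proof
      assume inj: "inj_on cell {0..m ^ n}"
      have "card {0..m ^ n} \<le> card ({..<n} \<rightarrow>\<^sub>E {0..<int m})"
        using cell by (intro card_inj_on_le[OF inj] finite_PiE) auto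
      thus False by (simp add: card_PiE)
    qed
    then obtain k k' where k: "k < k'" "k' \<le> m ^ n" "cell k = cell k'"
      by (auto simp: inj_on_def) (metis linorder_neqE_nat)
    define r where "r i = Archimedean_Field.frac (of_nat k' * c i) - Archimedean_Field.frac (of_nat k * c i)" for i
    define \<omega> where "\<omega> = (\<Sum>i<n. of_int (\<lfloor>of_nat k' * c i\<rfloor> - \<lfloor>of_nat k * c i\<rfloor>) * \<theta> ^ i)"
    have r: "\<bar>of_rat (r i) :: real\<bar> \<le> 1 / of_nat m" if "i < n" for i
    proof -
      have "\<lfloor>of_nat m * Archimedean_Field.frac (of_nat k * c i)\<rfloor> = \<lfloor>of_nat m * Archimedean_Field.frac (of_nat k' * c i)\<rfloor>"
        using fun_cong[OF k(3), of i] that by (simp add: cell_def)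
      hence "\<bar>of_nat m * r i\<bar> \<le> 1" unfolding r_def right_diff_distrib by linarith
      hence "\<bar>r i\<bar> \<le> 1 / of_nat m" using m(1) by (simp add: abs_mult field_simps)
      hence "of_rat \<bar>r i\<bar> \<le> (of_rat (1 / of_nat m) :: real)" by (simp only: of_rat_less_eq)
      thus ?thesis by (simp add: of_rat_divide)
    qed
    have rc: "r i = of_nat (k' - k) * c i - of_int (\<lfloor>of_nat k' * c i\<rfloor> - \<lfloor>of_nat k * c i\<rfloor>)" for i
      using k(1) by (simp add: r_def Archimedean_Field.frac_def of_nat_diff algebra_simps)
    have eq: "of_nat (k' - k) * \<gamma> - \<omega> = (\<Sum>i<n. of_rat (r i) * \<theta> ^ i)"
      unfolding c \<omega>_def sum_distrib_left sum_subtractf[symmetric] rc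
      by (intro sum.cong refl) (simp only: of_rat_diff of_rat_mult of_rat_of_nat_eq of_rat_of_int_eq left_diff_distrib mult.assoc)
    have small: "cmod (conj j (of_nat (k' - k) * \<gamma> - \<omega>)) < 1" if "j < n" for j
    proof -
      have "cmod (conj j (of_nat (k' - k) * \<gamma> - \<omega>)) \<le> (\<Sum>i<n. cmod (of_rat (r i) * conj j \<theta> ^ i))"
        unfolding eq conj_coords by (rule norm_sum)
      also have "\<dots> \<le> (\<Sum>i<n. 1 / of_nat m * cmod (conj j \<theta>) ^ i)"
      proof (rule sum_mono)
        fix i assume "i \<in> {..<n}"
        have "cmod (of_rat (r i)) = \<bar>of_rat (r i)\<bar>" by (rule cmod_of_rat)
        thus "cmod (of_rat (r i) * conj j \<theta> ^ i) \<le> 1 / of_nat m * cmod (conj j \<theta>) ^ i"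
          using r[of i] \<open>i \<in> {..<n}\<close> unfolding norm_mult norm_power
          by (intro mult_right_mono) auto
      qed
      also have "\<dots> = (\<Sum>i<n. cmod (conj j \<theta>) ^ i) / of_nat m"
        by (simp add: sum_divide_distrib)
      also have "\<dots> \<le> C / of_nat m"
        unfolding C_def using that
        by (intro divide_right_mono member_le_sum[where f = "\<lambda>j. \<Sum>i<n. cmod (conj j \<theta>) ^ i"]) (auto intro!: sum_nonneg)
      also have "\<dots> < 1" using m by simp
      finally show ?thesis .
    qed
    obtain l where l: "n = Suc l" using n_pos gr0_conv_Suc by auto
    define u where "u j = cmod (conj j (of_nat (k' - k) * \<gamma> - \<omega>))" for j
    have "(\<Prod>j<n. u j) = (\<Prod>j<l. u j) * u l" by (simp only: l prod.lessThan_Suc)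
    also have "\<dots> \<le> 1 * u l"
      using small l by (intro mult_right_mono prod_le_1) (auto simp: u_def less_imp_le)
    also have "\<dots> < 1" using small[of l] l by (simp add: u_def)
    finally have "cmod (norm_K (of_nat (k' - k) * \<gamma> - \<omega>)) < 1"
      by (simp add: norm_K_def prod_norm u_def)
    moreover have "\<omega> \<in> \<O>"
      unfolding \<omega>_def by (intro O_sum O_mult O_int O_power \<theta>_in_O)
    moreover have "k' - k \<in> {1..m ^ n}" using k by auto
    ultimately show ?thesis by blast
  qed
  thus ?thesis using m(1) by (intro exI[of _ "m ^ n"]) auto
qed

text \<open>Division with remainder up to a bounded factor. If \<open>\<beta>\<close> has least norm
  among the nonzero elements of \<open>I\<close>, the remainder
  \<open>of_nat k * \<alpha> - \<omega> * \<beta>\<close> has smaller norm and vanishes. The factor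
  \<open>k\<close> varies with \<open>\<alpha>\<close> but is bounded, so a factorial covers all
  cases.\<close>

lemma nearly_principal:
  "\<exists>M::nat. M > 0 \<and> (\<forall>I. frac I \<longrightarrow> (\<exists>\<beta>\<in>I. \<beta> \<noteq> 0 \<and> (\<forall>\<alpha>\<in>I. of_nat M * \<alpha> \<in> (*) \<beta> ` \<O>)))"
proof -
  obtain M :: nat where M: "M > 0"
    "\<And>\<gamma>. \<gamma> \<in> K \<Longrightarrow> \<exists>k\<in>{1..M}. \<exists>\<omega>\<in>\<O>. cmod (norm_K (of_nat k * \<gamma> - \<omega>)) < 1"
    using approximation by blast
  have "\<exists>\<beta>\<in>I. \<beta> \<noteq> 0 \<and> (\<forall>\<alpha>\<in>I. of_nat (fact M) * \<alpha> \<in> (*) \<beta> ` \<O>)" if I: "frac I" for I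
  proof -
    obtain d where d: "d \<in> \<O>" "d \<noteq> 0" "\<And>x. x \<in> I \<Longrightarrow> d * x \<in> \<O>"
      using frac_denominator[OF I] by blast
    \<comment> \<open>The factor \<open>d\<close> makes these norms rational integers, so that a
      least one exists.\<close>
    define \<nu> where "\<nu> x = nat \<lfloor>cmod (norm_K (d * x))\<rfloor>" for x
    have \<nu>: "real (\<nu> x) = cmod (norm_K (d * x))" if x: "x \<in> I" for x
    proof -
      obtain z where "norm_K (d * x) = of_int z" using norm_K_Ints[OF d(3)[OF x]] by (rule Ints_cases)
      thus ?thesis by (simp add: \<nu>_def)
    qed
    obtain a where "a \<in> I \<and> a \<noteq> 0" using frac_nonzero[OF I] by blast
    from ex_has_least_nat[of "\<lambda>x. x \<in> I \<and> x \<noteq> 0", OF this, of \<nu>]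
    obtain \<beta> where \<beta>: "\<beta> \<in> I" "\<beta> \<noteq> 0" "\<And>y. y \<in> I \<Longrightarrow> y \<noteq> 0 \<Longrightarrow> \<nu> \<beta> \<le> \<nu> y" by blast
    have K: "x \<in> K" if "x \<in> I" for x using fracD(1)[OF I] that by blast
    have "of_nat (fact M) * \<alpha> \<in> (*) \<beta> ` \<O>" if \<alpha>: "\<alpha> \<in> I" for \<alpha>
    proof -
      obtain k \<omega> where k: "k \<in> {1..M}" "\<omega> \<in> \<O>" "cmod (norm_K (of_nat k * (\<alpha> / \<beta>) - \<omega>)) < 1"
        using M(2)[OF K_divide[OF K[OF \<alpha>] K[OF \<beta>(1)]]] by blast
      define \<eta> where "\<eta> = of_nat k * \<alpha> - \<omega> * \<beta>"
      have \<eta>I: "\<eta> \<in> I"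
        unfolding \<eta>_def using k(2) \<alpha> \<beta>(1) by (intro frac_diff[OF I] fracD(5)[OF I]) auto
      have "\<eta> = 0"
      proof (rule ccontr)
        assume "\<eta> \<noteq> 0"
        have "d * \<eta> = (d * \<beta>) * (of_nat k * (\<alpha> / \<beta>) - \<omega>)"
          using \<beta>(2) by (simp add: \<eta>_def field_simps)
        moreover have "d * \<beta> \<in> K" "of_nat k * (\<alpha> / \<beta>) - \<omega> \<in> K"
          using K[OF \<alpha>] K[OF \<beta>(1)] O_K[OF d(1)] O_K[OF k(2)] by (simp_all add: K_mult K_diff K_divide)
        ultimately have "norm_K (d * \<eta>) = norm_K (d * \<beta>) * norm_K (of_nat k * (\<alpha> / \<beta>) - \<omega>)"
          by (simp only: norm_K_mult)
        hence "real (\<nu> \<eta>) = real (\<nu> \<beta>) * cmod (norm_K (of_nat k * (\<alpha> / \<beta>) - \<omega>))"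
          by (simp add: \<nu> \<eta>I \<beta>(1) norm_mult)
        moreover have "real (\<nu> \<beta>) > 0"
          using \<beta> d norm_K_eq_0_iff[OF O_K[OF d(3)[OF \<beta>(1)]]] by (simp add: \<nu>)
        ultimately have "real (\<nu> \<eta>) < real (\<nu> \<beta>)"
          using k(3) by (metis mult.right_neutral mult_strict_left_mono)
        thus False using \<beta>(3)[OF \<eta>I \<open>\<eta> \<noteq> 0\<close>] by simp
      qed
      have "k dvd fact M" using k(1) by (intro dvd_fact) auto
      then obtain l where "fact M = k * l" by blast
      hence "of_nat (fact M) * \<alpha> = of_nat l * (of_nat k * \<alpha>)"
        by (simp only: of_nat_mult mult_ac)
      also have "of_nat k * \<alpha> = \<omega> * \<beta>" using \<open>\<eta> = 0\<close> by (simp add: \<eta>_def)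
      finally have "of_nat (fact M) * \<alpha> = \<beta> * (of_nat l * \<omega>)" by (simp add: mult_ac)
      thus ?thesis using k(2) by (auto intro!: imageI O_mult)
    qed
    thus ?thesis using \<beta> by blast
  qed
  thus ?thesis by (intro exI[of _ "fact M"]) auto
qed

text \<open>Such an ideal is determined by which of finitely many representatives modulo
  \<open>M\<close> it contains. The division by \<open>D\<close> in \<open>e\<close> accounts for
  integers of \<open>K\<close> outside \<open>Z\<theta>\<close>.\<close>

lemma finite_ideals_containing:
  fixes M :: nat
  assumes "M > 0"
  shows "finite {J. frac J \<and> of_nat M \<in> J \<and> J \<subseteq> \<O>}" (is "finite ?\<J>")
proof -
  obtain D :: int where D: "D > 0" "\<And>x. x \<in> \<O> \<Longrightarrow> of_int D * x \<in> Z\<theta>"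
    using O_denominator by blast
  define L where "L = int M * D"
  have L: "L > 0" using D assms by (simp add: L_def)
  define e where "e c = (\<Sum>i<n. of_int (c i) * \<theta> ^ i) / of_int D" for c :: "nat \<Rightarrow> int"
  define \<phi> where "\<phi> J = {c \<in> {..<n} \<rightarrow>\<^sub>E {0..<L}. e c \<in> J}" for J
  have "\<phi> ` ?\<J> \<subseteq> Pow ({..<n} \<rightarrow>\<^sub>E {0..<L})" by (auto simp: \<phi>_def)
  hence "finite (\<phi> ` ?\<J>)" by (rule finite_subset) (simp add: finite_PiE)
  moreover have "inj_on \<phi> ?\<J>"
  proof (rule inj_onI)
    have sub: "J \<subseteq> J'" if J: "J \<in> ?\<J>" "J' \<in> ?\<J>" "\<phi> J = \<phi> J'" for J J'
    proof
      fix x assume x: "x \<in> J"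
      hence "x \<in> \<O>" using J by blast
      then obtain c :: "nat \<Rightarrow> int" where c: "of_int D * x = (\<Sum>i<n. of_int (c i) * \<theta> ^ i)"
        using D(2)[of x] by (auto simp: zspan_def)
      define c' where "c' = (\<lambda>i\<in>{..<n}. c i mod L)"
      define w where "w = (\<Sum>i<n. of_int (c i div L) * \<theta> ^ i)"
      have "of_int D * x = of_int D * e c' + of_int L * w"
        using reduce_coords[of c L] D by (simp add: c e_def c'_def w_def)
      hence xe: "x = e c' + w * of_nat M"
      proof -
        have "of_int D * x = of_int D * (e c' + w * of_nat M)"
          unfolding \<open>of_int D * x = of_int D * e c' + _\<close> by (simp add: L_def distrib_left mult_ac)
        thus ?thesis using D by simp
      qed
      have "w \<in> \<O>" unfolding w_def by (intro O_sum O_mult O_int O_power \<theta>_in_O)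
      hence w: "w * of_nat M \<in> J" "w * of_nat M \<in> J'"
        using J fracD(5)[of J w] fracD(5)[of J' w] by simp_all
      have "c' \<in> {..<n} \<rightarrow>\<^sub>E {0..<L}" using L by (auto simp: c'_def)
      moreover have "e c' \<in> J" using frac_diff[of J x "w * of_nat M"] w x J xe by simp
      ultimately have "c' \<in> \<phi> J" by (simp add: \<phi>_def)
      hence "c' \<in> \<phi> J'" using J by simp
      hence eJ: "e c' \<in> J'" by (simp add: \<phi>_def)
      have "frac J'" using J(2) by simp
      from fracD(4)[OF this eJ w(2)] show "x \<in> J'" by (simp only: xe)
    qed
    show "J = J'" if "J \<in> ?\<J>" "J' \<in> ?\<J>" "\<phi> J = \<phi> J'" for J J'
      using sub[OF that] sub[OF that(2,1) that(3)[symmetric]] by (rule subset_antisym)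
  qed
  ultimately show ?thesis by (rule finite_imageD)
qed

text \<open>Scaling by \<open>of_nat M / \<beta>\<close> moves any fractional ideal to one that
  contains \<open>M\<close> and lies in \<open>\<O>\<close>; of these there are finitely
  many.\<close>

lemma finite_classes:
  "\<exists>\<J>. finite \<J> \<and> (\<forall>J\<in>\<J>. frac J) \<and> (\<forall>I. frac I \<longrightarrow> (\<exists>J\<in>\<J>. \<exists>x\<in>K. x \<noteq> 0 \<and> I = (*) x ` J))"
proof -
  obtain M :: nat where M: "M > 0"
    "\<And>I. frac I \<Longrightarrow> \<exists>\<beta>\<in>I. \<beta> \<noteq> 0 \<and> (\<forall>\<alpha>\<in>I. of_nat M * \<alpha> \<in> (*) \<beta> ` \<O>)"
    using nearly_principal by blast
  define \<J> where "\<J> = {J. frac J \<and> of_nat M \<in> J \<and> J \<subseteq> \<O>}"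
  have "\<exists>J\<in>\<J>. \<exists>x\<in>K. x \<noteq> 0 \<and> I = (*) x ` J" if I: "frac I" for I
  proof -
    obtain \<beta> where \<beta>: "\<beta> \<in> I" "\<beta> \<noteq> 0" "\<And>\<alpha>. \<alpha> \<in> I \<Longrightarrow> of_nat M * \<alpha> \<in> (*) \<beta> ` \<O>"
      using M(2)[OF I] by blast
    have K: "\<beta> \<in> K" using fracD(1)[OF I] \<beta> by blast
    define J where "J = (*) (of_nat M / \<beta>) ` I"
    have "frac J" unfolding J_def using M(1) \<beta> K by (intro frac_scale[OF I] K_divide) auto
    moreover have "of_nat M \<in> J" unfolding J_def using \<beta> by (intro image_eqI[of _ _ \<beta>]) auto
    moreover have "J \<subseteq> \<O>"
    proof
      fix y assume "y \<in> J"
      then obtain \<alpha> where \<alpha>: "\<alpha> \<in> I" "y = of_nat M / \<beta> * \<alpha>" by (auto simp: J_def)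
      obtain w where w: "w \<in> \<O>" "of_nat M * \<alpha> = \<beta> * w" using \<beta>(3)[OF \<alpha>(1)] by blast
      hence "y = w" using \<alpha> \<beta>(2) by (simp add: field_simps)
      thus "y \<in> \<O>" using w by simp
    qed
    moreover have "I = (*) (\<beta> / of_nat M) ` J"
      using M(1) \<beta>(2) unfolding J_def scale_scale by simp
    ultimately show ?thesis
      using M(1) \<beta>(2) K by (intro bexI[of _ J] bexI[of _ "\<beta> / of_nat M"]) (auto simp: \<J>_def intro: K_divide)
  qed
  moreover have "finite \<J>" unfolding \<J>_def by (rule finite_ideals_containing[OF M(1)])
  moreover have "\<And>J. J \<in> \<J> \<Longrightarrow> frac J" by (simp add: \<J>_def)
  ultimately show ?thesis by (intro exI[of _ \<J>] conjI ballI allI impI)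
qed

end

context cyclic_field
begin

subsection \<open>The class group\<close>

lemma FG_simps [simp]: "carrier FG = {I. frac I}" "monoid.mult FG = iprod" "one FG = \<O>"
  by (simp_all add: fractional_ideal_group_def)

lemma comm_monoid_FG: "comm_monoid FG"
  by (rule comm_monoidI) (simp_all add: frac_iprod frac_O iprod_assoc iprod_O, rule iprod_commute)

text \<open>Two powers of \<open>I\<close> lie in the same class: P j is w times P i with
  \<open>i < j\<close>. Cancelling \<open>P i\<close> makes \<open>P (j - i)\<close> principal,
  which exhibits an inverse of \<open>I\<close>. Finiteness of the classes thus precedes the group
  structure and yields it.\<close>

lemma frac_inverse_ex:
  assumes I: "frac I"
  shows "\<exists>J. frac J \<and> iprod J I = \<O>"
proof -
  interpret comm_monoid FG by (rule comm_monoid_FG)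
  define P where "P k = I [^]\<^bsub>FG\<^esub> (k :: nat)" for k
  have P: "frac (P k)" for k using nat_pow_closed[of I k] I by (simp add: P_def)
  have Pm: "iprod (P i) (P j) = P (i + j)" for i j
    using nat_pow_mult[of I i j] I by (simp add: P_def)
  from finite_classes obtain \<J> where \<J>': "finite \<J> \<and> (\<forall>J\<in>\<J>. frac J) \<and>
    (\<forall>I. frac I \<longrightarrow> (\<exists>J\<in>\<J>. \<exists>x\<in>K. x \<noteq> 0 \<and> I = (*) x ` J))" ..
  note \<J> = conjunct1[OF \<J>'] bspec[OF conjunct1[OF conjunct2[OF \<J>']]]
    mp[OF spec[OF conjunct2[OF conjunct2[OF \<J>']]]]
  define Q where "Q k z \<longleftrightarrow> fst z \<in> \<J> \<and> snd z \<in> K \<and> snd z \<noteq> 0 \<and> P k = (*) (snd z) ` fst z" for k z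
  have "\<exists>z. Q k z" for k
  proof -
    obtain J x where "J \<in> \<J>" "x \<in> K" "x \<noteq> 0" "P k = (*) x ` J"
      using \<J>(3)[OF P[of k]] by blast
    thus ?thesis by (intro exI[of _ "(J, x)"]) (simp add: Q_def)
  qed
  then obtain z where z: "\<And>k. Q k (z k)" by metis
  define J where "J k = fst (z k)" for k
  define x where "x k = snd (z k)" for k
  have Jx: "J k \<in> \<J>" "x k \<in> K" "x k \<noteq> 0" "P k = (*) (x k) ` J k" for k
    using z[of k] by (simp_all add: J_def x_def Q_def)
  have "\<not> inj J"
  proof
    assume "inj J"
    moreover have "finite (range J)" using Jx(1) \<J>(1) by (meson finite_subset image_subsetI)
    ultimately show False using finite_imageD infinite_UNIV_nat by blast
  qed
  then obtain a b where ab: "a \<noteq> b" "J a = J b" unfolding inj_def by blast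
  define i where "i = min a b"
  define j where "j = max a b"
  have ij: "i < j" "J i = J j" using ab by (auto simp: i_def j_def min_def max_def)
  define w where "w = x j / x i"
  have w: "w \<in> K" "w \<noteq> 0" using Jx by (auto simp: w_def intro: K_divide)
  have "P j = (*) (x j) ` J i" using Jx(4)[of j] ij(2) by simp
  also have "x j = w * x i" using Jx(3)[of i] by (simp add: w_def)
  finally have Pj: "P j = (*) w ` P i" by (simp only: Jx(4)[of i] scale_scale)
  have "iprod (P i) ((*) (inverse w) ` P (j - i)) = (*) (inverse w) ` iprod (P (j - i)) (P i)"
    by (subst iprod_commute) (rule iprod_scale)
  also have "iprod (P (j - i)) (P i) = P j" using Pm[of "j - i" i] ij(1) by simp
  also have "(*) (inverse w) ` P j = P i" using w(2) by (simp add: Pj scale_scale)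
  finally have "iprod (P i) ((*) (inverse w) ` P (j - i)) = P i" .
  moreover have "frac ((*) (inverse w) ` P (j - i))"
    using w by (intro frac_scale P) (auto intro: K_inverse)
  ultimately have "(*) (inverse w) ` P (j - i) = \<O>"
    by (rule iprod_cancel[OF P, rotated])
  moreover have "P (j - i) = iprod (P (j - i - 1)) I"
  proof -
    have "P 1 = I" using I by (simp add: P_def iprod_O)
    moreover have "j - i - 1 + 1 = j - i" using ij(1) by simp
    ultimately show ?thesis using Pm[of "j - i - 1" 1] by metis
  qed
  ultimately have "iprod ((*) (inverse w) ` P (j - i - 1)) I = \<O>"
    by (simp add: iprod_scale)
  moreover have "frac ((*) (inverse w) ` P (j - i - 1))"
    using w by (intro frac_scale P K_inverse) auto
  ultimately show ?thesis by blast
qed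

lemma comm_group_FG: "comm_group FG"
proof -
  interpret comm_monoid FG by (rule comm_monoid_FG)
  show ?thesis
    by (rule comm_groupI)
      (simp_all add: frac_iprod frac_O iprod_assoc iprod_O frac_inverse_ex, rule iprod_commute)
qed

abbreviation PF :: "complex set set" where "PF \<equiv> principal_fractional_ideals K"

lemma PF_I: "x \<in> K \<Longrightarrow> x \<noteq> 0 \<Longrightarrow> (*) x ` \<O> \<in> PF"
  unfolding principal_fractional_ideals_def by blast

lemma PF_E:
  assumes "I \<in> PF" obtains x where "x \<in> K" "x \<noteq> 0" "I = (*) x ` \<O>"
  using assms unfolding principal_fractional_ideals_def by blast

lemma PF_frac: "I \<in> PF \<Longrightarrow> frac I"
  by (elim PF_E) (simp add: frac_scale frac_O)

lemma O_PF: "\<O> \<in> PF"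
  using PF_I[of 1] by simp

lemma PF_subgroup: "subgroup PF FG"
proof -
  interpret comm_group FG by (rule comm_group_FG)
  have inv: "(*) (inverse x) ` \<O> = inv\<^bsub>FG\<^esub> ((*) x ` \<O>)" if "x \<in> K" "x \<noteq> 0" for x
  proof (rule inv_equality[symmetric])
    have "frac ((*) x ` \<O>)" using that by (intro frac_scale frac_O)
    thus "(*) (inverse x) ` \<O> \<otimes>\<^bsub>FG\<^esub> (*) x ` \<O> = \<one>\<^bsub>FG\<^esub>"
      using that by (simp add: iprod_scale iprod_O scale_scale)
  qed (use that in \<open>simp_all add: frac_scale frac_O K_inverse\<close>)
  show ?thesis
  proof (rule subgroupI)
    show "PF \<subseteq> carrier FG" using PF_frac by auto
    show "PF \<noteq> {}" using O_PF by blast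
    show "inv\<^bsub>FG\<^esub> a \<in> PF" if a: "a \<in> PF" for a
    proof -
      obtain x where x: "x \<in> K" "x \<noteq> 0" "a = (*) x ` \<O>" using a by (rule PF_E)
      have "inv\<^bsub>FG\<^esub> a = (*) (inverse x) ` \<O>" using inv[OF x(1,2)] x(3) by simp
      thus ?thesis using PF_I[OF K_inverse[OF x(1)]] x(2) by simp
    qed
    show "a \<otimes>\<^bsub>FG\<^esub> b \<in> PF" if a: "a \<in> PF" and b: "b \<in> PF" for a b
    proof -
      obtain x where x: "x \<in> K" "x \<noteq> 0" "a = (*) x ` \<O>" using a by (rule PF_E)
      obtain y where y: "y \<in> K" "y \<noteq> 0" "b = (*) y ` \<O>" using b by (rule PF_E)
      have "iprod a b = (*) (x * y) ` \<O>"
        using iprod_principal[OF PF_frac[OF b], of x] by (simp add: x(3) y(3) scale_scale)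
      thus ?thesis using PF_I[OF K_mult[OF x(1) y(1)]] x(2) y(2) by simp
    qed
  qed
qed

lemma PF_normal: "PF \<lhd> FG"
  using comm_group.normal_iff_subgroup[OF comm_group_FG] PF_subgroup by simp

lemma comm_group_class_group: "comm_group (class_group K)"
  unfolding class_group_def by (rule comm_group.abelian_FactGroup[OF comm_group_FG PF_subgroup])

lemma class_group_carrier: "carrier (class_group K) = ideal_class K ` {I. frac I}"
  by (simp add: class_group_def carrier_FactGroup ideal_class_def)

lemma ideal_class_mult:
  "frac I \<Longrightarrow> frac J \<Longrightarrow> ideal_class K I \<otimes>\<^bsub>class_group K\<^esub> ideal_class K J = ideal_class K (iprod I J)"
  using normal.rcos_sum[OF PF_normal, of I J] by (simp add: class_group_def ideal_class_def)

lemma ideal_class_one: "\<one>\<^bsub>class_group K\<^esub> = PF"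
  by (simp add: class_group_def)

lemma ideal_class_eq_one_iff:
  assumes I: "frac I"
  shows "ideal_class K I = \<one>\<^bsub>class_group K\<^esub> \<longleftrightarrow> I \<in> PF"
proof -
  interpret comm_group FG by (rule comm_group_FG)
  have IC: "I \<in> carrier FG" using I by simp
  show ?thesis
    unfolding ideal_class_one ideal_class_def
    using coset_join1[OF _ IC PF_subgroup] coset_join2[OF IC PF_subgroup]
    by blast
qed

lemma ideal_class_carrier: "frac I \<Longrightarrow> ideal_class K I \<in> carrier (class_group K)"
  unfolding class_group_carrier by blast

lemma ideal_class_scale:
  assumes "frac I" "x \<in> K" "x \<noteq> 0"
  shows "ideal_class K ((*) x ` I) = ideal_class K I"
proof -
  have "ideal_class K ((*) x ` \<O>) = \<one>\<^bsub>class_group K\<^esub>"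
    using ideal_class_eq_one_iff[OF frac_scale[OF frac_O assms(2,3)]] PF_I[OF assms(2,3)] by blast
  moreover have "ideal_class K ((*) x ` \<O>) \<otimes>\<^bsub>class_group K\<^esub> ideal_class K I = ideal_class K ((*) x ` I)"
    unfolding ideal_class_mult[OF frac_scale[OF frac_O assms(2,3)] assms(1)] iprod_principal[OF assms(1)] ..
  ultimately show ?thesis 
    using monoid.l_one[OF comm_monoid.axioms(1)[OF comm_group.axioms(1)[OF comm_group_class_group]]
      ideal_class_carrier[OF assms(1)]] by simp
qed

lemma finite_class_group: "finite (carrier (class_group K))"
proof -
  from finite_classes obtain \<J> where \<J>': "finite \<J> \<and> (\<forall>J\<in>\<J>. frac J) \<and>
    (\<forall>I. frac I \<longrightarrow> (\<exists>J\<in>\<J>. \<exists>x\<in>K. x \<noteq> 0 \<and> I = (*) x ` J))" ..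
  note \<J> = conjunct1[OF \<J>'] bspec[OF conjunct1[OF conjunct2[OF \<J>']]]
    mp[OF spec[OF conjunct2[OF conjunct2[OF \<J>']]]]
  have "carrier (class_group K) \<subseteq> ideal_class K ` \<J>"
  proof
    fix c assume "c \<in> carrier (class_group K)"
    then obtain I where I: "frac I" "c = ideal_class K I" unfolding class_group_carrier by blast
    obtain J x where "J \<in> \<J>" "x \<in> K" "x \<noteq> 0" "I = (*) x ` J" using \<J>(3)[OF I(1)] by blast
    hence "c = ideal_class K J" using I(2) ideal_class_scale[OF \<J>(2)[of J]] by blast
    thus "c \<in> ideal_class K ` \<J>" using \<open>J \<in> \<J>\<close> by blast
  qed
  thus ?thesis using \<J>(1) by (meson finite_imageI finite_subset)
qed

end

section \<open>Units of cyclic septic fields\<close>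

text \<open>The factor \<open>A\<close> does not depend on \<open>k\<close>, so if \<open>N\<close>
  exceeded \<open>s\<close>, the ratio of the two exponentials would eventually pass it.\<close>

lemma power_growth_bound:
  fixes N s d A :: nat
  assumes bound: "\<And>k. (N ^ d) ^ k \<le> A * (s ^ d) ^ k" and "s > 0" "d > 0"
  shows "N \<le> s"
proof (rule ccontr)
  assume "\<not> N \<le> s"
  define x where "x = (real N / real s) ^ d"
  have "x > 1"
    unfolding x_def using \<open>\<not> N \<le> s\<close> assms by (intro one_less_power) auto
  from real_arch_pow[OF this, of "real A"] obtain k where k: "real A < x ^ k" ..
  have "x ^ k * real ((s ^ d) ^ k) = real ((N ^ d) ^ k)"
    using \<open>s > 0\<close> by (simp add: x_def power_divide)
  also have "\<dots> \<le> real (A * (s ^ d) ^ k)" using bound[of k] by (simp only: of_nat_le_iff)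
  also have "\<dots> = real A * real ((s ^ d) ^ k)" by simp
  finally have "x ^ k \<le> real A" using \<open>s > 0\<close> by simp
  thus False using k by simp
qed

locale cyclic_septic = cyclic_field 7 f \<theta> K \<sigma> for f \<theta> K \<sigma>
begin

section \<open>Units of norm one and the operator \<open>D\<close>\<close>

definition unit_K :: "complex \<Rightarrow> bool" where
  "unit_K u \<longleftrightarrow> u \<in> \<O> \<and> u \<noteq> 0 \<and> inverse u \<in> \<O>"

text \<open>Norm \<open>1\<close> excludes \<open>-1\<close>, the degree being odd. A unit fixed by
  \<open>\<sigma>\<close> is rational, thus \<open>1\<close> or \<open>-1\<close>, so
  \<open>D\<close> becomes injective on \<open>units1\<close>.\<close>

definition units1 :: "complex set" where "units1 = {u. unit_K u \<and> norm_K u = 1}"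

text \<open>The multiplicative form of the group ring element x - 1, where x stands for
  \<open>\<sigma>\<close>.\<close>

definition D :: "complex \<Rightarrow> complex" where "D u = \<sigma> u / u"

lemma unit_K_1: "unit_K 1"
  by (simp add: unit_K_def)

lemma unit_K_in_K: "unit_K u \<Longrightarrow> u \<in> K"
  by (simp add: unit_K_def O_K)

lemma unit_K_nz: "unit_K u \<Longrightarrow> u \<noteq> 0"
  by (simp add: unit_K_def)

lemma unit_K_mult: "unit_K u \<Longrightarrow> unit_K v \<Longrightarrow> unit_K (u * v)"
  by (simp add: unit_K_def O_mult)

lemma unit_K_inverse: "unit_K u \<Longrightarrow> unit_K (inverse u)"
  by (simp add: unit_K_def)

lemma unit_K_divide: "unit_K u \<Longrightarrow> unit_K v \<Longrightarrow> unit_K (u / v)"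
  using unit_K_mult[of u "inverse v"] unit_K_inverse by (simp add: divide_inverse)

lemma unit_K_power: "unit_K u \<Longrightarrow> unit_K (u ^ k)"
  by (induction k) (auto intro: unit_K_mult unit_K_1)

lemma unit_K_conj: "unit_K u \<Longrightarrow> unit_K (conj i u)"
  using conj_O[of u i] conj_O[of "inverse u" i] by (simp add: unit_K_def conj_inverse conj_eq_0_iff O_K)

lemma unit_K_of_power:
  assumes "unit_K (u ^ k)" "u \<in> K" "k > 0"
  shows "unit_K u"
proof -
  have "u \<noteq> 0" using assms by (auto simp: unit_K_def)
  moreover have "u \<in> \<O>"
    using assms by (auto simp: unit_K_def O_iff intro: algebraic_int_of_power)
  moreover have "inverse u \<in> \<O>"
    using assms by (auto simp: unit_K_def O_iff K_inverse simp flip: power_inverse intro: algebraic_int_of_power)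
  ultimately show ?thesis by (simp add: unit_K_def)
qed

lemma unit_K_Rats: "unit_K u \<Longrightarrow> u \<in> \<rat> \<Longrightarrow> u = 1 \<or> u = - 1"
proof -
  assume u: "unit_K u" "u \<in> \<rat>"
  have "u \<in> \<int>" "inverse u \<in> \<int>"
    using u by (auto simp: unit_K_def intro!: O_Rats_imp_Ints)
  then obtain a b where ab: "u = of_int a" "inverse u = of_int b" by (auto elim!: Ints_cases)
  hence "of_int (a * b) = (1 :: complex)" using unit_K_nz[OF u(1)] by (metis of_int_mult right_inverse)
  hence "a * b = 1" by (simp only: of_int_eq_1_iff)
  hence "a = 1 \<or> a = -1" by (auto simp: zmult_eq_1_iff)
  thus ?thesis using ab by auto
qed

lemma units1D: "u \<in> units1 \<Longrightarrow> unit_K u" "u \<in> units1 \<Longrightarrow> norm_K u = 1"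
  "u \<in> units1 \<Longrightarrow> u \<in> K" "u \<in> units1 \<Longrightarrow> u \<noteq> 0"
  by (auto simp: units1_def unit_K_def O_K)

lemma units1_1: "1 \<in> units1"
  by (simp add: units1_def unit_K_1)

lemma units1_mult: "u \<in> units1 \<Longrightarrow> v \<in> units1 \<Longrightarrow> u * v \<in> units1"
  by (simp add: units1_def unit_K_mult norm_K_mult unit_K_in_K)

lemma units1_inverse: "u \<in> units1 \<Longrightarrow> inverse u \<in> units1"
proof -
  assume u: "u \<in> units1"
  have "norm_K (u * inverse u) = norm_K u * norm_K (inverse u)"
    using units1D(3)[OF u] by (intro norm_K_mult K_inverse)
  hence "norm_K (inverse u) = 1" using units1D(2,4)[OF u] by simp
  thus ?thesis using u by (simp add: units1_def unit_K_inverse)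
qed

lemma units1_divide: "u \<in> units1 \<Longrightarrow> v \<in> units1 \<Longrightarrow> u / v \<in> units1"
  using units1_mult[of u "inverse v"] units1_inverse by (simp add: divide_inverse)

lemma units1_power: "u \<in> units1 \<Longrightarrow> u ^ k \<in> units1"
  by (induction k) (auto intro: units1_mult units1_1)

lemma units1_powi: "u \<in> units1 \<Longrightarrow> u powi k \<in> units1"
  by (auto simp: power_int_def intro: units1_power units1_inverse)

lemma units1_\<sigma>: "u \<in> units1 \<Longrightarrow> \<sigma> u \<in> units1"
  using unit_K_conj[of u 1] by (auto simp: units1_def norm_K_conj unit_K_in_K conj_1)

lemma units1_conj: "u \<in> units1 \<Longrightarrow> conj i u \<in> units1"
  by (induction i) (auto simp: conj_Suc intro: units1_\<sigma>)

lemma D_units1: "u \<in> units1 \<Longrightarrow> D u \<in> units1"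
  by (simp add: D_def units1_divide units1_\<sigma>)

lemma D_mult: "u \<in> K \<Longrightarrow> v \<in> K \<Longrightarrow> D (u * v) = D u * D v"
  by (simp add: D_def \<sigma>_mult)

lemma D_1 [simp]: "D 1 = 1"
  by (simp add: D_def \<sigma>_1)

lemma D_nz: "u \<in> units1 \<Longrightarrow> D u \<noteq> 0"
  using units1D(4)[OF D_units1] .

lemma D_inverse: "u \<in> units1 \<Longrightarrow> D (inverse u) = inverse (D u)"
  using D_mult[of u "inverse u"] units1D[of u] K_inverse[of u] D_nz[of u]
  by (simp add: inverse_unique)

lemma D_divide: "u \<in> units1 \<Longrightarrow> v \<in> units1 \<Longrightarrow> D (u / v) = D u / D v"
  using D_mult[of u "inverse v"] D_inverse[of v] units1D K_inverse by (simp add: divide_inverse)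

lemma D_eq_1:
  assumes "u \<in> units1" "D u = 1" shows "u = 1"
proof -
  have "\<sigma> u = u" using assms units1D(4) by (simp add: D_def)
  hence "u \<in> \<rat>" using assms units1D(3) by (intro fixed_imp_Rats) auto
  hence "u = 1 \<or> u = - 1" using units1D(1)[OF assms(1)] by (rule unit_K_Rats[rotated])
  moreover have "norm_K (- 1) = - 1"
    using conj_of_int[of _ "-1"] by (simp add: norm_K_def)
  ultimately show ?thesis using units1D(2)[OF assms(1)] by auto
qed

lemma D_inj:
  assumes "u \<in> units1" "v \<in> units1" "D u = D v" shows "u = v"
proof -
  have "D (u / v) = 1" using assms D_divide D_nz by simp
  hence "u / v = 1" by (rule D_eq_1[OF units1_divide[OF assms(1,2)]])
  thus ?thesis using units1D(4)[OF assms(2)] by simp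
qed

subsection \<open>The action of the group ring\<close>

text \<open>The group ring element a0 + a1 x + ... + a6 x^6 acting through exponents. By
  \<open>D_act\<close>, applying \<open>D\<close> is multiplication by x - 1; by
  \<open>act_add_norm\<close>, the action on \<open>units1\<close> factors through the quotient by 1
  + x + ... + x^6.\<close>

definition act :: "int \<Rightarrow> int \<Rightarrow> int \<Rightarrow> int \<Rightarrow> int \<Rightarrow> int \<Rightarrow> int \<Rightarrow> complex \<Rightarrow> complex" where
  "act a0 a1 a2 a3 a4 a5 a6 u =
     u powi a0 * conj 1 u powi a1 * conj 2 u powi a2 * conj 3 u powi a3 * conj 4 u powi a4
       * conj 5 u powi a5 * conj 6 u powi a6"

lemma conj_powi: "x \<in> K \<Longrightarrow> conj i (x powi k) = conj i x powi k"
  by (auto simp: power_int_def conj_power conj_inverse K_inverse)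

lemma act_units1: "u \<in> units1 \<Longrightarrow> act a0 a1 a2 a3 a4 a5 a6 u \<in> units1"
  unfolding act_def by (intro units1_mult units1_powi units1_conj)

lemma \<sigma>_act:
  assumes u: "u \<in> units1"
  shows "\<sigma> (act a0 a1 a2 a3 a4 a5 a6 u) = act a6 a0 a1 a2 a3 a4 a5 u"
proof -
  have K: "conj i u powi k \<in> K" "u powi k \<in> K" for i k
    using units1D(3)[OF u] by (simp_all add: K_powi conj_closed)
  have s: "\<sigma> (conj i u powi k) = conj (Suc i) u powi k" "\<sigma> (u powi k) = conj 1 u powi k" for i k
    using conj_powi[of "conj i u" 1 k] conj_powi[of u 1 k] units1D(3)[OF u]
    by (simp_all add: conj_closed conj_1 conj_Suc)
  have "conj 7 u = u" using conj_n[OF units1D(3)[OF u]] .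
  thus ?thesis
    unfolding act_def by (simp add: \<sigma>_mult K K_mult s numeral_2_eq_2[symmetric] mult_ac)
qed

lemma D_act:
  assumes u: "u \<in> units1"
  shows "D (act a0 a1 a2 a3 a4 a5 a6 u)
    = act (a6 - a0) (a0 - a1) (a1 - a2) (a2 - a3) (a3 - a4) (a4 - a5) (a5 - a6) u"
proof -
  have nz: "conj i u \<noteq> 0" "u \<noteq> 0" for i using units1D[OF units1_conj[OF u]] units1D[OF u] by auto
  show ?thesis
    unfolding D_def \<sigma>_act[OF u] unfolding act_def by (simp add: power_int_diff nz)
qed

lemma lessThan_7: "{..<7::nat} = {0, 1, 2, 3, 4, 5, 6}"
  by auto

lemma norm_K_seven: "norm_K u = act 1 1 1 1 1 1 1 u"
  unfolding norm_K_def lessThan_7 by (simp add: act_def mult_ac)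

lemma act_add_norm:
  assumes u: "u \<in> units1"
  shows "act (k + a0) (k + a1) (k + a2) (k + a3) (k + a4) (k + a5) (k + a6) u = act a0 a1 a2 a3 a4 a5 a6 u"
proof -
  have nz: "conj i u \<noteq> 0" "u \<noteq> 0" for i using units1D[OF units1_conj[OF u]] units1D[OF u] by auto
  have "act (k + a0) (k + a1) (k + a2) (k + a3) (k + a4) (k + a5) (k + a6) u
      = (act 1 1 1 1 1 1 1 u) powi k * act a0 a1 a2 a3 a4 a5 a6 u"
    unfolding act_def by (simp add: power_int_add nz power_int_mult_distrib mult_ac)
  thus ?thesis using units1D(2)[OF u] by (simp add: norm_K_seven[symmetric])
qed

text \<open>In \<open>\<int>[x]/(1 + x + \<dots> + x\<^sup>6)\<close> the number \<open>7\<close> is \<open>(x - 1)\<^sup>6\<close> times the unit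
  \<open>3 + 3x - 4x\<^sup>3 - 6x\<^sup>4 - 4x\<^sup>5\<close>.\<close>

definition W :: "complex \<Rightarrow> complex" where "W = act 3 3 0 (-4) (-6) (-4) 0"

lemma D6_W: "u \<in> units1 \<Longrightarrow> (D ^^ 6) (W u) = u ^ 7"
proof -
  assume u: "u \<in> units1"
  have "(D ^^ 6) (W u) = act 6 (-1) (-1) (-1) (-1) (-1) (-1) u"
    unfolding W_def by (simp add: D_act[OF u] eval_nat_numeral)
  \<comment> \<open>The coefficients reached are those of 7 - (1 + x + ... + x^6), and the bracket
    acts trivially on units of norm \<open>1\<close>.\<close>
  also have "\<dots> = act 7 0 0 0 0 0 0 u"
    using act_add_norm[OF u, of "-1" 7 0 0 0 0 0 0] by simp
  also have "\<dots> = u ^ 7" by (simp add: act_def)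
  finally show ?thesis .
qed

text \<open>All coefficients of (x - 1)^6 are congruent to \<open>1\<close> modulo \<open>7\<close>,
  so on an element with seventh power \<open>1\<close> the operator \<open>D ^^ 6\<close> acts as
  the norm and gives \<open>1\<close>. Injectivity of \<open>D\<close> then removes the six
  applications one by one.\<close>

lemma seventh_power_eq_1:
  assumes u: "u \<in> units1" and u7: "u ^ 7 = 1"
  shows "u = 1"
proof -
  have p: "conj i u powi (7 * k) = 1" for i k
    using conj_power[of u i 7] u7 units1D(3)[OF u] by (simp add: power_int_mult)
  have p': "u powi (7 * k) = 1" for k
    using u7 by (simp add: power_int_mult)
  have nz: "conj i u \<noteq> 0" "u \<noteq> 0" for i using units1D[OF units1_conj[OF u]] units1D[OF u] by auto
  have "(D ^^ 6) (act 1 0 0 0 0 0 0 u) = act (1 + 7 * 0) (1 + 7 * (-1)) (1 + 7 * 2) (1 + 7 * (-3)) (1 + 7 * 2) (1 + 7 * (-1)) (1 + 7 * 0) u"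
    by (simp add: D_act[OF u] eval_nat_numeral)
  also have "\<dots> = act (7 * 0) (7 * (-1)) (7 * 2) (7 * (-3)) (7 * 2) (7 * (-1)) (7 * 0) u"
    by (rule act_add_norm[OF u])
  also have "\<dots> = 1" unfolding act_def p p' by simp
  also have "act 1 0 0 0 0 0 0 u = u" by (simp add: act_def)
  finally have D6: "(D ^^ 6) u = 1" .
  have units: "(D ^^ i) u \<in> units1" for i
    by (induction i) (auto intro: u D_units1)
  have "(D ^^ (6 - i)) u = 1" if "i \<le> 6" for i
    using that
  proof (induction i)
    case (Suc i)
    hence "D ((D ^^ (6 - Suc i)) u) = 1"
      by (metis Suc_diff_le Suc_leD diff_Suc_Suc funpow.simps(2) o_apply)
    thus ?case by (rule D_eq_1[OF units])
  qed (simp add: D6)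
  from this[of 6] show ?thesis by simp
qed

subsection \<open>Counting units\<close>

definition ht :: "complex \<Rightarrow> real" where "ht u = (\<Sum>j<7. \<bar>ln (cmod (conj j u))\<bar>)"

lemma ln_conj_mult:
  "u \<in> units1 \<Longrightarrow> v \<in> units1 \<Longrightarrow> ln (cmod (conj j (u * v))) = ln (cmod (conj j u)) + ln (cmod (conj j v))"
  using units1D[OF units1_conj[of u j]] units1D[OF units1_conj[of v j]] units1D[of u] units1D[of v]
  by (simp add: conj_mult norm_mult ln_mult)

lemma ln_conj_inverse:
  "u \<in> units1 \<Longrightarrow> ln (cmod (conj j (inverse u))) = - ln (cmod (conj j u))"
  using units1D[OF units1_conj[of u j]] units1D[of u]
  by (simp add: conj_inverse norm_inverse ln_inverse)

lemma sum_ln_conj: "u \<in> units1 \<Longrightarrow> (\<Sum>j<7. ln (cmod (conj j u))) = 0"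
proof -
  assume u: "u \<in> units1"
  have "(\<Sum>j<7. ln (cmod (conj j u))) = ln (\<Prod>j<7. cmod (conj j u))"
    using units1D[OF units1_conj[OF u]] by (intro ln_prod[symmetric]) auto
  also have "(\<Prod>j<7. cmod (conj j u)) = cmod (norm_K u)"
    by (simp add: norm_K_def prod_norm)
  finally show ?thesis using units1D(2)[OF u] by simp
qed

lemma ht_mult: "u \<in> units1 \<Longrightarrow> v \<in> units1 \<Longrightarrow> ht (u * v) \<le> ht u + ht v"
  unfolding ht_def sum.distrib[symmetric]
  by (intro sum_mono) (simp add: ln_conj_mult abs_triangle_ineq)

lemma ht_power: "u \<in> units1 \<Longrightarrow> ht (u ^ k) = real k * ht u"
proof -
  assume u: "u \<in> units1"
  have "ln (cmod (conj j (u ^ k))) = real k * ln (cmod (conj j u))" for j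
    using units1D[OF units1_conj[OF u, of j]] units1D[OF u]
    by (simp add: conj_power norm_power ln_realpow)
  thus ?thesis by (simp add: ht_def abs_mult sum_distrib_left)
qed

definition ball_units :: "nat \<Rightarrow> complex set" where "ball_units R = {u \<in> units1. ht u \<le> real R}"

text \<open>The seven logarithms sum to zero, so six of them locate a unit, whence the exponent
  \<open>6\<close>. The quotient of two units with the same integer parts has its first six
  logarithms below \<open>1\<close> in absolute value, hence the last below \<open>6\<close>; the
  bound \<open>exp 6\<close> leaves finitely many such quotients.\<close>

lemma card_ball_units:
  "\<exists>F::nat. \<forall>R. finite (ball_units R) \<and> card (ball_units R) \<le> F * (2 * R + 1) ^ 6"
proof -
  define S where "S = {x \<in> \<O>. \<forall>i<7. cmod (conj i x) \<le> exp 6}"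
  have fS: "finite S" unfolding S_def by (rule finite_bounded_integers)
  have "finite (ball_units R) \<and> card (ball_units R) \<le> card S * (2 * R + 1) ^ 6" for R
  proof -
    define \<phi> where "\<phi> u = (\<lambda>j\<in>{..<6::nat}. \<lfloor>ln (cmod (conj j u))\<rfloor>)" for u
    define T where "T = {..<6::nat} \<rightarrow>\<^sub>E {- int R..int R}"
    have fT: "finite T" unfolding T_def by (intro finite_PiE) auto
    have cT: "card T = (2 * R + 1) ^ 6"
    proof -
      have "card {- int R..int R} = 2 * R + 1" by simp
      thus ?thesis unfolding T_def by (subst card_PiE) (simp_all only: finite_lessThan prod_constant card_lessThan)
    qed
    have \<phi>T: "\<phi> u \<in> T" if u: "u \<in> ball_units R" for u
    proof -
      have "\<lfloor>ln (cmod (conj j u))\<rfloor> \<in> {- int R..int R}" if j: "j < 6" for j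
      proof -
        have "\<bar>ln (cmod (conj j u))\<bar> \<le> ht u"
          unfolding ht_def using j by (intro member_le_sum) auto
        hence "\<bar>ln (cmod (conj j u))\<bar> \<le> real R" using u by (simp add: ball_units_def)
        thus ?thesis by (simp add: le_floor_iff floor_le_iff) linarith
      qed
      thus ?thesis unfolding T_def \<phi>_def by (intro restrict_PiE_iff[THEN iffD2]) auto
    qed
    define fib where "fib c = {u \<in> ball_units R. \<phi> u = c}" for c
    have fib: "finite (fib c) \<and> card (fib c) \<le> card S" for c
    proof (cases "fib c = {}")
      case False
      then obtain v where v: "v \<in> fib c" by blast
      have v1: "v \<in> units1" using v by (simp add: fib_def ball_units_def)
      have "(\<lambda>u. u * inverse v) ` fib c \<subseteq> S"
      proof
        fix y assume "y \<in> (\<lambda>u. u * inverse v) ` fib c"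
        then obtain u where u: "u \<in> fib c" "y = u * inverse v" by blast
        have u1: "u \<in> units1" using u(1) by (simp add: fib_def ball_units_def)
        have y1: "y \<in> units1" using u u1 v1 by (simp add: units1_mult units1_inverse)
        define l where "l j = ln (cmod (conj j y))" for j
        have lt1: "\<bar>l j\<bar> < 1" if "j < 6" for j
        proof -
          have "\<phi> u j = \<phi> v j" using u v by (simp add: fib_def)
          hence "\<lfloor>ln (cmod (conj j u))\<rfloor> = \<lfloor>ln (cmod (conj j v))\<rfloor>"
            using that by (simp add: \<phi>_def)
          moreover have "l j = ln (cmod (conj j u)) - ln (cmod (conj j v))"
            using u1 v1 by (simp add: l_def u(2) ln_conj_mult units1_inverse ln_conj_inverse)
          ultimately show ?thesis by linarith
        qed
        have "(\<Sum>j<7. l j) = 0" unfolding l_def by (rule sum_ln_conj[OF y1])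
        hence "l 0 + l 1 + l 2 + l 3 + l 4 + l 5 + l 6 = 0"
          unfolding lessThan_7 by simp
        hence "\<bar>l 6\<bar> < 6"
          using lt1[of 0] lt1[of 1] lt1[of 2] lt1[of 3] lt1[of 4] lt1[of 5] by simp
        have "cmod (conj j y) \<le> exp 6" if j: "j < 7" for j
        proof -
          have "\<bar>l j\<bar> < 6"
          proof (cases "j = 6")
            case False
            thus ?thesis using lt1[of j] j by simp
          qed (simp add: \<open>\<bar>l 6\<bar> < 6\<close>)
          moreover have "cmod (conj j y) > 0" using units1D(4)[OF units1_conj[OF y1]] by simp
          ultimately show ?thesis unfolding l_def by (metis abs_le_D1 exp_le_cancel_iff exp_ln less_imp_le)
        qed
        thus "y \<in> S" using units1D(1)[OF y1] by (simp add: S_def unit_K_def)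
      qed
      moreover have "inj_on (\<lambda>u. u * inverse v) (fib c)"
        using units1D(4)[OF v1] by (intro inj_onI) simp
      ultimately show ?thesis
        using fS by (meson card_inj_on_le finite_subset inj_on_finite)
    qed simp
    have eq: "ball_units R = (\<Union>c\<in>T. fib c)" using \<phi>T by (auto simp: fib_def)
    have "card (\<Union>c\<in>T. fib c) \<le> (\<Sum>c\<in>T. card (fib c))" by (rule card_UN_le[OF fT])
    also have "\<dots> \<le> (\<Sum>c\<in>T. card S)" using fib by (intro sum_mono) auto
    also have "\<dots> = card S * (2 * R + 1) ^ 6" by (simp add: cT)
    finally show ?thesis using eq fT fib by simp
  qed
  thus ?thesis by blast
qed

text \<open>The elements \<open>G [i\<^sub>1, \<dots>, i\<^sub>k] z = c\<^sub>1 D (c\<^sub>2 D (\<dots> D z))\<close> are pairwise distinct if the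
  representatives \<open>c\<^sub>i\<close> are inequivalent modulo the image of \<open>D\<close>.\<close>

fun G :: "(nat \<Rightarrow> complex) \<Rightarrow> nat list \<Rightarrow> complex \<Rightarrow> complex" where
  "G c [] z = z"
| "G c (i # is) z = c i * D (G c is z)"

lemma G_units1: "(\<And>i. i \<in> set is \<Longrightarrow> c i \<in> units1) \<Longrightarrow> z \<in> units1 \<Longrightarrow> G c is z \<in> units1"
  by (induction "is") (auto intro: units1_mult D_units1)

lemma D_funpow_units1: "z \<in> units1 \<Longrightarrow> (D ^^ k) z \<in> units1"
  by (induction k) (auto intro: D_units1)

lemma G_eq:
  "(\<And>i. i \<in> set is \<Longrightarrow> c i \<in> units1) \<Longrightarrow> z \<in> units1 \<Longrightarrow> G c is z = G c is 1 * (D ^^ length is) z"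
proof (induction "is")
  case (Cons i "is")
  have "G c is 1 \<in> units1" using Cons.prems by (intro G_units1 units1_1) auto
  thus ?case using Cons D_funpow_units1[OF Cons.prems(2), of "length is"]
    by (simp add: D_mult units1D(3) mult.assoc)
qed simp

context
  fixes I :: "nat set" and c :: "nat \<Rightarrow> complex"
  assumes fin: "finite I" and c: "\<And>i. i \<in> I \<Longrightarrow> c i \<in> units1"
    and ineq: "\<And>i j v. i \<in> I \<Longrightarrow> j \<in> I \<Longrightarrow> v \<in> units1 \<Longrightarrow> c i = c j * D v \<Longrightarrow> i = j"
begin

lemma G_inj:
  "set is \<subseteq> I \<Longrightarrow> set js \<subseteq> I \<Longrightarrow> length is = length js \<Longrightarrow> z \<in> units1 \<Longrightarrow> y \<in> units1 \<Longrightarrow>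
   G c is z = G c js y \<Longrightarrow> is = js \<and> z = y"
proof (induction "is" arbitrary: js)
  case (Cons i "is")
  then obtain j js' where js: "js = j # js'" by (cases js) auto
  have ij: "i \<in> I" "j \<in> I" "set is \<subseteq> I" "set js' \<subseteq> I" "length is = length js'"
    using Cons.prems js by auto
  have u: "G c is z \<in> units1" "G c js' y \<in> units1"
    using ij Cons.prems by (auto intro!: G_units1 c)
  have eq: "c i * D (G c is z) = c j * D (G c js' y)" using Cons.prems(6) js by simp
  have "c i = c j * D (G c js' y / G c is z)"
    using eq u D_nz[OF u(1)] by (simp add: D_divide field_simps)
  with ij(1,2) units1_divide[OF u(2,1)] have "i = j" by (rule ineq)
  hence "D (G c is z) = D (G c js' y)" using eq units1D(4)[OF c[OF ij(2)]] by simp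
  hence "G c is z = G c js' y" by (rule D_inj[OF u])
  with Cons.IH[OF ij(3,4,5) Cons.prems(4,5)] \<open>i = j\<close> js show ?case by simp
qed simp

text \<open>Words have length six because then \<open>G c is (W u) = G c is 1 * u ^ 7\<close>: the
  word adds at most \<open>B\<close> to the height and \<open>u\<close> contributes seven times its
  own. Distinct pairs of a word and a unit give distinct values, by \<open>G_inj\<close> and
  \<open>seventh_power_eq_1\<close>.\<close>

lemma card_ball_units_growth: "\<exists>B. \<forall>R. card I ^ 6 * card (ball_units R) \<le> card (ball_units (7 * R + B))"
proof -
  define L where "L = {is. set is \<subseteq> I \<and> length is = 6}"
  have fL: "finite L" and cL: "card L = card I ^ 6"
    unfolding L_def using finite_lists_length_eq[OF fin] card_lists_length_eq[OF fin] by auto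
  define B where "B = nat \<lceil>\<Sum>is\<in>L. \<bar>ht (G c is 1)\<bar>\<rceil>"
  have B: "ht (G c is 1) \<le> real B" if "is \<in> L" for "is"
  proof -
    have "\<bar>ht (G c is 1)\<bar> \<le> (\<Sum>is\<in>L. \<bar>ht (G c is 1)\<bar>)"
      using that fL by (intro member_le_sum) auto
    thus ?thesis unfolding B_def by linarith
  qed
  have "card I ^ 6 * card (ball_units R) \<le> card (ball_units (7 * R + B))" for R
  proof -
    define T where "T = (\<lambda>(is, u). G c is (W u))"
    have GT: "G c is (W u) = G c is 1 * u ^ 7" if "is \<in> L" "u \<in> units1" for "is" u
      using that G_eq[of "is" c "W u"] c D6_W[OF that(2)] by (auto simp: L_def W_def act_units1)
    have "inj_on T (L \<times> ball_units R)"
    proof (rule inj_onI)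
      fix p q assume p: "p \<in> L \<times> ball_units R" and q: "q \<in> L \<times> ball_units R" and Tpq: "T p = T q"
      obtain "is" u where pq1: "p = (is, u)" "is \<in> L" "u \<in> units1" using p by (auto simp: ball_units_def)
      obtain js v where pq2: "q = (js, v)" "js \<in> L" "v \<in> units1" using q by (auto simp: ball_units_def)
      have "is = js \<and> W u = W v"
        using pq1 pq2 Tpq by (intro G_inj) (auto simp: L_def T_def W_def act_units1)
      hence "is = js" "u ^ 7 = v ^ 7" using D6_W[OF pq1(3)] D6_W[OF pq2(3)] by auto
      hence "(u / v) ^ 7 = 1" using units1D(4)[OF pq2(3)] by (simp add: power_divide)
      hence "u / v = 1" by (rule seventh_power_eq_1[OF units1_divide[OF pq1(3) pq2(3)]])
      thus "p = q" using pq1 pq2 \<open>is = js\<close> units1D(4)[OF pq2(3)] by simp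
    qed
    moreover have "T ` (L \<times> ball_units R) \<subseteq> ball_units (7 * R + B)"
    proof
      fix y assume "y \<in> T ` (L \<times> ball_units R)"
      then obtain "is" u where y: "is \<in> L" "u \<in> units1" "ht u \<le> real R" "y = G c is (W u)"
        by (auto simp: T_def ball_units_def)
      have G1: "G c is 1 \<in> units1" using y(1) by (auto simp: L_def intro!: G_units1 c units1_1)
      have "ht y \<le> ht (G c is 1) + ht (u ^ 7)"
        using y G1 by (simp add: GT ht_mult units1_power)
      also have "\<dots> \<le> real (7 * R + B)"
        using B[OF y(1)] y(2,3) by (simp add: ht_power)
      finally show "y \<in> ball_units (7 * R + B)"
        using y G1 by (simp add: ball_units_def GT units1_mult units1_power)
    qed
    moreover have "finite (ball_units (7 * R + B))" using card_ball_units by blast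
    ultimately have "card (L \<times> ball_units R) \<le> card (ball_units (7 * R + B))"
      by (rule card_inj_on_le)
    thus ?thesis by (simp add: card_cartesian_product cL)
  qed
  thus ?thesis by blast
qed

text \<open>Iterated growth produces at least (card I)^(6k) units of height about 7^k, while
  \<open>card_ball_units\<close> allows only a constant times 7^(6k).\<close>

lemma card_unit_classes: "card I \<le> 7"
proof -
  obtain F :: nat where F: "\<And>R. finite (ball_units R)" "\<And>R. card (ball_units R) \<le> F * (2 * R + 1) ^ 6"
    using card_ball_units by blast
  obtain B where B: "\<And>R. card I ^ 6 * card (ball_units R) \<le> card (ball_units (7 * R + B))"
    using card_ball_units_growth by blast
  \<comment> \<open>Iterating R \<mapsto> 7 R + B from \<open>0\<close> reaches B (7^k - 1) / 6
    after \<open>k\<close> steps; the equation states this without division.\<close>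
  have "\<exists>R. R * 6 + B = B * 7 ^ k \<and> (card I ^ 6) ^ k \<le> card (ball_units R)" for k
  proof (induction k)
    case 0
    have "1 \<in> ball_units 0" by (simp add: ball_units_def units1_1 ht_def)
    hence "card (ball_units 0) \<ge> 1" using F(1)[of 0] by (metis One_nat_def Suc_leI card_gt_0_iff empty_iff)
    thus ?case by (intro exI[of _ 0]) simp
  next
    case (Suc k)
    then obtain R where R: "R * 6 + B = B * 7 ^ k" "(card I ^ 6) ^ k \<le> card (ball_units R)" by blast
    have "(card I ^ 6) ^ Suc k \<le> card I ^ 6 * card (ball_units R)" using R(2) by simp
    also have "\<dots> \<le> card (ball_units (7 * R + B))" by (rule B)
    finally show ?case using R(1) by (intro exI[of _ "7 * R + B"]) (simp add: algebra_simps)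
  qed
  note growth = this
  define s :: nat where "s = 7"
  define d :: nat where "d = 6"
  have "(card I ^ d) ^ k \<le> F * (2 * B + 1) ^ d * (s ^ d) ^ k" for k
  proof -
    obtain R where R: "R * 6 + B = B * s ^ k" "(card I ^ d) ^ k \<le> card (ball_units R)"
      using growth[of k] unfolding s_def[symmetric] d_def[symmetric] by (elim exE conjE)
    have "1 \<le> s ^ k" by (simp add: s_def)
    hence R2: "2 * R + 1 \<le> (2 * B + 1) * s ^ k"
      using R(1) by (simp add: distrib_right)
    have "(card I ^ d) ^ k \<le> F * (2 * R + 1) ^ d" 
      by (rule order.trans[OF R(2) F(2)[of R, folded d_def]])
    also have "\<dots> \<le> F * ((2 * B + 1) * s ^ k) ^ d" using R2 by (intro mult_left_mono power_mono) auto
    also have "\<dots> = F * (2 * B + 1) ^ d * (s ^ d) ^ k"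
      by (simp only: power_mult_distrib power_mult[symmetric] mult.assoc mult.commute[of k d])
    finally show ?thesis .
  qed
  hence "card I \<le> s" by (rule power_growth_bound) (simp_all add: s_def d_def)
  thus "card I \<le> 7" by (simp only: s_def)
qed

end

end

section \<open>Eisenstein elements\<close>

text \<open>For the least \<open>j\<close> with \<open>c j\<close> not divisible by
  \<open>q\<close>, multiplication by \<open>\<pi> ^ (n - 1 - j)\<close> makes all other terms
  integral: the lower ones through \<open>c k\<close>, the higher ones through
  \<open>\<pi> ^ n\<close>. So \<open>c j * \<pi> ^ (n - 1) / q\<close> is integral too, which makes
  \<open>c j * b 0\<close> a multiple of \<open>\<pi>\<close>; n-th powers bring the divisibility
  down to rational integers.\<close>

lemma eisenstein_dvd:
  fixes q :: nat and \<pi> :: complex and b c :: "nat \<Rightarrow> int"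
  assumes q: "prime q" and \<pi>: "algebraic_int \<pi>"
    and eis: "\<pi> ^ n = - of_nat q * (\<Sum>i<n. of_int (b i) * \<pi> ^ i)" and b0: "\<not> int q dvd b 0"
    and n: "n > 0"
    and int: "algebraic_int ((\<Sum>i<n. of_int (c i) * \<pi> ^ i) / of_nat q)" and i: "i < n"
  shows "int q dvd c i"
proof (rule ccontr)
  assume "\<not> int q dvd c i"
  define j where "j = (LEAST j. j < n \<and> \<not> int q dvd c j)"
  have j: "j < n" "\<not> int q dvd c j"
    using LeastI[of "\<lambda>j. j < n \<and> \<not> int q dvd c j" i] i \<open>\<not> int q dvd c i\<close> by (auto simp: j_def)
  have less: "int q dvd c k" if "k < j" for k
    using not_less_Least[OF that[unfolded j_def]] that j(1) by auto
  have q0: "(of_nat q :: complex) \<noteq> 0" using q by (simp add: prime_gt_0_nat)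
  define y where "y = (\<Sum>i<n. of_int (c i) * \<pi> ^ i) / of_nat q"
  define \<beta> where "\<beta> = (\<Sum>i<n. of_int (b i) * \<pi> ^ i)"
  have \<beta>: "algebraic_int \<beta>"
    unfolding \<beta>_def by (intro algebraic_int_sum algebraic_int_mult algebraic_int_of_int algebraic_int_power \<pi>)
  have \<pi>n: "\<pi> ^ n = - of_nat q * \<beta>" unfolding \<beta>_def by (rule eis)
  have rest: "algebraic_int (\<Sum>k\<in>{..<n}-{j}. of_int (c k) * \<pi> ^ (k + (n - 1 - j)) / of_nat q)"
  proof (rule algebraic_int_sum)
    fix k assume k: "k \<in> {..<n} - {j}"
    show "algebraic_int (of_int (c k) * \<pi> ^ (k + (n - 1 - j)) / of_nat q)"
    proof (cases "k < j")
      case True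
      then obtain e where "c k = int q * e" using less by blast
      hence "of_int (c k) * \<pi> ^ (k + (n - 1 - j)) / of_nat q = of_int e * \<pi> ^ (k + (n - 1 - j))"
        using q0 by simp
      thus ?thesis by (simp only: algebraic_int_mult algebraic_int_of_int algebraic_int_power \<pi>)
    next
      case False
      hence "k > j" using k by auto
      hence "k + (n - 1 - j) = n + (k - Suc j)" using j(1) by simp
      hence "of_int (c k) * \<pi> ^ (k + (n - 1 - j)) / of_nat q = of_int (c k) * (of_int (- 1) * \<beta> * \<pi> ^ (k - Suc j))"
        using q0 by (simp add: power_add \<pi>n)
      thus ?thesis by (simp only: algebraic_int_mult algebraic_int_of_int algebraic_int_power \<pi> \<beta>)
    qed
  qed
  have "y * \<pi> ^ (n - 1 - j) = (\<Sum>k<n. of_int (c k) * \<pi> ^ (k + (n - 1 - j)) / of_nat q)"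
    by (simp add: y_def sum_divide_distrib sum_distrib_right power_add mult.assoc)
  also have "\<dots> = of_int (c j) * \<pi> ^ (j + (n - 1 - j)) / of_nat q
      + (\<Sum>k\<in>{..<n}-{j}. of_int (c k) * \<pi> ^ (k + (n - 1 - j)) / of_nat q)"
    using j(1) by (intro sum.remove) auto
  also have "j + (n - 1 - j) = n - 1" using j(1) by simp
  finally have z_eq: "of_int (c j) * \<pi> ^ (n - 1) / of_nat q
      = y * \<pi> ^ (n - 1 - j) - (\<Sum>k\<in>{..<n}-{j}. of_int (c k) * \<pi> ^ (k + (n - 1 - j)) / of_nat q)"
    by simp
  define z where "z = of_int (c j) * \<pi> ^ (n - 1) / of_nat q"
  have z: "algebraic_int z"
    unfolding z_def z_eq using int rest
    by (intro algebraic_int_diff algebraic_int_mult algebraic_int_power \<pi>) (simp_all only: y_def)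
  have "z * \<pi> = of_int (c j) * \<pi> ^ n / of_nat q"
    using n by (simp add: z_def power_eq_if[of \<pi> n] mult_ac)
  also have "\<dots> = - (of_int (c j) * \<beta>)" using q0 by (simp add: \<pi>n)
  finally have cz: "of_int (c j) * \<beta> = - (z * \<pi>)" by simp
  define \<gamma> where "\<gamma> = (\<Sum>i<n-1. of_int (b (Suc i)) * \<pi> ^ i)"
  have \<gamma>: "algebraic_int \<gamma>"
    unfolding \<gamma>_def by (intro algebraic_int_sum algebraic_int_mult algebraic_int_of_int algebraic_int_power \<pi>)
  have "\<beta> = of_int (b 0) + \<pi> * \<gamma>"
  proof -
    obtain n' where n': "n = Suc n'" using n gr0_conv_Suc by blast
    have "\<beta> = of_int (b 0) + (\<Sum>i<n'. of_int (b (Suc i)) * \<pi> ^ Suc i)"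
      unfolding \<beta>_def n' sum.lessThan_Suc_shift by simp
    also have "(\<Sum>i<n'. of_int (b (Suc i)) * \<pi> ^ Suc i) = \<pi> * \<gamma>"
      by (simp add: \<gamma>_def n' sum_distrib_left mult_ac)
    finally show ?thesis .
  qed
  hence "of_int (c j * b 0) = \<pi> * (of_int (- 1) * z - of_int (c j) * \<gamma>)"
    using cz by (simp add: algebra_simps)
  hence "of_int (c j * b 0) ^ n = \<pi> ^ n * (of_int (- 1) * z - of_int (c j) * \<gamma>) ^ n"
    by (simp only: power_mult_distrib)
  hence "of_int ((c j * b 0) ^ n) / of_int (int q) = of_int (- 1) * \<beta> * (of_int (- 1) * z - of_int (c j) * \<gamma>) ^ n"
    using q0 by (simp add: \<pi>n)
  hence "algebraic_int (of_int ((c j * b 0) ^ n) / of_int (int q) :: complex)"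
    by (simp only: algebraic_int_mult algebraic_int_diff algebraic_int_of_int algebraic_int_power \<beta> \<gamma> z)
  hence "int q dvd (c j * b 0) ^ n"
    using q by (intro of_int_quotient_algebraic_int) (auto simp: prime_gt_0_nat)
  hence "int q dvd c j * b 0" using q prime_dvd_power by (metis prime_nat_int_transfer)
  thus False using q j b0 by (metis prime_dvd_multD prime_nat_int_transfer)
qed

lemma rat_common_denominator:
  fixes c :: "nat \<Rightarrow> rat"
  shows "\<exists>d::int. d > 0 \<and> (\<exists>z::nat \<Rightarrow> int. \<forall>i<n. of_int d * c i = of_int (z i))"
proof (induction n)
  case (Suc n)
  then obtain d :: int and z :: "nat \<Rightarrow> int"
    where d: "d > 0" "\<And>i. i < n \<Longrightarrow> of_int d * c i = of_int (z i)" by blast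
  obtain a e where ae: "quotient_of (c n) = (a, e)" by force
  have e: "e > 0" using quotient_of_denom_pos[OF ae] .
  have c: "c n = of_int a / of_int e" using quotient_of_div[OF ae] by simp
  have "of_int (d * e) * c i = of_int (if i = n then d * a else e * z i)" if "i < Suc n" for i
  proof (cases "i = n")
    case True
    thus ?thesis using e by (simp add: c)
  next
    case False
    hence "of_int e * (of_int d * c i) = of_int e * of_int (z i)" using d(2)[of i] that by simp
    thus ?thesis using False by (simp add: mult_ac)
  qed
  thus ?case using d(1) e by (intro exI[of _ "d * e"] conjI exI[of _ "\<lambda>i. if i = n then d * a else e * z i"]) auto
qed (auto intro: exI[of _ 1])

text \<open>Infinite descent: a vanishing combination with integer coefficients stays integral after
  division by \<open>q\<close>, so \<open>eisenstein_dvd\<close> makes all its coefficients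
  divisible by \<open>q\<close>, and the quotients satisfy the same relation again.\<close>

lemma eisenstein_indep:
  fixes q :: nat and \<pi> :: complex and b :: "nat \<Rightarrow> int" and c :: "nat \<Rightarrow> rat"
  assumes q: "prime q" and \<pi>: "algebraic_int \<pi>"
    and eis: "\<pi> ^ n = - of_nat q * (\<Sum>i<n. of_int (b i) * \<pi> ^ i)" and b0: "\<not> int q dvd b 0"
    and n: "n > 0" and zero: "(\<Sum>i<n. of_rat (c i) * \<pi> ^ i) = 0" and i: "i < n"
  shows "c i = 0"
proof -
  obtain d :: int and z :: "nat \<Rightarrow> int" where d: "d > 0" "\<And>i. i < n \<Longrightarrow> of_int d * c i = of_int (z i)"
    using rat_common_denominator[of n c] by blast
  have z: "(of_int (z i) :: complex) = of_int d * of_rat (c i)" if "i < n" for i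
    using d(2)[OF that] by (metis of_rat_mult of_rat_of_int_eq)
  have "(\<Sum>i<n. of_int (z i) * \<pi> ^ i) = of_int d * (\<Sum>i<n. of_rat (c i) * \<pi> ^ i)"
    by (simp add: z sum_distrib_left mult.assoc)
  hence sz: "(\<Sum>i<n. of_int (z i) * \<pi> ^ i) = 0" using zero by simp
  have "\<exists>e::nat \<Rightarrow> int. (\<forall>i<n. z i = int q ^ k * e i) \<and> (\<Sum>i<n. of_int (e i) * \<pi> ^ i) = 0" for k
  proof (induction k)
    case 0
    show ?case using sz by (intro exI[of _ z]) simp
  next
    case (Suc k)
    then obtain e where e: "\<And>i. i < n \<Longrightarrow> z i = int q ^ k * e i" "(\<Sum>i<n. of_int (e i) * \<pi> ^ i) = 0" by blast
    have "algebraic_int ((\<Sum>i<n. of_int (e i) * \<pi> ^ i) / of_nat q)" using e(2) by simp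
    hence dvd: "int q dvd e i" if "i < n" for i by (rule eisenstein_dvd[OF q \<pi> eis b0 n _ that])
    define e' where "e' i = e i div int q" for i
    have e': "e i = int q * e' i" if "i < n" for i using dvd[OF that] by (simp add: e'_def)
    have "of_nat q * (\<Sum>i<n. of_int (e' i) * \<pi> ^ i) = (\<Sum>i<n. of_int (e i) * \<pi> ^ i)"
      by (simp add: sum_distrib_left e' mult.assoc)
    hence "(\<Sum>i<n. of_int (e' i) * \<pi> ^ i) = 0" using e(2) q by (simp add: prime_gt_0_nat)
    moreover have "z i = int q ^ Suc k * e' i" if "i < n" for i
      using e(1)[OF that] e'[OF that] by simp
    ultimately show ?case by blast
  qed
  hence dvd: "int q ^ k dvd z i" for k using i by (metis dvd_triv_left)
  have "z i = 0"
  proof (rule ccontr)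
    assume nz: "z i \<noteq> 0"
    define k where "k = nat \<bar>z i\<bar>"
    have "int q ^ k \<le> \<bar>z i\<bar>" using dvd_imp_le_int[OF nz dvd[of k]] by simp
    moreover have "int k < 2 ^ k" using of_nat_less_two_power by auto
    moreover have "(2::int) ^ k \<le> int q ^ k" using prime_ge_2_nat[OF q] by (intro power_mono) auto
    ultimately show False by (simp add: k_def)
  qed
  thus ?thesis using d(2)[OF i] d(1) by simp
qed

section \<open>Relations between seventh roots of ideals\<close>

context cyclic_septic
begin

definition prime_power_prod :: "nat set \<Rightarrow> (nat \<Rightarrow> nat) \<Rightarrow> nat" where
  "prime_power_prod S a = (\<Prod>p\<in>S. p ^ a p)"

text \<open>What remains of a principal product of ideals: if Q_p^7 = (p) for
  \<open>p \<in> S\<close> and \<open>x\<close> generates the product of the powers of Q_p with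
  exponents \<open>a p\<close>, then \<open>x ^ 7\<close> and \<open>prime_power_prod S a\<close>
  differ by a unit. Only elements occur, so the unit count applies directly.\<close>

definition rel :: "nat set \<Rightarrow> (nat \<Rightarrow> nat) \<Rightarrow> bool" where
  "rel S a \<longleftrightarrow> (\<exists>x\<in>K. x \<noteq> 0 \<and> unit_K (x ^ 7 / of_nat (prime_power_prod S a)))"

lemma prime_power_prod_comb:
  "prime_power_prod S (\<lambda>p. k * a p + l * a' p) = prime_power_prod S a ^ k * prime_power_prod S a' ^ l"
  by (simp add: prime_power_prod_def power_add prod.distrib prod_power_distrib
      mult.commute[of k] mult.commute[of l] flip: power_mult)

lemma prime_power_prod_pos: "(\<And>p. p \<in> S \<Longrightarrow> prime p) \<Longrightarrow> prime_power_prod S a > 0"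
  unfolding prime_power_prod_def by (intro prod_pos) (auto simp: prime_gt_0_nat)

lemma multiplicity_prime_power_prod:
  "finite S \<Longrightarrow> (\<And>p. p \<in> S \<Longrightarrow> prime p) \<Longrightarrow> p \<in> S \<Longrightarrow> multiplicity p (prime_power_prod S a) = a p"
  unfolding prime_power_prod_def by (subst multiplicity_prod_prime_powers) auto

lemma seventh_power_mod:
  assumes S: "finite S" "\<And>p. p \<in> S \<Longrightarrow> prime p" and "m > 0" "l > 0"
    and eq: "m ^ 7 * prime_power_prod S a' = l ^ 7 * prime_power_prod S a" and p: "p \<in> S"
  shows "[a p = a' p] (mod 7)"
proof -
  have pp: "prime_elem p" using S(2)[OF p] by simp
  have *: "multiplicity p (x ^ 7 * prime_power_prod S e) = 7 * multiplicity p x + e p" if "x > 0" for x e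
    using that prime_power_prod_pos[of S e] S p pp
    by (subst prime_elem_multiplicity_mult_distrib)
      (auto simp: prime_elem_multiplicity_power_distrib multiplicity_prime_power_prod)
  have "7 * multiplicity p m + a' p = 7 * multiplicity p l + a p"
    using *[OF \<open>m > 0\<close>, of a'] *[OF \<open>l > 0\<close>, of a] eq by simp
  thus ?thesis unfolding cong_def by presburger
qed

lemma \<sigma>_of_nat: "\<sigma> (of_nat k) = of_nat k"
  using conj_of_nat[of "Suc 0" k] unfolding conj_1 .

text \<open>The rational factor \<open>P\<close> is fixed by \<open>\<sigma>\<close> and cancels in
  \<open>D x ^ 7\<close>, which is thus a unit, and so is its root \<open>D x\<close>. The norm is
  \<open>1\<close> because \<open>\<sigma>\<close> preserves norms.\<close>

lemma unit_D:
  assumes "x \<in> K" "x \<noteq> 0" "unit_K (x ^ 7 / of_nat P)" "P > 0"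
  shows "D x \<in> units1"
proof -
  define \<omega> where "\<omega> = x ^ 7 / of_nat P"
  have x7: "x ^ 7 = \<omega> * of_nat P" using assms(4) by (simp add: \<omega>_def)
  have \<omega>: "unit_K \<omega>" using assms(3) by (simp add: \<omega>_def)
  have "D x ^ 7 = \<sigma> (x ^ 7) / x ^ 7"
    using conj_power[of x 1 7] assms(1) by (simp add: D_def conj_1 power_divide)
  also have "\<dots> = \<sigma> \<omega> / \<omega>"
    using assms(4) unit_K_in_K[OF \<omega>] by (simp add: x7 \<sigma>_mult \<sigma>_of_nat)
  finally have "unit_K (D x ^ 7)"
    using unit_K_divide[OF unit_K_conj[OF \<omega>, of 1] \<omega>] by (simp add: conj_1)
  moreover have DK: "D x \<in> K" using assms(1) by (simp add: D_def K_divide \<sigma>_closed)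
  ultimately have "unit_K (D x)" by (intro unit_K_of_power[of "D x" 7]) auto
  moreover have "norm_K (D x) = 1"
  proof -
    have "\<sigma> x = D x * x" using assms(2) by (simp add: D_def)
    hence "norm_K x = norm_K (D x) * norm_K x"
      using norm_K_mult[OF DK assms(1)] norm_K_conj[OF assms(1)] by simp
    thus ?thesis using norm_K_eq_0_iff[OF assms(1)] assms(2) by simp
  qed
  ultimately show ?thesis by (simp add: units1_def)
qed

lemma D_power: "x \<in> K \<Longrightarrow> D (x ^ k) = D x ^ k"
  by (induction k) (auto simp: D_mult K_power)

text \<open>Two relations that are independent modulo \<open>7\<close> would produce \<open>49\<close> classes of units.\<close>

lemma relations_rank:
  assumes S: "finite S" "\<And>p. p \<in> S \<Longrightarrow> prime p" "S \<noteq> {}"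
  shows "\<exists>p0\<in>S. \<forall>a. rel S a \<longrightarrow> 7 dvd a p0 \<longrightarrow> (\<forall>p\<in>S. 7 dvd a p)"
proof (rule ccontr)
  assume "\<not> ?thesis"
  hence no: "\<exists>a. rel S a \<and> 7 dvd a p0 \<and> (\<exists>p\<in>S. \<not> 7 dvd a p)" if "p0 \<in> S" for p0
    using that by blast
  \<comment> \<open>The failure of the claim is used twice, the second time at \<open>p1\<close>.
    Modulo \<open>7\<close> the exponents become triangular: \<open>a\<close> is nonzero at
    \<open>p1\<close>, while \<open>a'\<close> is zero at \<open>p1\<close> and nonzero at
    \<open>p2\<close>.\<close>
  obtain a p1 where a: "rel S a" "p1 \<in> S" "\<not> 7 dvd a p1" using no S(3) by blast
  obtain a' p2 where a': "rel S a'" "7 dvd a' p1" "p2 \<in> S" "\<not> 7 dvd a' p2" using no[OF a(2)] by blast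
  define P where "P = prime_power_prod S a"
  define P' where "P' = prime_power_prod S a'"
  have P: "P > 0" "P' > 0" unfolding P_def P'_def using prime_power_prod_pos[of S] S(2) by simp_all
  obtain x where x: "x \<in> K" "x \<noteq> 0" "unit_K (x ^ 7 / of_nat P)" using a(1) by (auto simp: rel_def P_def)
  obtain x' where x': "x' \<in> K" "x' \<noteq> 0" "unit_K (x' ^ 7 / of_nat P')" using a'(1) by (auto simp: rel_def P'_def)
  define \<omega> where "\<omega> = x ^ 7 / of_nat P"
  define \<omega>' where "\<omega>' = x' ^ 7 / of_nat P'"
  have \<omega>: "unit_K \<omega>" "unit_K \<omega>'" using x x' by (simp_all add: \<omega>_def \<omega>'_def)
  have x7: "x ^ 7 = \<omega> * of_nat P" "x' ^ 7 = \<omega>' * of_nat P'" using P by (simp_all add: \<omega>_def \<omega>'_def)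
  define z where "z k l = x ^ k * x' ^ l" for k l
  have z: "z k l \<in> K" "z k l \<noteq> 0" for k l
    using x x' by (auto simp: z_def intro!: K_mult K_power)
  have Dz: "D (z k l) = D x ^ k * D x' ^ l" for k l
    using x(1) x'(1) by (simp add: z_def D_mult D_power K_power)
  have z7: "z k l ^ 7 = \<omega> ^ k * \<omega>' ^ l * of_nat (prime_power_prod S (\<lambda>p. k * a p + l * a' p))" for k l
  proof -
    have "z k l ^ 7 = (x ^ 7) ^ k * (x' ^ 7) ^ l"
      by (simp add: z_def power_mult_distrib mult.commute[of k] mult.commute[of l] flip: power_mult)
    thus ?thesis
      by (simp add: x7 power_mult_distrib prime_power_prod_comb P_def P'_def mult_ac)
  qed
  \<comment> \<open>An index below \<open>49\<close> encodes two exponents below \<open>7\<close> in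
    base \<open>7\<close>.\<close>
  define c where "c i = D (z (i div 7) (i mod 7))" for i
  have "card {..<49::nat} \<le> 7"
  proof (rule card_unit_classes[where c = c])
    fix i assume "i \<in> {..<49::nat}"
    show "c i \<in> units1"
      unfolding c_def Dz using unit_D[OF x P(1)] unit_D[OF x' P(2)] by (intro units1_mult units1_power)
  next
    fix i j v assume ij: "i \<in> {..<49::nat}" "j \<in> {..<49::nat}" and v: "v \<in> units1" and eq: "c i = c j * D v"
    define k where "k = i div 7"
    define l where "l = i mod 7"
    define k' where "k' = j div 7"
    define l' where "l' = j mod 7"
    have kl: "k < 7" "l < 7" "k' < 7" "l' < 7" using ij by (auto simp: k_def l_def k'_def l'_def)
    \<comment> \<open>Equivalence of the two classes makes \<open>y\<close> invariant under
      \<open>\<sigma>\<close>, hence rational. Seventh powers then give an equation between rational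
      integers up to a unit, which is rational and therefore a sign.\<close>
    define y where "y = z k l / (z k' l' * v)"
    have vK: "v \<in> K" "v \<noteq> 0" using units1D[OF v] by auto
    have yK: "y \<in> K" "y \<noteq> 0" using z vK by (auto simp: y_def intro!: K_divide K_mult)
    have yz: "z k l = y * (z k' l' * v)" using z vK by (simp add: y_def)
    have "D (z k l) = D y * (D (z k' l') * D v)"
      unfolding yz using yK z vK by (simp add: D_mult K_mult)
    moreover have "D (z k l) = D (z k' l') * D v"
      using eq by (simp add: c_def k_def l_def k'_def l'_def)
    moreover have "D (z k l) \<noteq> 0"
      using z[of k l] conj_eq_0_iff[of "z k l" 1] by (simp add: D_def conj_1)
    ultimately have "D y = 1" by auto
    hence "\<sigma> y = y" using yK by (simp add: D_def)
    hence "y \<in> \<rat>" using yK by (intro fixed_imp_Rats)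
    then obtain m d where md: "d > 0" "y = of_int m / of_int d" by (auto elim: Rats_cases')
    have m0: "m \<noteq> 0" using yK(2) md by auto
    define A where "A = prime_power_prod S (\<lambda>p. k * a p + l * a' p)"
    define A' where "A' = prime_power_prod S (\<lambda>p. k' * a p + l' * a' p)"
    have A: "A > 0" "A' > 0" unfolding A_def A'_def using prime_power_prod_pos[of S] S(2) by simp_all
    define \<epsilon> where "\<epsilon> = (\<omega> ^ k * \<omega>' ^ l) / (\<omega> ^ k' * \<omega>' ^ l' * v ^ 7)"
    have \<epsilon>: "unit_K \<epsilon>"
      unfolding \<epsilon>_def by (intro unit_K_divide unit_K_mult unit_K_power \<omega> units1D(1)[OF v])
    have nz: "\<omega> ^ k' * \<omega>' ^ l' * v ^ 7 \<noteq> 0" using unit_K_nz[OF \<omega>(1)] unit_K_nz[OF \<omega>(2)] vK by simp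
    have "z k l ^ 7 = y ^ 7 * (z k' l' ^ 7 * v ^ 7)" unfolding yz by (simp only: power_mult_distrib)
    hence "(\<omega> ^ k * \<omega>' ^ l) * of_nat A = y ^ 7 * of_nat A' * (\<omega> ^ k' * \<omega>' ^ l' * v ^ 7)"
      by (simp add: z7 A_def A'_def mult_ac)
    moreover have "y = U / V * z" if "U * z = y * V" "V \<noteq> 0" for U V y z :: complex
      using that by (simp add: field_simps)
    ultimately have y7: "y ^ 7 * of_nat A' = \<epsilon> * of_nat A"
      using nz unfolding \<epsilon>_def by blast
    hence "\<epsilon> = y ^ 7 * of_nat A' / of_nat A" using A by simp
    hence "\<epsilon> \<in> \<rat>" using \<open>y \<in> \<rat>\<close> by simp
    hence "\<epsilon> = 1 \<or> \<epsilon> = - 1" using \<epsilon> by (intro unit_K_Rats)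
    moreover have "of_int (m ^ 7 * int A') = \<epsilon> * of_int (d ^ 7 * int A)"
    proof -
      have "of_int m = y * of_int d" using md by simp
      hence "of_int (m ^ 7 * int A') = (y ^ 7 * of_nat A') * of_int d ^ 7"
        by (simp add: power_mult_distrib mult_ac)
      thus ?thesis unfolding y7 by (simp add: mult_ac)
    qed
    ultimately have "m ^ 7 * int A' = d ^ 7 * int A \<or> m ^ 7 * int A' = - (d ^ 7 * int A)"
    proof (elim disjE)
      assume "\<epsilon> = 1" and e: "of_int (m ^ 7 * int A') = \<epsilon> * of_int (d ^ 7 * int A)"
      hence "(of_int (m ^ 7 * int A') :: complex) = of_int (d ^ 7 * int A)" by (simp only: mult_1)
      hence "m ^ 7 * int A' = d ^ 7 * int A" by (simp only: of_int_eq_iff)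
      thus ?thesis ..
    next
      assume "\<epsilon> = - 1" and e: "of_int (m ^ 7 * int A') = \<epsilon> * of_int (d ^ 7 * int A)"
      hence "(of_int (m ^ 7 * int A') :: complex) = of_int (- (d ^ 7 * int A))"
        by (simp only: mult_minus1 of_int_minus)
      hence "m ^ 7 * int A' = - (d ^ 7 * int A)" by (simp only: of_int_eq_iff)
      thus ?thesis ..
    qed
    hence "\<bar>m ^ 7 * int A'\<bar> = \<bar>d ^ 7 * int A\<bar>" by auto
    hence "int (nat \<bar>m\<bar> ^ 7 * A') = int (nat \<bar>d\<bar> ^ 7 * A)"
      by (simp add: abs_mult power_abs)
    hence main: "nat \<bar>m\<bar> ^ 7 * A' = nat \<bar>d\<bar> ^ 7 * A" by (simp only: of_nat_eq_iff)
    have cong: "[k * a p + l * a' p = k' * a p + l' * a' p] (mod 7)" if "p \<in> S" for p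
      using seventh_power_mod[OF S(1,2) _ _ main[unfolded A_def A'_def] that] m0 md(1) by simp
    have p7: "prime (7::nat)" by simp
    have "[k * a p1 = k' * a p1] (mod 7)"
    proof -
      have "[k * a p1 + l * a' p1 = k * a p1] (mod 7)" "[k' * a p1 + l' * a' p1 = k' * a p1] (mod 7)"
        using a'(2) by (auto simp: cong_def mod_add_eq[symmetric])
      thus ?thesis using cong[OF a(2)] by (meson cong_sym cong_trans)
    qed
    moreover have "coprime (a p1) 7"
      using prime_imp_coprime[OF p7 a(3)] by (simp add: coprime_commute)
    ultimately have "[k = k'] (mod 7)" by (simp add: cong_mult_rcancel_nat)
    hence kk: "k = k'" using kl by (simp add: cong_def)
    hence "[l * a' p2 = l' * a' p2] (mod 7)" using cong[OF a'(3)] by (simp add: cong_add_lcancel_nat)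
    moreover have "coprime (a' p2) 7"
      using prime_imp_coprime[OF p7 a'(4)] by (simp add: coprime_commute)
    ultimately have "[l = l'] (mod 7)" by (simp add: cong_mult_rcancel_nat)
    hence "l = l'" using kl by (simp add: cong_def)
    thus "i = j" using kk unfolding k_def l_def k'_def l'_def by (metis div_mod_decomp)
  qed simp
  thus False by simp
qed

end

section \<open>Leading coefficients and divided differences\<close>

text \<open>The divided difference of \<open>p\<close> over \<open>n + 1\<close> nodes. It concerns
  the coefficient at \<open>n\<close> rather than the leading one, so that it covers smaller degrees
  too.\<close>

lemma coeff_lagrange:
  fixes p :: "'a :: field poly"
  assumes A: "finite A" "card A = Suc n" and deg: "Polynomial.degree p \<le> n"
  shows "Polynomial.coeff p n = (\<Sum>x\<in>A. poly p x / (\<Prod>y\<in>A-{x}. x - y))"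
proof -
  define L where "L x = (\<Prod>y\<in>A-{x}. [:- y, 1:])" for x
  define r where "r = (\<Sum>x\<in>A. Polynomial.smult (poly p x / (\<Prod>y\<in>A-{x}. x - y)) (L x))"
  have degL: "Polynomial.degree (L x) = n" if "x \<in> A" for x
    unfolding L_def using that A by (subst degree_prod_sum_eq) auto
  have leadL: "Polynomial.coeff (L x) n = 1" if "x \<in> A" for x
    using degL[OF that] lead_coeff_prod[of "\<lambda>y. [:- y, 1:]" "A - {x}"] by (simp add: L_def)
  have polyL: "poly (L x) z = (\<Prod>y\<in>A-{x}. z - y)" for x z
    by (simp add: L_def poly_prod)
  have eval: "poly r z = poly p z" if z: "z \<in> A" for z
  proof -
    have "poly r z = (\<Sum>x\<in>A. poly p x / (\<Prod>y\<in>A-{x}. x - y) * (\<Prod>y\<in>A-{x}. z - y))"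
      by (simp add: r_def poly_sum polyL)
    also have "\<dots> = (\<Sum>x\<in>{z}. poly p x / (\<Prod>y\<in>A-{x}. x - y) * (\<Prod>y\<in>A-{x}. z - y))"
    proof (rule sum.mono_neutral_right)
      show "\<forall>x\<in>A - {z}. poly p x / (\<Prod>y\<in>A-{x}. x - y) * (\<Prod>y\<in>A-{x}. z - y) = 0"
        using z A by (auto simp: prod_zero_iff)
    qed (use A z in auto)
    also have "\<dots> = poly p z" using A by simp
    finally show ?thesis .
  qed
  have "Polynomial.degree r \<le> n"
    unfolding r_def using A degL by (intro degree_sum_le) (auto intro: order.trans[OF degree_smult_le])
  have "r - p = 0"
  proof (rule ccontr)
    assume nz: "r - p \<noteq> 0"
    have "A \<subseteq> {z. poly (r - p) z = 0}" using eval by auto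
    hence "card A \<le> card {z. poly (r - p) z = 0}" using poly_roots_finite[OF nz] by (intro card_mono)
    also have "\<dots> \<le> Polynomial.degree (r - p)" using nz by (rule card_poly_roots_bound)
    also have "\<dots> \<le> n" using deg \<open>Polynomial.degree r \<le> n\<close> by (rule degree_diff_le[rotated])
    finally show False using A by simp
  qed
  hence "Polynomial.coeff p n = Polynomial.coeff r n" by simp
  also have "\<dots> = (\<Sum>x\<in>A. poly p x / (\<Prod>y\<in>A-{x}. x - y))"
    by (simp add: r_def coeff_sum leadL)
  finally show ?thesis .
qed

section \<open>Characteristic ideals as fractional ideals\<close>

context cyclic_septic
begin

text \<open>Passing from degree equal to \<open>n\<close> to degree at most \<open>n\<close> absorbs
  the adjoined zero and makes closure under addition evident even when leading terms cancel.\<close>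

lemma char_ideal_iff:
  "a \<in> char_ideal K n \<longleftrightarrow>
     (\<exists>f. f \<in> int_valued_polys K \<and> Polynomial.degree f \<le> n \<and> Polynomial.coeff f n = a)" (is "_ \<longleftrightarrow> ?R")
proof
  assume "a \<in> char_ideal K n"
  thus ?R
  proof (cases "a = 0")
    case True
    have "0 \<in> int_valued_polys K" by (simp add: int_valued_polys_def)
    thus ?thesis using True by (intro exI[of _ 0]) simp
  next
    case False
    thus ?thesis using \<open>a \<in> char_ideal K n\<close> by (auto simp: char_ideal_def)
  qed
next
  assume ?R
  then obtain f where f: "f \<in> int_valued_polys K" "Polynomial.degree f \<le> n" "Polynomial.coeff f n = a" by blast
  show "a \<in> char_ideal K n"
  proof (cases "a = 0")
    case False
    hence "Polynomial.degree f = n" using f le_degree[of f n] by auto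
    thus ?thesis using f by (auto simp: char_ideal_def)
  qed (simp add: char_ideal_def)
qed

lemma int_valued_add: "p \<in> int_valued_polys K \<Longrightarrow> g \<in> int_valued_polys K \<Longrightarrow> p + g \<in> int_valued_polys K"
  by (simp add: int_valued_polys_def K_add O_add)

lemma int_valued_smult: "p \<in> int_valued_polys K \<Longrightarrow> a \<in> \<O> \<Longrightarrow> Polynomial.smult a p \<in> int_valued_polys K"
  by (simp add: int_valued_polys_def K_mult O_mult O_K)

lemma char_ideal_add: "a \<in> char_ideal K n \<Longrightarrow> a' \<in> char_ideal K n \<Longrightarrow> a + a' \<in> char_ideal K n"
proof -
  assume "a \<in> char_ideal K n" "a' \<in> char_ideal K n"
  then obtain g g' where "g \<in> int_valued_polys K" "Polynomial.degree g \<le> n" "Polynomial.coeff g n = a"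
    "g' \<in> int_valued_polys K" "Polynomial.degree g' \<le> n" "Polynomial.coeff g' n = a'"
    unfolding char_ideal_iff by blast
  thus ?thesis unfolding char_ideal_iff
    by (intro exI[of _ "g + g'"]) (simp add: int_valued_add degree_add_le)
qed

lemma char_ideal_scale: "a \<in> char_ideal K n \<Longrightarrow> c \<in> \<O> \<Longrightarrow> c * a \<in> char_ideal K n"
proof -
  assume "a \<in> char_ideal K n" and c: "c \<in> \<O>"
  then obtain g where "g \<in> int_valued_polys K" "Polynomial.degree g \<le> n" "Polynomial.coeff g n = a"
    unfolding char_ideal_iff by blast
  thus ?thesis unfolding char_ideal_iff using c
    by (intro exI[of _ "Polynomial.smult c g"]) (simp add: int_valued_smult order.trans[OF degree_smult_le])
qed

lemma char_ideal_O: "a \<in> \<O> \<Longrightarrow> a \<in> char_ideal K n"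
  unfolding char_ideal_iff
  by (intro exI[of _ "Polynomial.monom a n"])
    (simp add: int_valued_polys_def degree_monom_le poly_monom O_mult O_power O_K coeff_monom)

lemma char_ideal_Suc: "a \<in> char_ideal K n \<Longrightarrow> a \<in> char_ideal K (Suc n)"
proof -
  assume "a \<in> char_ideal K n"
  then obtain g where g: "g \<in> int_valued_polys K" "Polynomial.degree g \<le> n" "Polynomial.coeff g n = a"
    unfolding char_ideal_iff by blast
  have "pCons 0 g \<in> int_valued_polys K"
    using g(1) by (auto simp: int_valued_polys_def O_mult coeff_pCons split: nat.splits)
  thus ?thesis unfolding char_ideal_iff using g by (intro exI[of _ "pCons 0 g"]) (simp add: degree_pCons_le[THEN order.trans])
qed

text \<open>Lagrange's formula writes \<open>a\<close> as a sum of integral values divided by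
  products of node differences, so a common multiple \<open>E\<close> of these products clears the
  denominator. Later the nodes are chosen to keep \<open>E\<close> small at
  \<open>q\<close>.\<close>

lemma char_ideal_denominator:
  assumes A: "finite A" "card A = Suc n" "A \<subseteq> \<O>" and a: "a \<in> char_ideal K n"
    and E: "\<And>x. x \<in> A \<Longrightarrow> \<exists>w\<in>\<O>. E = w * (\<Prod>y\<in>A-{x}. x - y)"
  shows "E * a \<in> \<O>"
proof -
  obtain g where g: "g \<in> int_valued_polys K" "Polynomial.degree g \<le> n" "Polynomial.coeff g n = a"
    using a unfolding char_ideal_iff by blast
  have "E * a = (\<Sum>x\<in>A. E * (poly g x / (\<Prod>y\<in>A-{x}. x - y)))"
    using coeff_lagrange[OF A(1,2) g(2)] by (simp add: g(3) sum_distrib_left)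
  also have "\<dots> \<in> \<O>"
  proof (rule O_sum)
    fix x assume x: "x \<in> A"
    obtain w where w: "w \<in> \<O>" "E = w * (\<Prod>y\<in>A-{x}. x - y)" using E[OF x] by blast
    have "(\<Prod>y\<in>A-{x}. x - y) \<noteq> 0" using A by (auto simp: prod_zero_iff)
    hence "E * (poly g x / (\<Prod>y\<in>A-{x}. x - y)) = w * poly g x" by (simp add: w(2))
    moreover have "poly g x \<in> \<O>" using g(1) x A(3) by (auto simp: int_valued_polys_def)
    ultimately show "E * (poly g x / (\<Prod>y\<in>A-{x}. x - y)) \<in> \<O>" using w(1) by (simp add: O_mult)
  qed
  finally show ?thesis .
qed

text \<open>Up to sign the square of the Vandermonde determinant of the nodes: a crude common
  multiple of all denominators in Lagrange's formula.\<close>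

definition differences :: "complex set \<Rightarrow> complex" where
  "differences A = (\<Prod>x\<in>A. \<Prod>y\<in>A-{x}. x - y)"

lemma differences_multiple:
  assumes "finite A" "A \<subseteq> \<O>" "x \<in> A"
  shows "\<exists>w\<in>\<O>. differences A = w * (\<Prod>y\<in>A-{x}. x - y)"
proof
  show "differences A = (\<Prod>x\<in>A-{x}. \<Prod>y\<in>A-{x}. x - y) * (\<Prod>y\<in>A-{x}. x - y)"
    unfolding differences_def using assms by (subst prod.remove[of A x]) (auto simp: mult.commute)
  show "(\<Prod>x\<in>A-{x}. \<Prod>y\<in>A-{x}. x - y) \<in> \<O>"
    using assms by (intro O_prod O_diff) auto
qed

lemma differences_of_nat:
  "differences (of_nat ` {..n}) = of_int (\<Prod>x\<le>n. \<Prod>y\<in>{..n}-{x}. int x - int y)"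
proof -
  have inj: "inj_on (of_nat :: nat \<Rightarrow> complex) B" for B by (auto intro: inj_onI)
  have "(\<Prod>y\<in>of_nat ` {..n} - {of_nat x}. of_nat x - y) = (of_int (\<Prod>y\<in>{..n}-{x}. int x - int y) :: complex)"
    if "x \<le> n" for x
  proof -
    have "of_nat ` {..n} - {of_nat x} = (of_nat ` ({..n} - {x}) :: complex set)" by auto
    thus ?thesis by (simp add: prod.reindex[OF inj])
  qed
  thus ?thesis unfolding differences_def by (simp add: prod.reindex[OF inj])
qed

lemma nat_nodes: "finite (of_nat ` {..n} :: complex set)" "card (of_nat ` {..n} :: complex set) = Suc n"
  "of_nat ` {..n} \<subseteq> \<O>"
  by (auto simp: card_image inj_on_def)

lemma char_ideal_int_denominator:
  "a \<in> char_ideal K n \<Longrightarrow> of_int (\<Prod>x\<le>n. \<Prod>y\<in>{..n}-{x}. int x - int y) * a \<in> \<O>"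
  unfolding differences_of_nat[symmetric]
  by (rule char_ideal_denominator[OF nat_nodes]) (auto intro!: differences_multiple nat_nodes)

lemma frac_char_ideal: "frac (char_ideal K n)"
proof (rule fracI)
  show "char_ideal K n \<subseteq> K" by (auto simp: char_ideal_iff int_valued_polys_def)
  show "\<exists>x\<in>char_ideal K n. x \<noteq> 0" using char_ideal_O[OF O_1] by (intro bexI[of _ 1]) auto
  show "of_int (\<Prod>x\<le>n. \<Prod>y\<in>{..n}-{x}. int x - int y) \<in> \<O>" by (rule O_int)
  show "of_int (\<Prod>x\<le>n. \<Prod>y\<in>{..n}-{x}. int x - int y) * a \<in> \<O>" if "a \<in> char_ideal K n" for a
    using that by (rule char_ideal_int_denominator)
  show "of_int (\<Prod>x\<le>n. \<Prod>y\<in>{..n}-{x}. int x - int y) \<noteq> (0 :: complex)"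
    by (simp add: prod_zero_iff del: of_int_prod)
qed (auto intro: char_ideal_add char_ideal_scale char_ideal_O)

end

section \<open>Totally ramified primes\<close>

text \<open>The field structure, given by \<open>f\<close> and \<open>\<theta>\<close>, is kept
  apart from the element \<open>\<pi>\<close> and the Eisenstein coefficients \<open>b\<close>
  belonging to \<open>q\<close>, so that one cyclic field can be examined at several primes.\<close>

locale ramified_prime = cyclic_septic f \<theta> K \<sigma> for f \<theta> K \<sigma> +
  fixes q :: nat and \<pi> :: complex and b :: "nat \<Rightarrow> int"
  assumes q_prime: "prime q" and \<pi>_O: "\<pi> \<in> \<O>"
    and eis: "\<pi> ^ 7 = - of_nat q * (\<Sum>i<7. of_int (b i) * \<pi> ^ i)" and b0: "\<not> int q dvd b 0"
    and K_\<pi>: "x \<in> K \<Longrightarrow> \<exists>c :: nat \<Rightarrow> rat. x = (\<Sum>i<7. of_rat (c i) * \<pi> ^ i)"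
begin

section \<open>The prime ideal above \<open>q\<close> and its residue field\<close>

lemma q_nz: "(of_nat q :: complex) \<noteq> 0" and q_int_nz: "int q \<noteq> 0"
  using q_prime by (simp_all add: prime_gt_0_nat)

lemma q_prime_int: "prime (int q)"
  using q_prime by simp

text \<open>The order \<open>\<int>[\<pi>]\<close> is maximal at \<open>q\<close>.\<close>

lemma O_local:
  assumes x: "x \<in> \<O>"
  shows "\<exists>m c. \<not> int q dvd m \<and> of_int m * x = (\<Sum>i<7. of_int (c i) * \<pi> ^ i)"
proof -
  obtain r :: "nat \<Rightarrow> rat" where r: "x = (\<Sum>i<7. of_rat (r i) * \<pi> ^ i)"
    using K_\<pi>[OF O_K[OF x]] by blast
  obtain d :: int and z :: "nat \<Rightarrow> int" where d: "d > 0" "\<And>i. i < 7 \<Longrightarrow> of_int d * r i = of_int (z i)"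
    using rat_common_denominator[of 7 r] by blast
  have z: "(of_int d * of_rat (r i) :: complex) = of_int (z i)" if "i < 7" for i
    using d(2)[OF that] by (metis of_rat_mult of_rat_of_int_eq)
  define ok where "ok m \<longleftrightarrow> m > 0 \<and> (\<exists>c::nat \<Rightarrow> int. of_int (int m) * x = (\<Sum>i<7. of_int (c i) * \<pi> ^ i))" for m :: nat
  have "ok (nat d)"
    using d(1) by (auto simp: ok_def r sum_distrib_left mult.assoc[symmetric] z intro!: exI[of _ z])
  \<comment> \<open>If \<open>q\<close> divided the least denominator \<open>m\<close>, then
    \<open>eisenstein_dvd\<close> would make all coefficients divisible by \<open>q\<close>, and the
    quotient of \<open>m\<close> by \<open>q\<close> would be a smaller denominator.\<close>
  define m where "m = (LEAST m. ok m)"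
  have m: "ok m" unfolding m_def using \<open>ok (nat d)\<close> by (rule LeastI)
  then obtain c :: "nat \<Rightarrow> int" where c: "of_int (int m) * x = (\<Sum>i<7. of_int (c i) * \<pi> ^ i)"
    by (auto simp: ok_def)
  have "\<not> int q dvd int m"
  proof
    assume "int q dvd int m"
    then obtain m' where m': "m = q * m'" by (auto simp: int_dvd_int_iff)
    have "(\<Sum>i<7. of_int (c i) * \<pi> ^ i) / of_nat q = of_nat m' * x"
      using q_nz by (simp add: c[symmetric] m')
    hence int: "algebraic_int ((\<Sum>i<7. of_int (c i) * \<pi> ^ i) / of_nat q)"
      using x by (auto simp: O_iff intro: algebraic_int_mult algebraic_int_of_nat)
    have dvd: "int q dvd c i" if "i < 7" for i
      by (rule eisenstein_dvd[OF q_prime _ eis b0 _ int that]) (use \<pi>_O in \<open>auto simp: O_iff\<close>)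
    have "of_nat q * (of_nat m' * x) = of_nat q * (\<Sum>i<7. of_int (c i div int q) * \<pi> ^ i)"
    proof -
      have "of_nat q * (of_nat m' * x) = (\<Sum>i<7. of_int (c i) * \<pi> ^ i)"
        by (simp add: c[symmetric] m')
      also have "\<dots> = (\<Sum>i<7. of_int (int q * (c i div int q)) * \<pi> ^ i)"
        using dvd by (intro sum.cong) auto
      finally show ?thesis by (simp add: sum_distrib_left mult.assoc)
    qed
    hence "of_int (int m') * x = (\<Sum>i<7. of_int (c i div int q) * \<pi> ^ i)"
      using q_nz by simp
    moreover have "m' > 0" using m m' by (auto simp: ok_def)
    ultimately have "ok m'" unfolding ok_def by (intro conjI exI[of _ "\<lambda>i. c i div int q"])
    hence "m \<le> m'" unfolding m_def by (rule Least_le)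
    thus False using m' \<open>m' > 0\<close> prime_ge_2_nat[OF q_prime] by simp
  qed
  thus ?thesis using c by blast
qed

lemma inverse_mod_q: "\<not> int q dvd m \<Longrightarrow> \<exists>m' e. m * m' = 1 + int q * e"
proof -
  assume "\<not> int q dvd m"
  hence "coprime m (int q)" using q_prime_int by (metis coprime_commute prime_imp_coprime)
  then obtain m' where "[m * m' = 1] (mod int q)" using cong_solve_coprime_int by blast
  hence "int q dvd m * m' - 1" by (simp add: cong_iff_dvd_diff)
  then obtain e where "m * m' - 1 = int q * e" by blast
  hence "m * m' = 1 + int q * e" by simp
  thus ?thesis by blast
qed

text \<open>The quotient of \<open>\<pi> ^ 7\<close> by \<open>- q\<close>. It is congruent to
  \<open>b 0\<close> modulo \<open>\<pi>\<close>, hence invertible at \<open>q\<close>;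
  \<open>\<gamma>\<close> is the cofactor in this congruence.\<close>

definition \<beta> :: complex where "\<beta> = (\<Sum>i<7. of_int (b i) * \<pi> ^ i)"
definition \<gamma> :: complex where "\<gamma> = (\<Sum>i<6. of_int (b (Suc i)) * \<pi> ^ i)"

lemma \<gamma>_O: "\<gamma> \<in> \<O>"
  unfolding \<gamma>_def by (intro O_sum O_mult O_power O_int \<pi>_O)

lemma tail_split: "(\<Sum>i<7. of_int (c i) * \<pi> ^ i) = of_int (c 0) + \<pi> * (\<Sum>i<6. of_int (c (Suc i)) * \<pi> ^ i)"
proof -
  have "(\<Sum>i<Suc 6. of_int (c i) * \<pi> ^ i) = of_int (c 0) + (\<Sum>i<6. of_int (c (Suc i)) * \<pi> ^ Suc i)"
    unfolding sum.lessThan_Suc_shift by simp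
  thus ?thesis by (simp add: sum_distrib_left mult_ac)
qed

lemma \<beta>_eq: "\<beta> = of_int (b 0) + \<pi> * \<gamma>"
  unfolding \<beta>_def \<gamma>_def by (rule tail_split)

lemma \<pi>7: "\<pi> ^ 7 = - of_nat q * \<beta>"
  unfolding \<beta>_def by (rule eis)

lemma \<beta>_O: "\<beta> \<in> \<O>"
  unfolding \<beta>_eq by (intro O_add O_mult O_int \<pi>_O \<gamma>_O)

text \<open>The ideal generated by \<open>q\<close> and \<open>\<pi> ^ k\<close>; for
  \<open>k\<close> from \<open>1\<close> to \<open>7\<close> it turns out to be the k-th power of
  the prime \<open>Q\<close> above \<open>q\<close>.\<close>

definition QQ :: "nat \<Rightarrow> complex set" where
  "QQ k = {u * of_nat q + v * \<pi> ^ k | u v. u \<in> \<O> \<and> v \<in> \<O>}"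

abbreviation Q :: "complex set" where "Q \<equiv> QQ (Suc 0)"

lemma QQ_I: "u \<in> \<O> \<Longrightarrow> v \<in> \<O> \<Longrightarrow> u * of_nat q + v * \<pi> ^ k \<in> QQ k"
  unfolding QQ_def by blast

lemma QQ_E:
  assumes "x \<in> QQ k" obtains u v where "u \<in> \<O>" "v \<in> \<O>" "x = u * of_nat q + v * \<pi> ^ k"
  using assms unfolding QQ_def by blast

lemma QQ_add: "x \<in> QQ k \<Longrightarrow> y \<in> QQ k \<Longrightarrow> x + y \<in> QQ k"
proof -
  assume "x \<in> QQ k" "y \<in> QQ k"
  then obtain u v u' v' where *: "u \<in> \<O>" "v \<in> \<O>" "x = u * of_nat q + v * \<pi> ^ k"
    "u' \<in> \<O>" "v' \<in> \<O>" "y = u' * of_nat q + v' * \<pi> ^ k" by (elim QQ_E)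
  have "x + y = (u + u') * of_nat q + (v + v') * \<pi> ^ k" by (simp add: * algebra_simps)
  thus ?thesis using QQ_I[OF O_add[OF *(1,4)] O_add[OF *(2,5)]] by simp
qed

lemma QQ_mult: "x \<in> QQ k \<Longrightarrow> a \<in> \<O> \<Longrightarrow> a * x \<in> QQ k"
proof -
  assume "x \<in> QQ k" and a: "a \<in> \<O>"
  then obtain u v where *: "u \<in> \<O>" "v \<in> \<O>" "x = u * of_nat q + v * \<pi> ^ k" by (elim QQ_E)
  have "a * x = (a * u) * of_nat q + (a * v) * \<pi> ^ k" by (simp add: * algebra_simps)
  thus ?thesis using QQ_I[OF O_mult[OF a *(1)] O_mult[OF a *(2)]] by simp
qed

lemma q_QQ: "of_nat q \<in> QQ k"
  using QQ_I[of 1 0 k] by simp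

lemma \<pi>_QQ: "\<pi> ^ k \<in> QQ k"
  using QQ_I[of 0 1 k] by simp

lemma \<pi>_Q: "\<pi> \<in> Q"
  using \<pi>_QQ[of "Suc 0"] by simp

lemma QQ_O: "x \<in> QQ k \<Longrightarrow> x \<in> \<O>"
  by (elim QQ_E) (simp add: O_add O_mult O_power \<pi>_O)

lemma frac_QQ: "frac (QQ k)"
proof (rule fracI[where d = 1])
  show "QQ k \<subseteq> K" using QQ_O O_K by blast
  show "\<exists>x\<in>QQ k. x \<noteq> 0" using q_QQ q_nz by blast
  show "0 \<in> QQ k" using QQ_mult[OF q_QQ O_0] by simp
qed (auto intro: QQ_add QQ_mult QQ_O)

lemma Q_diff: "x \<in> Q \<Longrightarrow> y \<in> Q \<Longrightarrow> x - y \<in> Q"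
  by (rule frac_diff[OF frac_QQ])

lemma qO_Q: "a \<in> \<O> \<Longrightarrow> of_nat q * a \<in> Q"
  using QQ_mult[OF q_QQ] by (simp add: mult.commute)

text \<open>Modulo \<open>q\<close> an element of \<open>Q\<close> is a multiple of
  \<open>\<pi>\<close>, and \<open>\<pi> ^ 7\<close> is divisible by \<open>q\<close>.\<close>

lemma Q_seventh_power:
  assumes "x \<in> Q" shows "\<exists>e\<in>\<O>. x ^ 7 = of_nat q * e"
proof -
  obtain u v where *: "u \<in> \<O>" "v \<in> \<O>" "x = u * of_nat q + v * \<pi>" using assms by (auto elim: QQ_E)
  have "x ^ 7 - (v * \<pi>) ^ 7 = (x - v * \<pi>) * (\<Sum>i<7. (v * \<pi>) ^ (7 - Suc i) * x ^ i)"
    by (rule power_diff_sumr2)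
  hence "x ^ 7 = of_nat q * (u * (\<Sum>i<7. (v * \<pi>) ^ (7 - Suc i) * x ^ i)) + v ^ 7 * \<pi> ^ 7"
    by (simp add: *(3) power_mult_distrib algebra_simps)
  also have "\<dots> = of_nat q * (u * (\<Sum>i<7. (v * \<pi>) ^ (7 - Suc i) * x ^ i) - v ^ 7 * \<beta>)"
    by (simp add: \<pi>7 algebra_simps)
  finally show ?thesis
    using * \<pi>_O \<beta>_O QQ_O[OF assms]
    by (intro bexI[of _ "u * (\<Sum>i<7. (v * \<pi>) ^ (7 - Suc i) * x ^ i) - v ^ 7 * \<beta>"])
      (simp_all add: O_mult O_diff O_power O_sum)
qed

lemma int_in_Q: "of_int z \<in> Q \<Longrightarrow> int q dvd z"
proof -
  assume "of_int z \<in> Q"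
  then obtain e where e: "e \<in> \<O>" "of_int z ^ 7 = of_nat q * e" using Q_seventh_power by blast
  hence "of_int (z ^ 7) / of_int (int q) = e" using q_nz by simp
  hence "algebraic_int (of_int (z ^ 7) / of_int (int q) :: complex)" using e(1) by (simp add: O_iff)
  hence "int q dvd z ^ 7" using q_int_nz by (rule of_int_quotient_algebraic_int)
  thus ?thesis using q_prime_int by (rule prime_dvd_power[rotated])
qed

text \<open>The residue field at \<open>Q\<close> is the prime field. By \<open>O_local\<close> some
  multiple \<open>of_int m * x\<close>, with \<open>m\<close> prime to \<open>q\<close>, is an
  integral polynomial in \<open>\<pi>\<close>, congruent to its constant term; then \<open>m\<close>
  is inverted modulo \<open>q\<close>.\<close>

lemma residue: "x \<in> \<O> \<Longrightarrow> \<exists>z. x - of_int z \<in> Q"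
proof -
  assume x: "x \<in> \<O>"
  obtain m c where mc: "\<not> int q dvd m" "of_int m * x = (\<Sum>i<7. of_int (c i) * \<pi> ^ i)"
    using O_local[OF x] by blast
  obtain m' e where m': "m * m' = 1 + int q * e" using inverse_mod_q[OF mc(1)] by blast
  define t where "t = (\<Sum>i<6. of_int (c (Suc i)) * \<pi> ^ i)"
  have t: "t \<in> \<O>" unfolding t_def by (intro O_sum O_mult O_int O_power \<pi>_O)
  have mx: "of_int m * x = of_int (c 0) + \<pi> * t" unfolding mc(2) t_def by (rule tail_split)
  have mm: "of_int m * of_int m' = (1 + of_nat q * of_int e :: complex)"
    using arg_cong[OF m', of "of_int :: int \<Rightarrow> complex"] by simp
  have "x + of_nat q * (of_int e * x) = of_int m' * (of_int m * x)"
    using mm by (simp add: algebra_simps)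
  hence "x - of_int (m' * c 0) = (of_int m' * t) * \<pi> - of_nat q * (of_int e * x)"
    unfolding mx by (simp add: algebra_simps)
  moreover have "(of_int m' * t) * \<pi> \<in> Q" using t by (intro QQ_mult \<pi>_Q O_mult O_int)
  moreover have "of_nat q * (of_int e * x) \<in> Q" using x by (intro qO_Q O_mult O_int)
  ultimately show ?thesis by (metis Q_diff)
qed

lemma not_in_Q_iff: "x \<in> \<O> \<Longrightarrow> x - of_int z \<in> Q \<Longrightarrow> x \<notin> Q \<longleftrightarrow> \<not> int q dvd z"
proof -
  assume x: "x \<in> \<O>" "x - of_int z \<in> Q"
  have "of_int z \<in> Q" if "int q dvd z"
  proof -
    obtain e where "z = int q * e" using \<open>int q dvd z\<close> by blast
    thus ?thesis using qO_Q[of "of_int e"] by simp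
  qed
  moreover have "int q dvd z" if "x \<in> Q"
    using Q_diff[OF that x(2)] by (intro int_in_Q) simp
  moreover have "x \<in> Q" if "of_int z \<in> Q" using QQ_add[OF x(2) that] by simp
  ultimately show ?thesis by blast
qed

lemma Q_prime:
  assumes "x \<in> \<O>" "y \<in> \<O>" "x \<notin> Q" "y \<notin> Q" shows "x * y \<notin> Q"
proof -
  obtain z w where z: "x - of_int z \<in> Q" and w: "y - of_int w \<in> Q" using residue assms by blast
  have "x * y - of_int (z * w) = y * (x - of_int z) + of_int z * (y - of_int w)"
    by (simp add: algebra_simps)
  also have "\<dots> \<in> Q" using z w assms by (intro QQ_add QQ_mult O_int)
  finally have "x * y - of_int (z * w) \<in> Q" .
  moreover have "\<not> int q dvd z * w"
    using assms z w q_prime_int not_in_Q_iff by (metis prime_dvd_multD)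
  ultimately show ?thesis using not_in_Q_iff[OF O_mult[OF assms(1,2)]] by blast
qed

lemma one_not_in_Q: "1 \<notin> Q"
  using int_in_Q[of 1] prime_gt_1_nat[OF q_prime] by auto

lemma prod_not_in_Q:
  "(\<And>i. i \<in> I \<Longrightarrow> g i \<in> \<O>) \<Longrightarrow> (\<And>i. i \<in> I \<Longrightarrow> g i \<notin> Q) \<Longrightarrow> (\<Prod>i\<in>I. g i) \<notin> Q"
  by (induction I rule: infinite_finite_induct) (simp_all add: one_not_in_Q Q_prime O_prod)

text \<open>Elements outside \<open>Q\<close> are invertible modulo \<open>q\<close>, because \<open>Q\<^sup>7 \<subseteq> q\<O>\<close>.\<close>

lemma inverse_mod_qO:
  assumes "d \<in> \<O>" "d \<notin> Q" shows "\<exists>d'\<in>\<O>. \<exists>e\<in>\<O>. 1 = d * d' + of_nat q * e"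
proof -
  obtain z where z: "d - of_int z \<in> Q" using residue assms by blast
  have "\<not> int q dvd z" using not_in_Q_iff[OF assms(1) z] assms(2) by blast
  then obtain z' e where z': "z * z' = 1 + int q * e" using inverse_mod_q by blast
  have zz: "of_int z * of_int z' = (1 + of_nat q * of_int e :: complex)"
    using arg_cong[OF z', of "of_int :: int \<Rightarrow> complex"] by simp
  have "1 - d * of_int z' = (of_int z * of_int z' - of_nat q * of_int e) - d * of_int z'" by (simp add: zz)
  also have "\<dots> = (- of_int z') * (d - of_int z) - of_nat q * of_int e" by (simp add: algebra_simps)
  also have "\<dots> \<in> Q" by (rule Q_diff[OF QQ_mult[OF z O_uminus[OF O_int]] qO_Q[OF O_int]])
  finally obtain e' where e': "e' \<in> \<O>" "(1 - d * of_int z') ^ 7 = of_nat q * e'"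
    using Q_seventh_power by blast
  \<comment> \<open>With y = 1 - d z' in \<open>Q\<close>, dividing 1 - y^7 by 1 - y = d z' inverts
    \<open>d\<close> up to y^7, a multiple of \<open>q\<close>.\<close>
  have "1 ^ 7 - (1 - d * of_int z') ^ 7
      = (1 - (1 - d * of_int z')) * (\<Sum>i<7. (1 - d * of_int z') ^ (7 - Suc i) * 1 ^ i)"
    by (rule power_diff_sumr2)
  hence "1 = d * (of_int z' * (\<Sum>i<7. (1 - d * of_int z') ^ (7 - Suc i))) + of_nat q * e'"
    by (simp add: e'(2) algebra_simps)
  moreover have "of_int z' * (\<Sum>i<7. (1 - d * of_int z') ^ (7 - Suc i)) \<in> \<O>"
    using assms by (intro O_mult O_sum O_power O_diff O_int O_1)
  ultimately show ?thesis using e'(1) by blast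
qed

text \<open>Every integer of \<open>K\<close> is congruent to a rational integer modulo
  \<open>Q\<close>, so Fermat's little theorem applies. It is the source of an integer-valued
  polynomial of degree \<open>q\<close> with a denominator.\<close>

lemma fermat_Q: "x \<in> \<O> \<Longrightarrow> x ^ q - x \<in> Q"
proof -
  assume x: "x \<in> \<O>"
  obtain z where z: "x - of_int z \<in> Q" using residue[OF x] by blast
  have "x ^ q - of_int z ^ q = (x - of_int z) * (\<Sum>i<q. of_int z ^ (q - Suc i) * x ^ i)"
    by (rule power_diff_sumr2)
  moreover have "(\<Sum>i<q. of_int z ^ (q - Suc i) * x ^ i) * (x - of_int z) \<in> Q"
    using x z by (intro QQ_mult O_sum O_mult O_power O_int)
  ultimately have 1: "x ^ q - of_int z ^ q \<in> Q" by (simp add: mult.commute)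
  have "int q dvd z ^ q - z"
  proof -
    have "[z ^ q = z] (mod int q)"
    proof (cases "int q dvd z")
      case True
      moreover have "q > 0" using q_prime prime_gt_0_nat by blast
      ultimately show ?thesis by (simp add: cong_def dvd_power_le[of z] mod_eq_0_iff_dvd[symmetric] zero_power power_mod[of z "int q" q, symmetric])
    next
      case False
      define y where "y = nat (z mod int q)"
      have y: "int y = z mod int q" using prime_gt_0_nat[OF q_prime] by (simp add: y_def)
      have "\<not> q dvd y"
        using False y by (metis dvd_mod_iff dvd_refl int_dvd_int_iff)
      hence "[y ^ (q - 1) = 1] (mod q)" using fermat_theorem[OF q_prime] by blast
      hence "[y * y ^ (q - 1) = y * 1] (mod q)" by (rule cong_scalar_left)
      moreover have "y * y ^ (q - 1) = y ^ q" using prime_gt_0_nat[OF q_prime] by (simp add: power_eq_if)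
      ultimately have "[y ^ q = y] (mod q)" by simp
      hence "[int y ^ q = int y] (mod int q)" by (metis cong_int_iff of_nat_power)
      moreover have "[z = int y] (mod int q)" by (simp add: y cong_def)
      ultimately show ?thesis by (meson cong_pow cong_sym cong_trans)
    qed
    thus ?thesis by (simp add: cong_iff_dvd_diff)
  qed
  then obtain e where "z ^ q - z = int q * e" by blast
  hence "of_int z ^ q - of_int z = (of_nat q * of_int e :: complex)"
    by (metis of_int_diff of_int_mult of_int_of_nat_eq of_int_power)
  hence 2: "of_int z ^ q - of_int z \<in> Q" using qO_Q[of "of_int e"] by simp
  have "x ^ q - x = (x ^ q - of_int z ^ q) + (of_int z ^ q - of_int z) - (x - of_int z)" by simp
  also have "\<dots> \<in> Q" by (rule Q_diff[OF QQ_add[OF 1 2] z])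
  finally show ?thesis .
qed

subsection \<open>The seventh power of \<open>Q\<close>\<close>

text \<open>The point is that \<open>q\<close> lies in the product. The Eisenstein relation writes q
  b_0 as a combination of \<open>\<pi> ^ 7\<close>, a multiple of \<open>\<pi> ^ Suc k\<close>, and
  of q \<pi>; then b_0 is inverted modulo \<open>q\<close> at the cost of a multiple of q^2.\<close>

lemma iprod_Q_QQ:
  assumes k: "k \<ge> 1" "k \<le> 6"
  shows "iprod Q (QQ k) = QQ (Suc k)"
proof
  show "iprod Q (QQ k) \<subseteq> QQ (Suc k)"
  proof (rule iprod_least)
    fix x y assume "x \<in> Q" "y \<in> QQ k"
    then obtain u v u' v' where *: "u \<in> \<O>" "v \<in> \<O>" "x = u * of_nat q + v * \<pi> ^ Suc 0"
      "u' \<in> \<O>" "v' \<in> \<O>" "y = u' * of_nat q + v' * \<pi> ^ k" by (elim QQ_E)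
    have "x * y = (u * y + v * \<pi> * u') * of_nat q + (v * v') * \<pi> ^ Suc k"
      by (simp add: *(3,6) algebra_simps)
    moreover have "y \<in> \<O>" using \<open>y \<in> QQ k\<close> by (rule QQ_O)
    ultimately show "x * y \<in> QQ (Suc k)"
      using QQ_I[of "u * y + v * \<pi> * u'" "v * v'" "Suc k"] * by (simp only: O_add O_mult \<pi>_O)
  qed (rule QQ_add)
  have F: "frac (iprod Q (QQ k))" by (intro frac_iprod frac_QQ)
  have pk: "\<pi> ^ Suc k \<in> iprod Q (QQ k)" using iprod_mult[OF \<pi>_Q \<pi>_QQ[of k]] by simp
  have qq: "of_nat q * of_nat q \<in> iprod Q (QQ k)" by (intro iprod_mult q_QQ)
  have qp: "of_nat q * \<pi> \<in> iprod Q (QQ k)" using iprod_mult[OF \<pi>_Q q_QQ[of k]] by (simp add: mult.commute)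
  have p7: "\<pi> ^ 7 \<in> iprod Q (QQ k)"
  proof -
    have "6 - k + Suc k = 7" using k by simp
    hence "\<pi> ^ 7 = \<pi> ^ (6 - k) * \<pi> ^ Suc k" by (metis power_add)
    thus ?thesis using fracD(5)[OF F O_power[OF \<pi>_O] pk] by simp
  qed
  have qI: "of_nat q \<in> iprod Q (QQ k)"
  proof -
    obtain b' e where b': "b 0 * b' = 1 + int q * e" using inverse_mod_q[OF b0] by blast
    have bb: "of_int (b 0) * of_int b' = (1 + of_nat q * of_int e :: complex)"
      using arg_cong[OF b', of "of_int :: int \<Rightarrow> complex"] by simp
    have "of_nat q * of_int (b 0) = of_int (- 1) * \<pi> ^ 7 - \<gamma> * (of_nat q * \<pi>)"
      by (simp add: \<pi>7 \<beta>_eq algebra_simps)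
    also have "\<dots> \<in> iprod Q (QQ k)" by (intro frac_diff[OF F] fracD(5)[OF F] p7 qp O_int \<gamma>_O)
    finally have qb: "of_nat q * of_int (b 0) \<in> iprod Q (QQ k)" .
    have "of_int b' * (of_nat q * of_int (b 0)) - of_int e * (of_nat q * of_nat q) \<in> iprod Q (QQ k)"
      by (rule frac_diff[OF F fracD(5)[OF F O_int qb] fracD(5)[OF F O_int qq]])
    also have "of_int b' * (of_nat q * of_int (b 0)) - of_int e * (of_nat q * of_nat q)
        = of_nat q * (of_int (b 0) * of_int b' - of_nat q * of_int e :: complex)"
      by (simp only: right_diff_distrib mult.assoc mult.left_commute mult.commute)
    also have "\<dots> = of_nat q" unfolding bb by simp
    finally show ?thesis .
  qed
  show "QQ (Suc k) \<subseteq> iprod Q (QQ k)"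
  proof
    fix x assume "x \<in> QQ (Suc k)"
    then obtain u v where *: "u \<in> \<O>" "v \<in> \<O>" "x = u * of_nat q + v * \<pi> ^ Suc k" by (elim QQ_E)
    show "x \<in> iprod Q (QQ k)"
      unfolding *(3) using fracD(4)[OF F fracD(5)[OF F *(1) qI] fracD(5)[OF F *(2) pk]] .
  qed
qed

lemma QQ_7: "QQ 7 = (*) (of_nat q) ` \<O>"
proof
  show "QQ 7 \<subseteq> (*) (of_nat q) ` \<O>"
  proof
    fix x assume "x \<in> QQ 7"
    then obtain u v where *: "u \<in> \<O>" "v \<in> \<O>" "x = u * of_nat q + v * \<pi> ^ 7" by (elim QQ_E)
    have "x = of_nat q * (u - v * \<beta>)" by (simp add: *(3) \<pi>7 algebra_simps)
    thus "x \<in> (*) (of_nat q) ` \<O>" using O_diff[OF *(1) O_mult[OF *(2) \<beta>_O]] by blast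
  qed
  show "(*) (of_nat q) ` \<O> \<subseteq> QQ 7"
    using QQ_mult[OF q_QQ[of 7]] by (auto simp: mult.commute)
qed

lemma Q_power: "Q [^]\<^bsub>FG\<^esub> (7::nat) = (*) (of_nat q) ` \<O>"
proof -
  interpret comm_group FG by (rule comm_group_FG)
  have QC: "Q \<in> carrier FG" using frac_QQ by simp
  have "Q [^]\<^bsub>FG\<^esub> Suc k = QQ (Suc k)" if "k \<le> 6" for k
    using that
  proof (induction k)
    case 0
    thus ?case using QC by (simp add: iprod_O frac_QQ)
  next
    case (Suc k)
    have "Q [^]\<^bsub>FG\<^esub> Suc (Suc k) = iprod (QQ (Suc k)) Q" using Suc by simp
    also have "\<dots> = QQ (Suc (Suc k))" using Suc.prems iprod_Q_QQ[of "Suc k"] by (simp add: iprod_commute)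
    finally show ?case .
  qed
  from this[of 6] show ?thesis by (simp add: QQ_7)
qed

subsection \<open>The characteristic ideals of degree \<open>q - 1\<close> and \<open>q\<close>\<close>

text \<open>The nodes \<open>0, ..., q - 1\<close> are distinct modulo \<open>q\<close>, so the
  characteristic ideal of degree \<open>q - 1\<close> has denominators prime to
  \<open>q\<close>.\<close>

lemma small_differences: "\<not> int q dvd (\<Prod>x\<le>q-1. \<Prod>y\<in>{..q-1}-{x}. int x - int y)"
proof -
  have "\<not> int q dvd int x - int y" if "x \<le> q - 1" "y \<le> q - 1" "y \<noteq> x" for x y
  proof
    assume "int q dvd int x - int y"
    hence "int q \<le> \<bar>int x - int y\<bar>" using that dvd_imp_le_int[of "int x - int y" "int q"] by simp
    thus False using that prime_gt_0_nat[OF q_prime] by linarith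
  qed
  thus ?thesis
    using q_prime_int by (auto simp: prime_dvd_prod_iff)
qed

text \<open>The forward difference g(X + 1) - g(X) is again integer-valued; it lowers the degree by
  one and multiplies the coefficient at \<open>q\<close> by \<open>q\<close>.\<close>

lemma leading_q: "a \<in> char_ideal K q \<Longrightarrow> of_nat q * a \<in> char_ideal K (q - 1)"
proof -
  assume "a \<in> char_ideal K q"
  then obtain g where g: "g \<in> int_valued_polys K" "Polynomial.degree g \<le> q" "Polynomial.coeff g q = a"
    unfolding char_ideal_iff by blast
  define g' where "g' = pcompose g [:1, 1:] - g"
  have q: "q = Suc (q - 1)" using prime_gt_0_nat[OF q_prime] by simp
  have gsum: "g = (\<Sum>i\<le>q. Polynomial.monom (Polynomial.coeff g i) i)"
    using g(2) by (rule poly_as_sum_of_monoms'[symmetric])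
  have cf: "Polynomial.coeff (pcompose g [:1, 1:]) k = (\<Sum>i\<le>q. Polynomial.coeff g i * of_nat (i choose k))" for k
  proof -
    have "pcompose g [:1, 1:] = (\<Sum>i\<le>q. Polynomial.smult (Polynomial.coeff g i) ([:1, 1:] ^ i))"
    proof -
      have "poly g y = (\<Sum>i\<le>q. Polynomial.coeff g i * y ^ i)" for y
        using arg_cong[OF gsum, of "\<lambda>p. poly p y"] by (simp add: poly_sum poly_monom)
      thus ?thesis by (intro poly_eq_poly_eq_iff[THEN iffD1] ext) (simp add: poly_pcompose poly_sum)
    qed
    moreover have "Polynomial.coeff ([:1, 1 :: complex:] ^ i) k = of_nat (i choose k)" for i
      using coeff_linear_poly_power[of k i 1 "1 :: complex"]
      by (cases "k \<le> i") (simp_all add: coeff_eq_0 degree_power_eq binomial_eq_0)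
    ultimately show ?thesis by (simp add: coeff_sum)
  qed
  have "Polynomial.coeff g' k = 0" if "k \<ge> q" for k
  proof -
    have "(\<Sum>i\<le>q. Polynomial.coeff g i * of_nat (i choose k)) = (\<Sum>i\<in>{q}. Polynomial.coeff g i * of_nat (i choose k))"
      using that by (intro sum.mono_neutral_right) (auto simp: binomial_eq_0)
    thus ?thesis using that g(2) by (cases "k = q") (simp_all add: g'_def cf coeff_eq_0 binomial_eq_0)
  qed
  hence "Polynomial.degree g' \<le> q - 1" using q by (intro degree_le) auto
  moreover have "Polynomial.coeff g' (q - 1) = of_nat q * a"
  proof -
    have "(\<Sum>i\<le>q. Polynomial.coeff g i * of_nat (i choose (q - 1)))
        = (\<Sum>i\<in>{q - 1, q}. Polynomial.coeff g i * of_nat (i choose (q - 1)))"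
      using q by (intro sum.mono_neutral_right) (auto simp: binomial_eq_0)
    also have "\<dots> = Polynomial.coeff g (q - 1) + a * of_nat q"
    proof -
      have "q choose (q - 1) = q" using binomial_Suc_n[of "q - 1"] q by simp
      moreover have "q - 1 \<noteq> q" using q by simp
      ultimately show ?thesis using g(3) by simp
    qed
    finally show ?thesis by (simp add: g'_def cf)
  qed
  moreover have "g' \<in> int_valued_polys K"
  proof -
    have "poly g' x \<in> \<O>" if "x \<in> \<O>" for x
      using g(1) that O_add[OF O_1 that] by (simp add: g'_def poly_pcompose int_valued_polys_def O_diff)
    moreover have "Polynomial.coeff g' k \<in> K" for k
      using g(1) by (auto simp: g'_def cf int_valued_polys_def intro!: K_diff K_sum K_mult)
    ultimately show ?thesis by (simp add: int_valued_polys_def)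
  qed
  ultimately show ?thesis unfolding char_ideal_iff by blast
qed

text \<open>Among the nodes \<open>0, ..., q - 1\<close> and \<open>\<pi>\<close>, only
  \<open>0\<close> and \<open>\<pi>\<close> agree modulo \<open>Q\<close>. Interpolation therefore
  costs a single factor \<open>\<pi>\<close> besides a factor \<open>E\<close> outside
  \<open>Q\<close>.\<close>

lemma \<pi>_denominator: "\<exists>E\<in>\<O>. E \<notin> Q \<and> (\<forall>a\<in>char_ideal K q. E * \<pi> * a \<in> \<O>)"
proof -
  define N where "N = (of_nat ` {..q-1} :: complex set)"
  have q: "q = Suc (q - 1)" using prime_gt_0_nat[OF q_prime] by simp
  have \<pi>0: "\<pi> \<noteq> 0"
  proof
    assume "\<pi> = 0"
    hence "\<beta> = 0" using \<pi>7 q_nz by simp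
    hence "of_int (b 0) = (0 :: complex)" using \<beta>_eq \<open>\<pi> = 0\<close> by simp
    thus False using b0 by simp
  qed
  have \<pi>diff: "\<pi> - of_nat i \<notin> Q" "of_nat i - \<pi> \<notin> Q" if "i \<le> q - 1" "i \<noteq> 0" for i
  proof -
    have i: "\<not> int q dvd int i" using that q by (auto dest!: dvd_imp_le simp: int_dvd_int_iff)
    have "of_int (int i) \<notin> Q" using i int_in_Q by blast
    moreover have "of_int (int i) = \<pi> - (\<pi> - of_nat i)" "of_int (int i) = (of_nat i - \<pi>) + \<pi>" by simp_all
    ultimately show "\<pi> - of_nat i \<notin> Q" "of_nat i - \<pi> \<notin> Q" by (metis Q_diff \<pi>_Q, metis QQ_add \<pi>_Q)
  qed
  have ijdiff: "of_nat i - of_nat j \<notin> Q" if "i \<le> q - 1" "j \<le> q - 1" "j \<noteq> i" for i j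
  proof
    assume "of_nat i - of_nat j \<in> Q"
    hence "of_int (int i - int j) \<in> Q" by simp
    hence "int q dvd int i - int j" by (rule int_in_Q)
    hence "int q \<le> \<bar>int i - int j\<bar>" using that dvd_imp_le_int[of "int i - int j" "int q"] by simp
    thus False using that q by linarith
  qed
  have \<pi>N: "\<pi> \<notin> N"
  proof
    assume "\<pi> \<in> N"
    then obtain i where i: "i \<le> q - 1" "\<pi> = of_nat i" by (auto simp: N_def)
    hence "i \<noteq> 0" using \<pi>0 by auto
    moreover have "\<pi> - of_nat i \<in> Q" using i QQ_mult[OF q_QQ O_0] by simp
    ultimately show False using \<pi>diff i by blast
  qed
  define A where "A = insert \<pi> N"
  have N: "finite N" "card N = q" "N \<subseteq> \<O>"
    using nat_nodes[of "q - 1", folded N_def] q by simp_all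
  have A: "finite A" "card A = Suc q" "A \<subseteq> \<O>"
    using \<pi>N N \<pi>_O by (auto simp: A_def)
  have zero: "0 \<in> A" "\<pi> \<in> A" by (auto simp: A_def N_def)
  \<comment> \<open>The difference of \<open>0\<close> and \<open>\<pi>\<close>, the only one in
    \<open>Q\<close>, is replaced by \<open>1\<close>, which keeps the product \<open>E\<close>
    outside \<open>Q\<close>.\<close>
  define d where "d x y = (if {x, y} = {0, \<pi>} then 1 else x - y)" for x y
  have dO: "d x y \<in> \<O>" if "x \<in> A" "y \<in> A" for x y
    using that A(3) by (auto simp: d_def intro!: O_diff)
  have dQ: "d x y \<notin> Q" if "x \<in> A" "y \<in> A" "y \<noteq> x" for x y
  proof (cases "{x, y} = {0, \<pi>}")
    case False
    have "x - y \<notin> Q"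
    proof (cases "x = \<pi>")
      case True
      then obtain i where "y = of_nat i" "i \<le> q - 1"
        using \<open>y \<in> A\<close> \<open>y \<noteq> x\<close> by (auto simp: A_def N_def)
      moreover have "i \<noteq> 0" using False True calculation by auto
      ultimately show ?thesis using True \<pi>diff by blast
    next
      case x: False
      then obtain i where i: "x = of_nat i" "i \<le> q - 1" using \<open>x \<in> A\<close> by (auto simp: A_def N_def)
      show ?thesis
      proof (cases "y = \<pi>")
        case True
        hence "i \<noteq> 0" using False i by auto
        thus ?thesis using True i \<pi>diff by blast
      next
        case y: False
        then obtain j where "y = of_nat j" "j \<le> q - 1" using \<open>y \<in> A\<close> by (auto simp: A_def N_def)
        thus ?thesis using i ijdiff that(3) by blast
      qed
    qed
    thus ?thesis using False by (simp add: d_def)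
  qed (simp add: d_def one_not_in_Q)
  define E where "E = (\<Prod>x\<in>A. \<Prod>y\<in>A-{x}. d x y)"
  have EO: "E \<in> \<O>" unfolding E_def by (intro O_prod dO) auto
  have EQ: "E \<notin> Q" unfolding E_def using dO dQ by (intro prod_not_in_Q O_prod) auto
  have mult: "\<exists>w\<in>\<O>. E * \<pi> = w * (\<Prod>y\<in>A-{x}. x - y)" if x: "x \<in> A" for x
  proof -
    define R where "R = (\<Prod>x\<in>A-{x}. \<Prod>y\<in>A-{x}. d x y)"
    have R: "R \<in> \<O>" unfolding R_def by (intro O_prod dO) auto
    have ER: "E = (\<Prod>y\<in>A-{x}. d x y) * R"
      unfolding E_def R_def using A(1) x by (rule prod.remove)
    show ?thesis
    proof (cases "x = 0 \<or> x = \<pi>")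
      case False
      hence "(\<Prod>y\<in>A-{x}. d x y) = (\<Prod>y\<in>A-{x}. x - y)" by (intro prod.cong) (auto simp: d_def doubleton_eq_iff)
      hence "E * \<pi> = (R * \<pi>) * (\<Prod>y\<in>A-{x}. x - y)" by (simp add: ER mult_ac)
      thus ?thesis using O_mult[OF R \<pi>_O] by blast
    next
      case True
      define x' where "x' = \<pi> - x"
      have x': "x' \<in> A - {x}" "{x, x'} = {0, \<pi>}" using True zero \<pi>0 by (auto simp: x'_def)
      have "(\<Prod>y\<in>A-{x}. d x y) = d x x' * (\<Prod>y\<in>A-{x}-{x'}. d x y)"
        using A(1) x'(1) by (intro prod.remove) auto
      also have "d x x' = 1" using x' by (simp add: d_def)
      also have "(\<Prod>y\<in>A-{x}-{x'}. d x y) = (\<Prod>y\<in>A-{x}-{x'}. x - y)"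
        using True x' by (intro prod.cong) (auto simp: d_def x'_def doubleton_eq_iff)
      finally have 1: "(\<Prod>y\<in>A-{x}. d x y) = (\<Prod>y\<in>A-{x}-{x'}. x - y)" by simp
      have 2: "(\<Prod>y\<in>A-{x}. x - y) = (x - x') * (\<Prod>y\<in>A-{x}-{x'}. x - y)"
        using A(1) x'(1) by (intro prod.remove) auto
      have "\<exists>s\<in>\<O>. \<pi> = s * (x - x')"
        using True
      proof
        assume "x = 0"
        thus ?thesis by (intro bexI[of _ "- 1"]) (simp_all add: x'_def O_uminus)
      next
        assume "x = \<pi>"
        thus ?thesis by (intro bexI[of _ 1]) (simp_all add: x'_def)
      qed
      then obtain s where s: "s \<in> \<O>" "\<pi> = s * (x - x')" by blast
      have "E * \<pi> = (R * s) * (\<Prod>y\<in>A-{x}. x - y)"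
        unfolding ER 1 2 by (subst s(2)) (simp add: mult_ac)
      thus ?thesis using O_mult[OF R s(1)] by blast
    qed
  qed
  have "E * \<pi> * a \<in> \<O>" if "a \<in> char_ideal K q" for a
    by (rule char_ideal_denominator[OF A that mult])
  thus ?thesis using EO EQ by blast
qed

text \<open>Locally at \<open>q\<close> the ideal of degree \<open>q - 1\<close> is trivial and that
  of degree \<open>q\<close> is the inverse of \<open>Q\<close>. Multiplication by \<open>q\<close>
  and by \<open>\<pi>\<close> leads from the latter to the former by \<open>leading_q\<close> and
  \<open>\<pi>_denominator\<close>; conversely one explicit polynomial places \<open>1\<close> in
  the product.\<close>

lemma char_ideal_step: "iprod Q (char_ideal K q) = char_ideal K (q - 1)"
proof
  let ?J = "char_ideal K q" and ?J' = "char_ideal K (q - 1)"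
  have q: "q = Suc (q - 1)" using prime_gt_0_nat[OF q_prime] by simp
  have JJ: "a \<in> ?J" if "a \<in> ?J'" for a using char_ideal_Suc[OF that] q by simp
  have FJ': "frac ?J'" and FJ: "frac ?J" by (rule frac_char_ideal)+
  obtain E where E: "E \<in> \<O>" "E \<notin> Q" "\<And>a. a \<in> ?J \<Longrightarrow> E * \<pi> * a \<in> \<O>"
    using \<pi>_denominator by blast
  obtain E' e where E': "E' \<in> \<O>" "e \<in> \<O>" "1 = E * E' + of_nat q * e"
    using inverse_mod_qO[OF E(1,2)] by blast
  have \<pi>a: "\<pi> * a \<in> ?J'" if a: "a \<in> ?J" for a
  proof -
    have "\<pi> * a = (E * E' + of_nat q * e) * (\<pi> * a)" unfolding E'(3)[symmetric] by simp
    also have "\<dots> = E' * (E * \<pi> * a) + e * \<pi> * (of_nat q * a)" by (simp add: algebra_simps)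
    also have "\<dots> \<in> ?J'"
      by (rule char_ideal_add[OF char_ideal_O[OF O_mult[OF E'(1) E(3)[OF a]]]
            char_ideal_scale[OF leading_q[OF a] O_mult[OF E'(2) \<pi>_O]]])
    finally show ?thesis .
  qed
  show "iprod Q ?J \<subseteq> ?J'"
  proof (rule iprod_least)
    fix x a assume "x \<in> Q" and a: "a \<in> ?J"
    then obtain u v where *: "u \<in> \<O>" "v \<in> \<O>" "x = u * of_nat q + v * \<pi>" by (auto elim: QQ_E)
    have "x * a = u * (of_nat q * a) + v * (\<pi> * a)" by (simp add: *(3) algebra_simps)
    also have "\<dots> \<in> ?J'"
      by (rule char_ideal_add[OF char_ideal_scale[OF leading_q[OF a] *(1)] char_ideal_scale[OF \<pi>a[OF a] *(2)]])
    finally show "x * a \<in> ?J'" .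
  qed (rule char_ideal_add)
  have F: "frac (iprod Q ?J)" by (intro frac_iprod frac_QQ FJ)
  have one_J: "1 \<in> ?J" by (rule char_ideal_O[OF O_1])
  have \<pi>6: "\<pi> ^ 6 / of_nat q \<in> ?J"
  proof -
    \<comment> \<open>This polynomial, \<pi>^6 / q times X^q - X, is integer-valued because X^q - X
      takes values in \<open>Q\<close> and \<pi>^7 / q is minus \<open>\<beta>\<close>. Its leading
      coefficient times \<open>\<pi>\<close> is thus invertible at \<open>q\<close>.\<close>
    define g where "g = Polynomial.smult (\<pi> ^ 6 / of_nat q) (Polynomial.monom 1 q - Polynomial.monom 1 1)"
    have c: "\<pi> ^ 6 / of_nat q \<in> K" using \<pi>_O by (intro K_divide K_power O_K) simp_all
    have "poly g x \<in> \<O>" if x: "x \<in> \<O>" for x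
    proof -
      obtain u v where *: "u \<in> \<O>" "v \<in> \<O>" "x ^ q - x = u * of_nat q + v * \<pi>"
        using fermat_Q[OF x] by (auto elim: QQ_E)
      have "poly g x = \<pi> ^ 6 / of_nat q * (u * of_nat q + v * \<pi>)"
        by (simp add: g_def poly_monom *(3)[symmetric])
      also have "\<dots> = u * \<pi> ^ 6 + v * (\<pi> ^ 7 / of_nat q)"
        using q_nz by (simp add: field_simps eval_nat_numeral)
      also have "\<pi> ^ 7 / of_nat q = - \<beta>" using q_nz by (simp add: \<pi>7)
      finally show ?thesis using * \<beta>_O \<pi>_O by (simp add: O_add O_mult O_power O_uminus O_diff)
    qed
    moreover have "Polynomial.coeff g i \<in> K" for i
      unfolding g_def using c by (auto simp: coeff_monom intro!: K_mult K_diff K_uminus)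
    ultimately have "g \<in> int_valued_polys K" by (simp add: int_valued_polys_def)
    moreover have "Polynomial.degree g \<le> q"
      unfolding g_def using prime_gt_0_nat[OF q_prime]
      by (intro order.trans[OF degree_smult_le] degree_diff_le degree_monom_le[THEN order.trans]) auto
    moreover have "Polynomial.coeff g q = \<pi> ^ 6 / of_nat q"
      using prime_gt_1_nat[OF q_prime] by (simp add: g_def coeff_monom)
    ultimately show ?thesis unfolding char_ideal_iff by blast
  qed
  have qP: "of_nat q \<in> iprod Q ?J" using iprod_mult[OF q_QQ[of "Suc 0"] one_J] by simp
  have \<pi>P: "\<pi> \<in> iprod Q ?J" using iprod_mult[OF \<pi>_Q one_J] by simp
  have "\<pi> * (\<pi> ^ 6 / of_nat q) \<in> iprod Q ?J" by (rule iprod_mult[OF \<pi>_Q \<pi>6])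
  also have "\<pi> * (\<pi> ^ 6 / of_nat q) = \<pi> ^ 7 / of_nat q" by (simp add: eval_nat_numeral)
  also have "\<dots> = - \<beta>" using q_nz by (simp add: \<pi>7)
  finally have \<beta>P: "- \<beta> \<in> iprod Q ?J" .
  obtain b' e0 where b': "b 0 * b' = 1 + int q * e0" using inverse_mod_q[OF b0] by blast
  have bb: "of_int (b 0) * of_int b' = (1 + of_nat q * of_int e0 :: complex)"
    using arg_cong[OF b', of "of_int :: int \<Rightarrow> complex"] by simp
  have "(- of_int b') * (- \<beta>) - (of_int b' * \<gamma>) * \<pi> - of_int e0 * of_nat q \<in> iprod Q ?J"
    using \<gamma>_O by (intro frac_diff[OF F] fracD(5)[OF F] \<beta>P \<pi>P qP O_mult O_uminus O_int)
  also have "(- of_int b') * (- \<beta>) - (of_int b' * \<gamma>) * \<pi> - of_int e0 * of_nat q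
      = of_int (b 0) * of_int b' - of_nat q * of_int e0" by (simp add: \<beta>_eq algebra_simps)
  also have "\<dots> = 1" by (simp add: bb)
  finally have one: "1 \<in> iprod Q ?J" .
  show "?J' \<subseteq> iprod Q ?J"
  proof
    fix a assume a: "a \<in> ?J'"
    define d where "d = (\<Prod>x\<le>q-1. \<Prod>y\<in>{..q-1}-{x}. int x - int y)"
    have da: "of_int d * a \<in> \<O>" unfolding d_def by (rule char_ideal_int_denominator[OF a])
    have "\<not> int q dvd d" unfolding d_def by (rule small_differences)
    then obtain d' e1 where d': "d * d' = 1 + int q * e1" using inverse_mod_q by blast
    have dd: "of_int d * of_int d' = (1 + of_nat q * of_int e1 :: complex)"
      using arg_cong[OF d', of "of_int :: int \<Rightarrow> complex"] by simp
    have "a = (of_int d * of_int d' - of_nat q * of_int e1) * a" by (simp add: dd)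
    also have "\<dots> = (of_int d' * (of_int d * a)) * 1 - of_int e1 * (of_nat q * a)" by (simp add: algebra_simps)
    also have "\<dots> \<in> iprod Q ?J"
      by (rule frac_diff[OF F fracD(5)[OF F O_mult[OF O_int da] one]
            fracD(5)[OF F O_int iprod_mult[OF q_QQ JJ[OF a]]]])
    finally show "a \<in> iprod Q ?J" .
  qed
qed

lemma Q_class_in_polya: "ideal_class K Q \<in> carrier (polya_group K)"
proof -
  interpret C: comm_group "class_group K" by (rule comm_group_class_group)
  let ?S = "{ideal_class K (char_ideal K n) | n. n \<ge> 1}"
  have in_S: "ideal_class K (char_ideal K n) \<in> generate (class_group K) ?S" if "n \<ge> 1" for n
    using that by (intro generate.incl) blast
  have car: "ideal_class K (char_ideal K n) \<in> carrier (class_group K)" for n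
    by (intro ideal_class_carrier frac_char_ideal)
  have QC: "ideal_class K Q \<in> carrier (class_group K)" by (intro ideal_class_carrier frac_QQ)
  have "ideal_class K Q \<otimes>\<^bsub>class_group K\<^esub> ideal_class K (char_ideal K q) = ideal_class K (char_ideal K (q - 1))"
    unfolding ideal_class_mult[OF frac_QQ frac_char_ideal] char_ideal_step ..
  hence "ideal_class K Q = ideal_class K (char_ideal K (q - 1)) \<otimes>\<^bsub>class_group K\<^esub>
      inv\<^bsub>class_group K\<^esub> ideal_class K (char_ideal K q)"
    using QC car by (metis C.inv_solve_right)
  moreover have "inv\<^bsub>class_group K\<^esub> ideal_class K (char_ideal K q) \<in> generate (class_group K) ?S"
    using prime_gt_0_nat[OF q_prime] by (intro generate.inv) auto
  moreover have "q - 1 \<ge> 1" using prime_gt_1_nat[OF q_prime] by simp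
  ultimately show ?thesis
    unfolding polya_group_def using in_S[of "q - 1"] by (simp add: generate.eng)
qed

lemma ramified_ideal_ex:
  "\<exists>I. frac I \<and> I [^]\<^bsub>FG\<^esub> (7::nat) = (*) (of_nat q) ` \<O> \<and> ideal_class K I \<in> carrier (polya_group K)"
  using frac_QQ Q_power Q_class_in_polya by blast

end

section \<open>Elementary abelian subgroups\<close>

text \<open>A subgroup with \<open>p ^ k\<close> elements forces
  \<open>k < p ^ k \<le> card (carrier G)\<close>, so the admissible ranks are bounded and
  \<open>GREATEST\<close> is attained.\<close>

lemma contains_elementary_le_p_rank:
  assumes fin: "finite (carrier G)" and p: "p \<ge> 2" and l: "contains_elementary G p l"
  shows "l \<le> p_rank p G"
  unfolding p_rank_def
proof (rule Greatest_le_nat[where P = "contains_elementary G p" and b = "card (carrier G)", OF l])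
  fix k assume "contains_elementary G p k"
  then obtain H where H: "subgroup H G" "G\<lparr>carrier := H\<rparr> \<cong> product_group {..<k} (\<lambda>_. integer_mod_group p)"
    by (auto simp: contains_elementary_def)
  have "card (carrier (G\<lparr>carrier := H\<rparr>)) = card (carrier (product_group {..<k} (\<lambda>_. integer_mod_group p)))"
    using H(2) by (auto simp: is_iso_def iso_def intro: bij_betw_same_card)
  hence "card H = p ^ k"
    using p by (simp add: card_PiE carrier_integer_mod_group)
  moreover have "card H \<le> card (carrier G)"
    using subgroup.subset[OF H(1)] fin by (rule card_mono[rotated])
  moreover have "k < p ^ k" using less_exp[of k] power_mono[of 2 p k] p by linarith
  ultimately show "k \<le> card (carrier G)" by simp
qed

lemma (in group) pow_mod_eq:
  assumes "g \<in> carrier G" "g [^] (p::nat) = \<one>"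
  shows "g [^] (m mod p) = g [^] (m::nat)"
proof -
  have "g [^] m = g [^] (p * (m div p) + m mod p)" by simp
  also have "\<dots> = (g [^] p) [^] (m div p) \<otimes> g [^] (m mod p)"
    using assms(1) by (simp only: nat_pow_mult[symmetric] nat_pow_pow)
  finally show ?thesis using assms by simp
qed

lemma (in comm_group) subgroup_finprod_closed:
  assumes "subgroup P G"
  shows "finite A \<Longrightarrow> (\<And>i. i \<in> A \<Longrightarrow> f i \<in> P) \<Longrightarrow> (\<Otimes>i\<in>A. f i) \<in> P"
proof (induction A rule: finite_induct)
  case empty
  thus ?case using assms by (simp add: subgroup.one_closed)
next
  case (insert x F)
  have "f \<in> F \<rightarrow> carrier G" "f x \<in> carrier G"
    using insert.prems subgroup.subset[OF assms] by auto
  thus ?case using insert assms by (simp add: subgroup.m_closed)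
qed

text \<open>Exponent vectors are sent to products of powers of the \<open>g i\<close>. Orders
  dividing \<open>p\<close> make this a homomorphism, independence makes it injective, and its image
  is the required subgroup.\<close>

lemma (in comm_group) contains_elementaryI:
  assumes P: "subgroup P G" and p: "p > 0"
    and g: "\<And>i. i < l \<Longrightarrow> g i \<in> P" "\<And>i. i < l \<Longrightarrow> g i [^] p = \<one>"
    and indep: "\<And>a :: nat \<Rightarrow> nat. (\<And>i. i < l \<Longrightarrow> a i < p) \<Longrightarrow> (\<Otimes>i\<in>{..<l}. g i [^] a i) = \<one> \<Longrightarrow> (\<And>i. i < l \<Longrightarrow> a i = 0)"
  shows "contains_elementary (G\<lparr>carrier := P\<rparr>) p l"
proof -
  define E where "E = product_group {..<l} (\<lambda>_. integer_mod_group p)"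
  have E: "group E" unfolding E_def by (rule product_group) simp
  have gC: "g i \<in> carrier G" if "i < l" for i using g(1)[OF that] subgroup.subset[OF P] by blast
  define \<phi> where "\<phi> v = (\<Otimes>i\<in>{..<l}. g i [^] nat (v i))" for v :: "nat \<Rightarrow> int"
  have car: "v i \<in> {0..<int p}" if "v \<in> carrier E" "i < l" for v i
    using that p by (auto simp: E_def carrier_integer_mod_group PiE_def Pi_def split: if_splits)
  have hom: "\<phi> \<in> hom E G"
  proof (rule homI)
    show "\<phi> v \<in> carrier G" for v unfolding \<phi>_def using gC by (intro finprod_closed) auto
    fix v w assume v: "v \<in> carrier E" and w: "w \<in> carrier E"
    have "g i [^] nat ((v i + w i) mod int p) = g i [^] nat (v i) \<otimes> g i [^] nat (w i)" if i: "i < l" for i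
    proof -
      have "nat ((v i + w i) mod int p) = (nat (v i) + nat (w i)) mod p"
        using car[OF v i] car[OF w i] by (simp add: nat_mod_distrib nat_add_distrib)
      thus ?thesis using pow_mod_eq[OF gC[OF i] g(2)[OF i]] gC[OF i] by (simp add: nat_pow_mult)
    qed
    hence "\<phi> (v \<otimes>\<^bsub>E\<^esub> w) = (\<Otimes>i\<in>{..<l}. g i [^] nat (v i) \<otimes> g i [^] nat (w i))"
      unfolding \<phi>_def using gC by (intro finprod_cong') (auto simp: E_def)
    also have "\<dots> = \<phi> v \<otimes> \<phi> w"
      unfolding \<phi>_def using gC by (intro finprod_multf) auto
    finally show "\<phi> (v \<otimes>\<^bsub>E\<^esub> w) = \<phi> v \<otimes> \<phi> w" .
  qed
  interpret h: group_hom E G \<phi> by (intro group_hom.intro group_hom_axioms.intro E hom is_group)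
  define H where "H = \<phi> ` carrier E"
  have sub: "subgroup H G" unfolding H_def by (rule h.img_is_subgroup)
  have "H \<subseteq> P"
  proof
    fix x assume "x \<in> H"
    then obtain v where v: "x = \<phi> v" by (auto simp: H_def)
    have "g i [^] (k::nat) \<in> P" if "i < l" for i k
      by (induction k) (use g(1)[OF that] P in \<open>auto simp: subgroup.one_closed subgroup.m_closed\<close>)
    thus "x \<in> P" unfolding v \<phi>_def by (intro subgroup_finprod_closed[OF P]) auto
  qed
  have inj: "inj_on \<phi> (carrier E)"
    unfolding h.inj_on_one_iff
  proof (intro allI impI)
    fix v assume v: "v \<in> carrier E" and "\<phi> v = \<one>"
    have z: "nat (v i) = 0" if "i < l" for i
    proof (rule indep[of "\<lambda>i. nat (v i)", OF _ _ that])
      fix i assume "i < l"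
      thus "nat (v i) < p" using car[OF v \<open>i < l\<close>] by auto
    qed (use \<open>\<phi> v = \<one>\<close> in \<open>simp add: \<phi>_def\<close>)
    have "v i = 0" if "i < l" for i using z[OF that] car[OF v that] by simp
    moreover have "v i = undefined" if "\<not> i < l" for i using v that by (auto simp: E_def PiE_def extensional_def)
    ultimately show "v = \<one>\<^bsub>E\<^esub>" by (auto simp: E_def fun_eq_iff)
  qed
  have "\<phi> \<in> iso E (G\<lparr>carrier := H\<rparr>)"
    using hom inj by (auto simp: iso_def hom_def bij_betw_def H_def)
  hence "E \<cong> G\<lparr>carrier := H\<rparr>" by (auto simp: is_iso_def)
  hence "G\<lparr>carrier := H\<rparr> \<cong> E" by (rule group.iso_sym[OF E])
  moreover have "subgroup H (G\<lparr>carrier := P\<rparr>)" using sub P \<open>H \<subseteq> P\<close> by (rule subgroup_incl)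
  ultimately show ?thesis unfolding contains_elementary_def E_def by (intro exI[of _ H]) simp
qed

section \<open>From ideals with principal seventh power to independent classes\<close>

context cyclic_septic
begin

lemma principal_power:
  assumes "x \<in> K" "x \<noteq> 0"
  shows "((*) x ` \<O>) [^]\<^bsub>FG\<^esub> (k::nat) = (*) (x ^ k) ` \<O>"
proof -
  interpret comm_group FG by (rule comm_group_FG)
  show ?thesis
  proof (induction k)
    case (Suc k)
    have F: "frac ((*) x ` \<O>)" using assms by (intro frac_scale frac_O)
    have "((*) x ` \<O>) [^]\<^bsub>FG\<^esub> Suc k = iprod ((*) (x ^ k) ` \<O>) ((*) x ` \<O>)"
      by (simp add: Suc)
    also have "\<dots> = (*) (x ^ Suc k) ` \<O>"
      unfolding iprod_principal[OF F] scale_scale by (simp add: mult.commute)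
    finally show ?case .
  qed simp
qed

lemma ideal_class_power:
  assumes "frac I"
  shows "ideal_class K (I [^]\<^bsub>FG\<^esub> (k::nat)) = ideal_class K I [^]\<^bsub>class_group K\<^esub> k"
proof -
  interpret F: comm_group FG by (rule comm_group_FG)
  interpret C: comm_group "class_group K" by (rule comm_group_class_group)
  show ?thesis
  proof (induction k)
    case 0
    thus ?case using ideal_class_eq_one_iff[OF frac_O] O_PF by simp
  next
    case (Suc k)
    have "frac (I [^]\<^bsub>FG\<^esub> k)" using F.nat_pow_closed[of I k] assms by simp
    thus ?case using ideal_class_mult[of "I [^]\<^bsub>FG\<^esub> k" I] assms Suc by simp
  qed
qed

text \<open>The product of the powers of the \<open>Qf i\<close> is followed through its class and
  its seventh power at once, so that triviality of the class can be turned into an equation between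
  elements.\<close>

lemma relation_of_ideals:
  fixes Qf :: "nat \<Rightarrow> complex set" and p a :: "nat \<Rightarrow> nat"
  assumes "\<And>i. i < k \<Longrightarrow> frac (Qf i)" "\<And>i. i < k \<Longrightarrow> Qf i [^]\<^bsub>FG\<^esub> (7::nat) = (*) (of_nat (p i)) ` \<O>"
    "\<And>i. i < k \<Longrightarrow> p i > 0"
  shows "\<exists>I. frac I \<and> ideal_class K I = (\<Otimes>\<^bsub>class_group K\<^esub>i\<in>{..<k}. ideal_class K (Qf i) [^]\<^bsub>class_group K\<^esub> a i)
    \<and> I [^]\<^bsub>FG\<^esub> (7::nat) = (*) (of_nat (\<Prod>i<k. p i ^ a i)) ` \<O>"
  using assms
proof (induction k)
  case 0
  interpret F: comm_group FG by (rule comm_group_FG)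
  interpret C: comm_group "class_group K" by (rule comm_group_class_group)
  show ?case
    using ideal_class_eq_one_iff[OF frac_O] O_PF frac_O F.nat_pow_one[of 7] by (intro exI[of _ \<O>]) simp
next
  case (Suc k)
  interpret F: comm_group FG by (rule comm_group_FG)
  interpret C: comm_group "class_group K" by (rule comm_group_class_group)
  have "\<exists>I. frac I \<and> ideal_class K I = (\<Otimes>\<^bsub>class_group K\<^esub>i\<in>{..<k}. ideal_class K (Qf i) [^]\<^bsub>class_group K\<^esub> a i)
    \<and> I [^]\<^bsub>FG\<^esub> (7::nat) = (*) (of_nat (\<Prod>i<k. p i ^ a i)) ` \<O>"
    by (rule Suc.IH) (simp_all add: Suc.prems)
  then obtain I where I: "frac I"
    "ideal_class K I = (\<Otimes>\<^bsub>class_group K\<^esub>i\<in>{..<k}. ideal_class K (Qf i) [^]\<^bsub>class_group K\<^esub> a i)"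
    "I [^]\<^bsub>FG\<^esub> (7::nat) = (*) (of_nat (\<Prod>i<k. p i ^ a i)) ` \<O>"
    by (elim exE conjE)
  have Q: "frac (Qf k)" "Qf k [^]\<^bsub>FG\<^esub> (7::nat) = (*) (of_nat (p k)) ` \<O>" "p k > 0"
    using Suc.prems by auto
  define J where "J = Qf k [^]\<^bsub>FG\<^esub> a k"
  have FJ: "frac J" unfolding J_def using F.nat_pow_closed[of "Qf k" "a k"] Q by simp
  have cl: "ideal_class K (Qf i) [^]\<^bsub>class_group K\<^esub> a i \<in> carrier (class_group K)" if "i < Suc k" for i
    using Suc.prems(1)[OF that] by (intro C.nat_pow_closed ideal_class_carrier)
  have "ideal_class K (iprod I J) = ideal_class K I \<otimes>\<^bsub>class_group K\<^esub> ideal_class K J"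
    by (rule ideal_class_mult[OF I(1) FJ, symmetric])
  also have "\<dots> = (\<Otimes>\<^bsub>class_group K\<^esub>i\<in>{..<Suc k}. ideal_class K (Qf i) [^]\<^bsub>class_group K\<^esub> a i)"
  proof -
    have "(\<Otimes>\<^bsub>class_group K\<^esub>i\<in>insert k {..<k}. ideal_class K (Qf i) [^]\<^bsub>class_group K\<^esub> a i) =
        (ideal_class K (Qf k) [^]\<^bsub>class_group K\<^esub> a k) \<otimes>\<^bsub>class_group K\<^esub>
        (\<Otimes>\<^bsub>class_group K\<^esub>i\<in>{..<k}. ideal_class K (Qf i) [^]\<^bsub>class_group K\<^esub> a i)"
      using cl by (intro C.finprod_insert) auto
    moreover have "(\<Otimes>\<^bsub>class_group K\<^esub>i\<in>{..<k}. ideal_class K (Qf i) [^]\<^bsub>class_group K\<^esub> a i) \<in> carrier (class_group K)"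
      using cl by (intro C.finprod_closed) auto
    ultimately show ?thesis
      using cl[of k] by (simp add: lessThan_Suc I(2) J_def ideal_class_power Q(1) C.m_comm)
  qed
  finally have 1: "ideal_class K (iprod I J) = \<dots>" .
  have "iprod I J [^]\<^bsub>FG\<^esub> (7::nat) = iprod (I [^]\<^bsub>FG\<^esub> (7::nat)) (J [^]\<^bsub>FG\<^esub> (7::nat))"
    using F.nat_pow_distrib[of I J 7] I(1) FJ by simp
  also have "J [^]\<^bsub>FG\<^esub> (7::nat) = (Qf k [^]\<^bsub>FG\<^esub> (7::nat)) [^]\<^bsub>FG\<^esub> a k"
    unfolding J_def using F.nat_pow_pow[of "Qf k" "a k" 7] F.nat_pow_pow[of "Qf k" 7 "a k"] Q(1) by (simp add: mult.commute)
  also have "\<dots> = (*) (of_nat (p k) ^ a k) ` \<O>" unfolding Q(2) using Q(3) by (intro principal_power) simp_all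
  also have "iprod (I [^]\<^bsub>FG\<^esub> (7::nat)) \<dots> = (*) (of_nat (\<Prod>i<Suc k. p i ^ a i)) ` \<O>"
  proof -
    have "frac ((*) (of_nat (p k) ^ a k) ` \<O>)" using Q(3) by (intro frac_scale frac_O K_power) simp_all
    thus ?thesis unfolding I(3) by (simp add: iprod_principal scale_scale)
  qed
  finally show ?case using 1 frac_iprod[OF I(1) FJ] by blast
qed

lemma principal_eq_imp_unit:
  assumes "(*) x ` \<O> = (*) y ` \<O>" "y \<noteq> 0" "x \<noteq> 0"
  shows "unit_K (x / y)"
proof -
  have "x * 1 \<in> (*) y ` \<O>" "y * 1 \<in> (*) x ` \<O>" using assms(1) by (metis O_1 imageI)+
  then obtain u w where u: "u \<in> \<O>" "x * 1 = y * u" and w: "w \<in> \<O>" "y * 1 = x * w" by blast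
  have "x / y = u" "inverse (x / y) = w" using u w assms by (simp_all add: field_simps)
  thus ?thesis using u w assms by (simp add: unit_K_def)
qed

text \<open>The prime \<open>p0\<close> singled out by \<open>relations_rank\<close> is left out. A
  relation among the other classes extends by exponent \<open>0\<close> at \<open>p0\<close>, so
  \<open>7\<close> divides all its exponents; being below \<open>7\<close>, they vanish.\<close>

lemma polya_contains_elementary:
  assumes S: "finite S" "\<And>p. p \<in> S \<Longrightarrow> prime p" "card S \<ge> Suc r"
    and Q: "\<And>p. p \<in> S \<Longrightarrow> \<exists>I. frac I \<and> I [^]\<^bsub>FG\<^esub> (7::nat) = (*) (of_nat p) ` \<O>
      \<and> ideal_class K I \<in> carrier (polya_group K)"
  shows "contains_elementary (polya_group K) 7 r"
proof -
  interpret C: comm_group "class_group K" by (rule comm_group_class_group)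
  have "S \<noteq> {}" using S by auto
  from relations_rank[OF S(1,2) this] obtain p0 where p0: "p0 \<in> S"
    "\<And>a p. rel S a \<Longrightarrow> 7 dvd a p0 \<Longrightarrow> p \<in> S \<Longrightarrow> 7 dvd a p" by blast
  have "r \<le> card (S - {p0})" using S p0(1) by simp
  from obtain_subset_with_card_n[OF this] obtain T where T: "T \<subseteq> S - {p0}" "card T = r" by blast
  have fT: "finite T" using T(1) S(1) finite_subset by blast
  obtain e where e: "bij_betw e {0..<r} T" using ex_bij_betw_nat_finite[OF fT] T(2) by blast
  have eS: "e i \<in> S" "e i \<noteq> p0" if "i < r" for i
  proof -
    have "e i \<in> T" using e that by (auto simp: bij_betw_def)
    thus "e i \<in> S" "e i \<noteq> p0" using T(1) by auto
  qed
  have e_inj: "inj_on e {..<r}" and e_img: "e ` {..<r} = T" using e by (auto simp: bij_betw_def atLeast0LessThan)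
  define Qf where "Qf i = (SOME I. frac I \<and> I [^]\<^bsub>FG\<^esub> (7::nat) = (*) (of_nat (e i)) ` \<O>
      \<and> ideal_class K I \<in> carrier (polya_group K))" for i
  have Qf: "frac (Qf i)" "Qf i [^]\<^bsub>FG\<^esub> (7::nat) = (*) (of_nat (e i)) ` \<O>"
    "ideal_class K (Qf i) \<in> carrier (polya_group K)" if "i < r" for i
    using someI_ex[OF Q[OF eS(1)[OF that]]] by (auto simp: Qf_def)
  have pos: "e i > 0" if "i < r" for i using S(2)[OF eS(1)[OF that]] by (rule prime_gt_0_nat)
  let ?P = "generate (class_group K) {ideal_class K (char_ideal K n) | n. n \<ge> 1}"
  have P: "subgroup ?P (class_group K)"
    by (rule C.generate_is_subgroup) (auto intro: ideal_class_carrier frac_char_ideal)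
  show ?thesis
    unfolding polya_group_def
  proof (rule C.contains_elementaryI[OF P, of 7 r "\<lambda>i. ideal_class K (Qf i)"])
    fix i assume i: "i < r"
    show "ideal_class K (Qf i) \<in> ?P" using Qf(3)[OF i] by (simp add: polya_group_def)
    have "(*) (of_nat (e i)) ` \<O> \<in> PF" using pos[OF i] by (intro PF_I) simp_all
    hence "ideal_class K (Qf i [^]\<^bsub>FG\<^esub> (7::nat)) = \<one>\<^bsub>class_group K\<^esub>"
      using Qf(2)[OF i] ideal_class_eq_one_iff[OF PF_frac] by simp
    thus "ideal_class K (Qf i) [^]\<^bsub>class_group K\<^esub> (7::nat) = \<one>\<^bsub>class_group K\<^esub>"
      by (simp only: ideal_class_power[OF Qf(1)[OF i]])
  next
    fix a :: "nat \<Rightarrow> nat" and i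
    assume a: "\<And>i. i < r \<Longrightarrow> a i < 7"
      and one: "(\<Otimes>\<^bsub>class_group K\<^esub>i\<in>{..<r}. ideal_class K (Qf i) [^]\<^bsub>class_group K\<^esub> a i) = \<one>\<^bsub>class_group K\<^esub>"
      and i: "i < r"
    obtain I where I: "frac I" "ideal_class K I = \<one>\<^bsub>class_group K\<^esub>"
      "I [^]\<^bsub>FG\<^esub> (7::nat) = (*) (of_nat (\<Prod>i<r. e i ^ a i)) ` \<O>"
      using relation_of_ideals[of r Qf e a] Qf pos one by auto
    have "I \<in> PF" using I(2) ideal_class_eq_one_iff[OF I(1)] by blast
    then obtain x where x: "x \<in> K" "x \<noteq> 0" "I = (*) x ` \<O>" by (rule PF_E)
    define a' where "a' p = (if p \<in> T then a (the_inv_into {..<r} e p) else 0)" for p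
    have ae: "a' (e i) = a i" if "i < r" for i
      using that e_img by (auto simp: a'_def the_inv_into_f_f[OF e_inj])
    have "prime_power_prod S a' = (\<Prod>p\<in>T. p ^ a' p)"
      unfolding prime_power_prod_def using T(1) S(1) by (intro prod.mono_neutral_right) (auto simp: a'_def)
    also have "\<dots> = (\<Prod>i<r. e i ^ a i)"
      unfolding e_img[symmetric] by (simp add: prod.reindex[OF e_inj] ae)
    finally have "(*) (x ^ 7) ` \<O> = (*) (of_nat (prime_power_prod S a')) ` \<O>"
      using I(3) principal_power[OF x(1,2), of 7] x(3) by simp
    moreover have "prime_power_prod S a' > 0" by (rule prime_power_prod_pos[OF S(2)])
    ultimately have "unit_K (x ^ 7 / of_nat (prime_power_prod S a'))"
      using x(2) by (intro principal_eq_imp_unit) auto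
    hence "rel S a'" using x by (auto simp: rel_def)
    moreover have "a' p0 = 0" using T(1) by (auto simp: a'_def)
    ultimately have "7 dvd a' (e i)" using p0(2) eS(1)[OF i] by simp
    thus "a i = 0" using a[OF i] ae[OF i] by auto
  qed simp
qed

lemma finite_polya_group: "finite (carrier (polya_group K))"
proof -
  interpret C: comm_group "class_group K" by (rule comm_group_class_group)
  have "carrier (polya_group K) \<subseteq> carrier (class_group K)"
    unfolding polya_group_def partial_object.simps
    by (simp, rule C.generate_incl) (auto intro: ideal_class_carrier frac_char_ideal)
  thus ?thesis using finite_class_group by (rule finite_subset)
qed

end

section \<open>Cyclic fields generated by a root of an Eisenstein polynomial\<close>

definition rat_eval :: "rat poly \<Rightarrow> complex \<Rightarrow> complex" where
  "rat_eval p z = poly (map_poly of_rat p) z"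

lemma rat_eval_0 [simp]: "rat_eval 0 z = 0"
  and rat_eval_pCons: "rat_eval (pCons c p) z = of_rat c + z * rat_eval p z"
  by (simp_all add: rat_eval_def Polynomial.map_poly_pCons)

lemma rat_eval_add [simp]: "rat_eval (p + p') z = rat_eval p z + rat_eval p' z"
  by (induction p p' rule: poly_induct2) (simp_all add: rat_eval_pCons of_rat_add algebra_simps)

lemma rat_eval_const [simp]: "rat_eval [:c:] z = of_rat c"
  and rat_eval_1 [simp]: "rat_eval 1 z = 1"
  by (simp_all add: rat_eval_pCons one_pCons)

lemma rat_eval_smult [simp]: "rat_eval (Polynomial.smult c p) z = of_rat c * rat_eval p z"
  by (induction p) (simp_all add: rat_eval_pCons of_rat_mult algebra_simps)

lemma rat_eval_mult [simp]: "rat_eval (p * p') z = rat_eval p z * rat_eval p' z"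
  by (induction p) (simp_all add: rat_eval_pCons algebra_simps)

lemma rat_eval_uminus [simp]: "rat_eval (- p) z = - rat_eval p z"
  using rat_eval_smult[of "-1" p z] by (simp del: rat_eval_smult)

lemma rat_eval_diff [simp]: "rat_eval (p - p') z = rat_eval p z - rat_eval p' z"
  using rat_eval_add[of p "- p'" z] by (simp del: rat_eval_add)

lemma rat_eval_power [simp]: "rat_eval (p ^ k) z = rat_eval p z ^ k"
  by (induction k) simp_all

lemma rat_eval_pcompose [simp]: "rat_eval (pcompose p p') z = rat_eval p (rat_eval p' z)"
  by (induction p) (simp_all add: rat_eval_pCons pcompose_pCons)

lemma rat_eval_monom: "rat_eval (Polynomial.monom c i) z = of_rat c * z ^ i"
  by (simp add: rat_eval_def map_poly_monom poly_monom)

lemma rat_eval_sum: "rat_eval (\<Sum>i\<in>I. p i) z = (\<Sum>i\<in>I. rat_eval (p i) z)"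
  by (induction I rule: infinite_finite_induct) simp_all

lemma rat_eval_altdef:
  assumes "Polynomial.degree p < n"
  shows "rat_eval p z = (\<Sum>i<n. of_rat (Polynomial.coeff p i) * z ^ i)"
proof -
  have "p = (\<Sum>i<n. Polynomial.monom (Polynomial.coeff p i) i)"
    using assms poly_as_sum_of_monoms'[of p "n - 1"] by (cases n) (auto simp: lessThan_Suc_atMost)
  hence "rat_eval p z = rat_eval (\<Sum>i<n. Polynomial.monom (Polynomial.coeff p i) i) z" by simp
  thus ?thesis by (simp add: rat_eval_sum rat_eval_monom)
qed

locale eisenstein_septic =
  fixes q :: nat and b :: "nat \<Rightarrow> int"
  assumes q_prime: "prime q" and b0: "\<not> int q dvd b 0"
begin

definition root :: "complex \<Rightarrow> bool" where
  "root z \<longleftrightarrow> z ^ 7 = - of_nat q * (\<Sum>i<7. of_int (b i) * z ^ i)"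

definition minpoly :: "rat poly" where
  "minpoly = Polynomial.monom 1 7 + (\<Sum>i<7. Polynomial.monom (of_int (int q * b i)) i)"

lemma degree_low: "Polynomial.degree (\<Sum>i<7. Polynomial.monom (of_int (int q * b i) :: rat) i) < 7"
  by (rule degree_sum_less) (auto intro: le_less_trans[OF degree_monom_le])

lemma degree_minpoly: "Polynomial.degree minpoly = 7"
  using degree_low unfolding minpoly_def by (subst degree_add_eq_left) (simp_all add: degree_monom_eq)

lemma minpoly_nz: "minpoly \<noteq> 0"
  using degree_minpoly by auto

lemma rat_eval_minpoly: "rat_eval minpoly z = z ^ 7 + of_nat q * (\<Sum>i<7. of_int (b i) * z ^ i)"
  by (simp add: minpoly_def rat_eval_sum rat_eval_monom of_rat_mult sum_distrib_left mult.assoc)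

lemma root_iff: "root z \<longleftrightarrow> rat_eval minpoly z = 0"
  unfolding root_def rat_eval_minpoly by (simp add: eq_neg_iff_add_eq_0)

lemma algebraic_int_root: "algebraic_int z" if "root z"
proof -
  have "rat_eval minpoly z = 0" using that by (simp add: root_iff)
  show ?thesis
  proof (rule algebraic_int.intros)
    have "Polynomial.degree (map_poly of_rat minpoly :: complex poly) = Polynomial.degree minpoly"
      by (rule Polynomial.degree_map_poly) simp
    hence d: "Polynomial.degree (map_poly of_rat minpoly :: complex poly) = 7"
      by (simp only: degree_minpoly)
    have c: "Polynomial.coeff minpoly 7 = 1"
      using degree_low by (simp add: minpoly_def coeff_eq_0)
    show "Polynomial.lead_coeff (map_poly of_rat minpoly :: complex poly) = 1"
      unfolding d by (subst Polynomial.coeff_map_poly) (simp_all only: c of_rat_0 of_rat_1)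
    show "\<forall>i. Polynomial.coeff (map_poly of_rat minpoly :: complex poly) i \<in> \<int>"
    proof
      fix i
      have "Polynomial.coeff minpoly i \<in> \<int>"
        unfolding minpoly_def by (auto simp: coeff_sum intro!: Ints_add Ints_sum Ints_mult)
      then obtain k where "Polynomial.coeff minpoly i = of_int k" by (rule Ints_cases)
      thus "Polynomial.coeff (map_poly of_rat minpoly :: complex poly) i \<in> \<int>"
        by (simp add: Polynomial.coeff_map_poly)
    qed
    show "poly (map_poly of_rat minpoly) z = 0"
      using \<open>rat_eval minpoly z = 0\<close> by (simp add: rat_eval_def)
  qed
qed

text \<open>\<open>eisenstein_indep\<close> in terms of polynomials; it stands in for the
  irreducibility of \<open>minpoly\<close>.\<close>

lemma rat_eval_eq_0_imp: "p = 0" if "root z" "Polynomial.degree p < 7" "rat_eval p z = 0"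
proof (rule poly_eqI)
  fix i
  have "(\<Sum>i<7. of_rat (Polynomial.coeff p i) * z ^ i) = 0"
    using that(3) rat_eval_altdef[OF that(2)] by simp
  hence "i < 7 \<Longrightarrow> Polynomial.coeff p i = 0"
    using eisenstein_indep[OF q_prime algebraic_int_root[OF that(1)] that(1)[unfolded root_def] b0] by simp
  thus "Polynomial.coeff p i = Polynomial.coeff 0 i"
    using that(2) by (cases "i < 7") (auto simp: coeff_eq_0)
qed

lemma rat_eval_mod: "rat_eval (p mod minpoly) z = rat_eval p z" if "root z"
proof -
  have "rat_eval p z = rat_eval (minpoly * (p div minpoly) + p mod minpoly) z" by simp
  thus ?thesis using that by (simp only: rat_eval_add rat_eval_mult root_iff) simp
qed

lemma degree_mod_minpoly: "Polynomial.degree (p mod minpoly) < 7"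
  using degree_mod_less[OF minpoly_nz, of p] degree_minpoly by auto

lemma minpoly_dvd: "minpoly dvd p" if "root z" "rat_eval p z = 0"
proof -
  have "p mod minpoly = 0"
    using that by (intro rat_eval_eq_0_imp[OF that(1) degree_mod_minpoly]) (simp add: rat_eval_mod)
  thus ?thesis by (simp add: mod_eq_0_iff_dvd)
qed

text \<open>All roots are conjugate, since \<open>minpoly\<close> divides every polynomial that
  vanishes at one of them. This makes substituting another root well defined.\<close>

lemma rat_eval_transfer: "rat_eval p z' = 0" if "root z" "root z'" "rat_eval p z = 0"
  using minpoly_dvd[OF that(1,3)] that(2) by (auto simp: root_iff elim!: dvdE)

lemma rat_eval_transfer_eq:
  "rat_eval p z' = rat_eval p' z'" if "root z" "root z'" "rat_eval p z = rat_eval p' z"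
  using rat_eval_transfer[of z z' "p - p'"] that by simp

text \<open>The greatest common divisor \<open>d\<close> with \<open>minpoly\<close> does not vanish
  at \<open>z\<close>, so its cofactor \<open>e\<close> in \<open>minpoly\<close> does, and
  \<open>minpoly\<close> divides \<open>e\<close>. Hence \<open>d\<close> is a unit and a Bezout
  coefficient yields the inverse.\<close>

lemma inverse_rat_eval: "\<exists>p'. inverse (rat_eval p z) = rat_eval p' z" if z: "root z"
proof (cases "rat_eval p z = 0")
  case True
  thus ?thesis by (intro exI[of _ 0]) simp
next
  case False
  define d u v where "d = gcd p minpoly" and "u = fst (bezout_coefficients p minpoly)"
    and "v = snd (bezout_coefficients p minpoly)"
  have d_eq: "u * p + v * minpoly = d"
    unfolding d_def u_def v_def by (rule bezout_coefficients_fst_snd)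
  have ev_d: "rat_eval d z = rat_eval u z * rat_eval p z"
    using z unfolding d_eq[symmetric] by (simp add: root_iff)
  have "rat_eval d z \<noteq> 0"
  proof
    assume "rat_eval d z = 0"
    moreover have "d dvd p" by (simp add: d_def)
    ultimately have "rat_eval p z = 0" by (auto elim!: dvdE)
    thus False using False by simp
  qed
  obtain e where e: "minpoly = d * e" unfolding d_def by (meson dvdE gcd_dvd2)
  hence "rat_eval e z = 0" using z \<open>rat_eval d z \<noteq> 0\<close> by (simp add: root_iff)
  hence "minpoly dvd e" by (rule minpoly_dvd[OF z])
  then obtain k where k: "e = minpoly * k" by (auto elim: dvdE)
  have "minpoly * (d * k) = minpoly * 1" using e k by (metis mult.left_commute mult_1_right)
  hence "d * k = 1" using minpoly_nz by (simp only: mult_cancel_left) simp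
  hence "rat_eval d z * rat_eval k z = 1" by (metis rat_eval_mult rat_eval_1)
  hence "rat_eval p z * rat_eval (u * k) z = 1" by (simp add: ev_d mult_ac)
  hence "inverse (rat_eval p z) = rat_eval (u * k) z" by (rule inverse_unique)
  thus ?thesis by blast
qed

lemma range_rat_eval: "range (\<lambda>p. rat_eval p z) = {\<Sum>i<7. of_rat (c i) * z ^ i | c :: nat \<Rightarrow> rat. True}"
  if "root z"
proof (rule equalityI; rule subsetI)
  fix x assume "x \<in> range (\<lambda>p. rat_eval p z)"
  then obtain p where "x = rat_eval p z" by blast
  hence "x = (\<Sum>i<7. of_rat (Polynomial.coeff (p mod minpoly) i) * z ^ i)"
    using rat_eval_altdef[OF degree_mod_minpoly, of p z] rat_eval_mod[OF that, of p] by simp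
  thus "x \<in> {\<Sum>i<7. of_rat (c i) * z ^ i | c :: nat \<Rightarrow> rat. True}" by blast
next
  fix x assume "x \<in> {\<Sum>i<7. of_rat (c i) * z ^ i | c :: nat \<Rightarrow> rat. True}"
  then obtain c :: "nat \<Rightarrow> rat" where "x = (\<Sum>i<7. of_rat (c i) * z ^ i)" by blast
  hence "x = rat_eval (\<Sum>i<7. Polynomial.monom (c i) i) z" by (simp add: rat_eval_sum rat_eval_monom)
  thus "x \<in> range (\<lambda>p. rat_eval p z)" by blast
qed

end

text \<open>Some multiple of \<open>i\<close> is \<open>1\<close> modulo the prime \<open>7\<close>,
  so a point fixed by the i-th iterate would be fixed by \<open>g\<close>.\<close>

lemma funpow_7_distinct:
  assumes "(g ^^ 7) x = x" "g x \<noteq> x" "0 < i" "i < 7"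
  shows "(g ^^ i) x \<noteq> x"
proof
  assume i: "(g ^^ i) x = x"
  obtain a where a: "i * a mod 7 = 1"
  proof -
    have "i \<in> {1,2,3,4,5,6}" using assms(3,4) by auto
    thus ?thesis using that[of 1] that[of 2] that[of 3] that[of 4] that[of 5] that[of 6] by auto
  qed
  have "(g ^^ (i * a)) x = x"
  proof (induction a)
    case (Suc a)
    thus ?case using i by (simp add: funpow_add)
  qed simp
  moreover have "(g ^^ (i * a)) x = (g ^^ (i * a mod 7)) x"
    using funpow_mod_eq[OF assms(1), of "i * a"] by simp
  ultimately show False using a assms(2) by simp
qed

locale eisenstein_automorphism = eisenstein_septic +
  fixes z :: complex and R :: "rat poly"
  assumes root_z: "root z" and root_next: "root (rat_eval R z)"
    and period: "(rat_eval R ^^ 7) z = z" and moves: "rat_eval R z \<noteq> z"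
begin

text \<open>Substitution of the root \<open>rat_eval R z\<close> for \<open>z\<close>. By
  \<open>rat_eval_transfer_eq\<close> the choice of the polynomial is immaterial for elements of the
  field.\<close>

definition auto :: "complex \<Rightarrow> complex" where
  "auto x = rat_eval (SOME p. rat_eval p z = x) (rat_eval R z)"

lemma auto_rat_eval: "auto (rat_eval p z) = rat_eval p (rat_eval R z)"
proof -
  have "rat_eval (SOME p'. rat_eval p' z = rat_eval p z) z = rat_eval p z"
    by (rule someI[of _ p]) simp
  thus ?thesis unfolding auto_def by (rule rat_eval_transfer_eq[OF root_z root_next])
qed

lemma rat_eval_funpow: "\<exists>p. \<forall>u. rat_eval p u = (rat_eval R ^^ k) u"
proof (induction k)
  case 0
  show ?case by (intro exI[of _ "[:0, 1:]"]) (simp add: rat_eval_pCons)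
next
  case (Suc k)
  then obtain p where "\<forall>u. rat_eval p u = (rat_eval R ^^ k) u" by blast
  thus ?case by (intro exI[of _ "pcompose R p"]) simp
qed

text \<open>The automorphism replaces the innermost \<open>z\<close> of an iterate; for this the
  iterate is read as a single polynomial in \<open>z\<close>, which \<open>rat_eval_funpow\<close>
  provides.\<close>

lemma auto_funpow: "(auto ^^ k) z = (rat_eval R ^^ k) z"
proof (induction k)
  case (Suc k)
  obtain p where p: "rat_eval p u = (rat_eval R ^^ k) u" for u using rat_eval_funpow[of k] by blast
  have "(auto ^^ Suc k) z = auto (rat_eval p z)" using Suc by (simp add: p)
  also have "\<dots> = rat_eval p (rat_eval R z)" by (rule auto_rat_eval)
  also have "\<dots> = (rat_eval R ^^ Suc k) z" by (simp only: p funpow_Suc_right o_def)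
  finally show ?case .
qed simp

lemma cyclic_septic: "cyclic_septic (\<lambda>i. - int q * b i) z (range (\<lambda>p. rat_eval p z)) auto"
proof
  let ?K = "range (\<lambda>p. rat_eval p z)"
  have z_eq: "z = rat_eval [:0, 1:] z" by (simp add: rat_eval_pCons)
  show "z ^ 7 = (\<Sum>i<7. of_int (- int q * b i) * z ^ i)"
    using root_z by (simp add: root_def sum_distrib_left sum_negf mult.assoc)
  show "c i = 0" if "(\<Sum>i<7. of_rat (c i) * z ^ i) = 0" "i < 7" for c :: "nat \<Rightarrow> rat" and i
    using eisenstein_indep[OF q_prime algebraic_int_root[OF root_z] root_z[unfolded root_def] b0 _ that]
    by simp
  show "?K = {\<Sum>i<7. of_rat (c i) * z ^ i | c :: nat \<Rightarrow> rat. True}" by (rule range_rat_eval[OF root_z])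
  show "z \<in> ?K" using z_eq by blast
  show "x * y \<in> ?K" if "x \<in> ?K" "y \<in> ?K" for x y
  proof -
    from that obtain p p' where "x = rat_eval p z" "y = rat_eval p' z" by blast
    hence "x * y = rat_eval (p * p') z" by simp
    thus ?thesis by blast
  qed
  show "inverse x \<in> ?K" if "x \<in> ?K" for x using that inverse_rat_eval[OF root_z] by fastforce
  show "auto x \<in> ?K" if "x \<in> ?K" for x
  proof -
    from that obtain p where "x = rat_eval p z" by blast
    hence "auto x = rat_eval (pcompose p R) z" by (simp add: auto_rat_eval)
    thus ?thesis by blast
  qed
  show "auto (x + y) = auto x + auto y" "auto (x * y) = auto x * auto y" if "x \<in> ?K" "y \<in> ?K" for x y
  proof -
    from that obtain p p' where p: "x = rat_eval p z" "y = rat_eval p' z" by blast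
    show "auto (x + y) = auto x + auto y"
      using auto_rat_eval[of "p + p'"] by (simp add: p auto_rat_eval)
    show "auto (x * y) = auto x * auto y"
      using auto_rat_eval[of "p * p'"] by (simp add: p auto_rat_eval)
  qed
  show "auto 1 = 1" using auto_rat_eval[of 1] by simp
  show "(auto ^^ 7) z = z" using period by (simp only: auto_funpow)
  show "(auto ^^ i) z \<noteq> z" if "0 < i" "i < 7" for i
    unfolding auto_funpow by (rule funpow_7_distinct[OF period moves that])
qed simp

end

subsection \<open>Simple extensions of the rationals\<close>

text \<open>Generated fields invert only nonzero elements; closure under \<open>inverse\<close> at
  zero rests on the convention \<open>inverse 0 = 0\<close>.\<close>

lemma generate_field_C_ring:
  shows "1 \<in> generate_field C_ring H" "x \<in> H \<Longrightarrow> x \<in> generate_field C_ring H"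
    "x \<in> generate_field C_ring H \<Longrightarrow> - x \<in> generate_field C_ring H"
    "x \<in> generate_field C_ring H \<Longrightarrow> inverse x \<in> generate_field C_ring H"
    "x \<in> generate_field C_ring H \<Longrightarrow> y \<in> generate_field C_ring H \<Longrightarrow> x + y \<in> generate_field C_ring H"
    "x \<in> generate_field C_ring H \<Longrightarrow> y \<in> generate_field C_ring H \<Longrightarrow> x * y \<in> generate_field C_ring H"
proof -
  interpret C: field C_ring by (rule field_from_type_algebra)
  have a_inv: "\<ominus>\<^bsub>C_ring\<^esub> x = - x" for x by (rule C.minus_equality) auto
  have m_inv: "inv\<^bsub>C_ring\<^esub> x = inverse x" if "x \<noteq> 0" for x
    by (rule C.comm_inv_char) (use that in auto)
  have zero: "0 \<in> generate_field C_ring H"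
    using generate_field.eng_add[OF generate_field.one generate_field.a_inv[OF generate_field.one], of C_ring H]
    by (simp add: a_inv)
  show "1 \<in> generate_field C_ring H" using generate_field.one[of C_ring H] by simp
  show "x \<in> H \<Longrightarrow> x \<in> generate_field C_ring H" by (rule generate_field.incl)
  show "x \<in> generate_field C_ring H \<Longrightarrow> - x \<in> generate_field C_ring H"
    using generate_field.a_inv[of x C_ring H] by (simp add: a_inv)
  show "x \<in> generate_field C_ring H \<Longrightarrow> inverse x \<in> generate_field C_ring H"
    using generate_field.m_inv[of x C_ring H] zero by (cases "x = 0") (simp_all add: m_inv)
  show "x \<in> generate_field C_ring H \<Longrightarrow> y \<in> generate_field C_ring H \<Longrightarrow> x + y \<in> generate_field C_ring H"
    using generate_field.eng_add[of x C_ring H y] by simp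
  show "x \<in> generate_field C_ring H \<Longrightarrow> y \<in> generate_field C_ring H \<Longrightarrow> x * y \<in> generate_field C_ring H"
    using generate_field.eng_mult[of x C_ring H y] by simp
qed

lemma generate_field_C_ring_induct [consumes 1]:
  assumes "x \<in> generate_field C_ring H" "P 1" "\<And>x. x \<in> H \<Longrightarrow> P x" "\<And>x. P x \<Longrightarrow> P (- x)"
    "\<And>x. P x \<Longrightarrow> P (inverse x)" "\<And>x y. P x \<Longrightarrow> P y \<Longrightarrow> P (x + y)" "\<And>x y. P x \<Longrightarrow> P y \<Longrightarrow> P (x * y)"
  shows "P x"
proof -
  interpret C: field C_ring by (rule field_from_type_algebra)
  have a_inv: "\<ominus>\<^bsub>C_ring\<^esub> x = - x" for x by (rule C.minus_equality) auto
  have m_inv: "inv\<^bsub>C_ring\<^esub> x = inverse x" if "x \<noteq> 0" for x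
    by (rule C.comm_inv_char) (use that in auto)
  show ?thesis
    using assms(1) by (induction rule: generate_field.induct) (use assms(2-) in \<open>simp_all add: a_inv m_inv\<close>)
qed

lemma generate_field_of_rat: "of_rat r \<in> generate_field C_ring H"
proof -
  note c = generate_field_C_ring
  have nat: "of_nat n \<in> generate_field C_ring H" for n
  proof (induction n)
    case 0
    show ?case using c(5)[OF c(1) c(3)[OF c(1)], of H] by simp
  next
    case (Suc n)
    show ?case using c(5)[OF c(1) Suc] by simp
  qed
  have int: "of_int k \<in> generate_field C_ring H" for k
    using nat[of "nat k"] c(3)[OF nat[of "nat (- k)"]] by (cases "k \<ge> 0") (simp_all add: of_nat_nat)
  obtain i j where "r = Rat.Fract i j" "j > 0" by (cases r)
  hence "of_rat r = of_int i * inverse (of_int j :: complex)" by (simp add: of_rat_rat divide_inverse)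
  thus ?thesis using c(6)[OF int c(4)[OF int], of i j] by simp
qed

lemma rat_eval_in_generate_field:
  "z \<in> generate_field C_ring H \<Longrightarrow> rat_eval p z \<in> generate_field C_ring H"
proof (induction p)
  case 0
  show ?case using generate_field_of_rat[of 0] by simp
next
  case (pCons a p)
  show ?case unfolding rat_eval_pCons
    by (rule generate_field_C_ring(5)[OF generate_field_of_rat
          generate_field_C_ring(6)[OF pCons.prems pCons.IH[OF pCons.prems]]])
qed

lemma (in eisenstein_septic) rat_adjoin_eq:
  assumes "root z" "\<theta> = rat_eval p z" "z = rat_eval p' \<theta>"
  shows "rat_adjoin \<theta> = range (\<lambda>p. rat_eval p z)"
proof (rule equalityI; rule subsetI)
  fix x assume "x \<in> rat_adjoin \<theta>"
  hence "\<exists>p. x = rat_eval p z" unfolding rat_adjoin_def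
  proof (induction rule: generate_field_C_ring_induct)
    show "\<exists>p. 1 = rat_eval p z" by (intro exI[of _ 1]) simp
  next
    fix x y assume "\<exists>p. x = rat_eval p z" "\<exists>p. y = rat_eval p z"
    then obtain p p' where p: "x = rat_eval p z" "y = rat_eval p' z" by blast
    show "\<exists>p. x + y = rat_eval p z" by (intro exI[of _ "p + p'"]) (simp add: p)
    show "\<exists>p. x * y = rat_eval p z" by (intro exI[of _ "p * p'"]) (simp add: p)
  next
    fix x assume "\<exists>p. x = rat_eval p z"
    then obtain p where p: "x = rat_eval p z" by blast
    show "\<exists>p. - x = rat_eval p z" by (intro exI[of _ "- p"]) (simp add: p)
    show "\<exists>p. inverse x = rat_eval p z" using inverse_rat_eval[OF assms(1)] p by simp
  next
    fix x assume "x \<in> {\<theta>}"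
    hence "x = rat_eval p z" using assms(2) by (simp only: singleton_iff)
    thus "\<exists>p. x = rat_eval p z" by blast
  qed
  thus "x \<in> range (\<lambda>p. rat_eval p z)" by blast
next
  fix x assume "x \<in> range (\<lambda>p. rat_eval p z)"
  then obtain p where p: "x = rat_eval p z" by blast
  have "\<theta> \<in> rat_adjoin \<theta>" unfolding rat_adjoin_def by (rule generate_field_C_ring(2)) simp
  hence "z \<in> rat_adjoin \<theta>" unfolding assms(3) rat_adjoin_def by (rule rat_eval_in_generate_field)
  thus "x \<in> rat_adjoin \<theta>" unfolding p rat_adjoin_def by (rule rat_eval_in_generate_field)
qed

section \<open>The Hashimoto--Hoshi polynomials\<close>

text \<open>\<open>GG t (x - 1)\<close> is the value \<open>f\<^sub>t(x)\<close> of the Hashimoto--Hoshi polynomial. If \<open>a\<close> is a root of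
  \<open>GG t\<close>, its next two conjugates under a generator of the Galois group are \<open>b = BB t a / DD t a\<close>
  and \<open>c = CC t a / DD t a\<close>, and the third one is \<open>(b - t) / a\<close>.\<close>

definition GG :: "'a::comm_ring_1 \<Rightarrow> 'a \<Rightarrow> 'a" where
  "GG T a = a^7 - a^6*T^3 - a^6*T^2 - 5*a^6*T + a^6 + 3*a^5*T^3 + 3*a^5*T^2 - 6*a^5*T - 3*a^5 + a^4*T^7 +
      a^4*T^6 + 9*a^4*T^5 - 5*a^4*T^4 + 15*a^4*T^3 + 8*a^4*T^2 + 9*a^4*T - 3*a^4 - a^3*T^8 - a^3*T^7 -
      8*a^3*T^6 + 12*a^3*T^5 - 14*a^3*T^4 + 8*a^3*T^3 + 2*a^3*T^2 + 12*a^3*T + 3*a^3 - a^2*T^8 - 2*a^2*T^7 -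
      11*a^2*T^6 - 4*a^2*T^5 - 10*a^2*T^4 - 13*a^2*T^3 - 5*a^2*T^2 - 3*a^2*T + 3*a^2 - a*T^7 - 2*a*T^6 -
      8*a*T^5 - 2*a*T^4 - 11*a*T^3 - 5*a*T^2 - 6*a*T - a - T^5 - T^4 - T^3 - 2*T^2 - T - 1"

definition DD :: "'a::comm_ring_1 \<Rightarrow> 'a \<Rightarrow> 'a" where
  "DD T a = 0 - a^3*T^2 - a^3*T + a^2*T^4 + a^2*T^3 + 2*a^2*T^2 - a^2*T + a*T^4 + 3*a*T^2 + a*T + T"

definition BB :: "'a::comm_ring_1 \<Rightarrow> 'a \<Rightarrow> 'a" where
  "BB T a = a^4*T - a^3*T^3 - 3*a^3*T^2 + a^3*T + a^2*T^4 + 2*a^2*T^3 - 3*a^2*T^2 - a^2*T + 2*a*T^3 + a*T^2 - a*T + T^2"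

definition CC :: "'a::comm_ring_1 \<Rightarrow> 'a \<Rightarrow> 'a" where
  "CC T a = 0 - a^4 + 3*a^3*T + a^2*T^4 - a^2*T^2 + a^2*T + 2*a^2 - a*T^5 - a*T^4 - a*T^3 - 2*a*T^2 - 3*a*T -
      T^4 - T^2 - T - 1"

text \<open>With \<open>e = t\<^sup>3 + t\<^sup>2 + 5t + 6\<close>, the polynomial \<open>7\<^sup>7 GG t ((z + e - 7) / 7)\<close> is monic in \<open>z\<close> and
  congruent to \<open>z\<^sup>7\<close> modulo \<open>gg t\<close>; the cofactors of \<open>gg t\<close> are the coefficients \<open>hh t i\<close>.\<close>

definition gg :: "'a::comm_ring_1 \<Rightarrow> 'a" where
  "gg T = T^6 + 2*T^5 + 11*T^4 + T^3 + 16*T^2 + 4*T + 8"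

definition hh :: "int \<Rightarrow> nat \<Rightarrow> int" where
  "hh T i = [0 - 6*T^15 - 30*T^14 + 133*T^13 + 504*T^12 + 3255*T^11 + 6244*T^10 + 12033*T^9 + 8438*T^8 -
      19620*T^7 - 52892*T^6 - 136787*T^5 - 167671*T^4 - 179676*T^3 - 206640*T^2 - 103680*T - 82944, 0 -
      35*T^12 - 140*T^11 + 462*T^10 + 1134*T^9 + 7882*T^8 + 10087*T^7 + 17738*T^6 + 11487*T^5 - 12999*T^4 -
      2982*T^3 - 39018*T^2 - 24192*T - 24192, 0 - 84*T^9 - 252*T^8 + 546*T^7 + 588*T^6 + 6027*T^5 + 4116*T^4
      + 8085*T^3 + 8498*T^2 + 2268*T + 3024, 0 - 105*T^6 - 210*T^5 + 217*T^4 - 105*T^3 + 1407*T^2 + 609*T +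
      1218, 0 - 70*T^3 - 70*T^2 - 7*T - 28, 0 - 21] ! i"

text \<open>The roots \<theta> = a + 1 of the Hashimoto--Hoshi polynomial have sum e, so 7 \<theta>
  - e has trace zero. This is why no term of degree six occurs.\<close>

lemma eisenstein_form:
  fixes T a :: "complex"
  shows "(7*a + 7 - (T^3 + T^2 + 5*T + 6))^7 + gg T * ((0 - 6*T^15 - 30*T^14 + 133*T^13 + 504*T^12 +
      3255*T^11 + 6244*T^10 + 12033*T^9 + 8438*T^8 - 19620*T^7 - 52892*T^6 - 136787*T^5 - 167671*T^4 -
      179676*T^3 - 206640*T^2 - 103680*T - 82944)*(7*a + 7 - (T^3 + T^2 + 5*T + 6))^0 + (0 - 35*T^12 -
      140*T^11 + 462*T^10 + 1134*T^9 + 7882*T^8 + 10087*T^7 + 17738*T^6 + 11487*T^5 - 12999*T^4 - 2982*T^3 -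
      39018*T^2 - 24192*T - 24192)*(7*a + 7 - (T^3 + T^2 + 5*T + 6))^1 + (0 - 84*T^9 - 252*T^8 + 546*T^7 +
      588*T^6 + 6027*T^5 + 4116*T^4 + 8085*T^3 + 8498*T^2 + 2268*T + 3024)*(7*a + 7 - (T^3 + T^2 + 5*T +
      6))^2 + (0 - 105*T^6 - 210*T^5 + 217*T^4 - 105*T^3 + 1407*T^2 + 609*T + 1218)*(7*a + 7 - (T^3 + T^2 +
      5*T + 6))^3 + (0 - 70*T^3 - 70*T^2 - 7*T - 28)*(7*a + 7 - (T^3 + T^2 + 5*T + 6))^4 + (0 - 21)*(7*a + 7
      - (T^3 + T^2 + 5*T + 6))^5) = 7^7 * GG T a"
  unfolding GG_def gg_def by Groebner_Basis.algebra

text \<open>Cleared of denominators: the rational function BB / DD carries b to c. The forms in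
  \<open>B\<close> and \<open>D\<close> are \<open>DD\<close> and \<open>BB\<close> at
  \<open>B / D\<close>, made homogeneous.\<close>

lemma DD_next_identity:
  fixes T a B D :: "complex"
  assumes "B = BB T a" "D = DD T a"
  shows "((T)*D^3 + (T^4 + 3*T^2 + T)*B*D^2 + (T^4 + T^3 + 2*T^2 - T)*B^2*D + (0 - T^2 - T)*B^3) * CC T a -
      ((T^2)*D^4 + (2*T^3 + T^2 - T)*B*D^3 + (T^4 + 2*T^3 - 3*T^2 - T)*B^2*D^2 + (0 - T^3 - 3*T^2 + T)*B^3*D
      + (T)*B^4) = GG T a * (a^9*T^4 - a^8*T^6 - 6*a^8*T^5 + a^8*T^4 - 3*a^7*T^8 + 3*a^7*T^7 + 10*a^7*T^6 -
      9*a^7*T^5 - 4*a^7*T^4 + 5*a^6*T^10 + 14*a^6*T^9 + 3*a^6*T^8 + 5*a^6*T^7 + 29*a^6*T^6 + 17*a^6*T^5 -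
      4*a^6*T^4 - 2*a^5*T^12 - 13*a^5*T^11 - 22*a^5*T^10 - 10*a^5*T^9 - 17*a^5*T^8 - 29*a^5*T^7 - 11*a^5*T^6
      + 27*a^5*T^5 + 6*a^5*T^4 + 2*a^4*T^13 + 8*a^4*T^12 + 5*a^4*T^11 - 10*a^4*T^10 - 16*a^4*T^9 - 15*a^4*T^8
      - 31*a^4*T^7 - 54*a^4*T^6 - 15*a^4*T^5 + 6*a^4*T^4 + a^3*T^13 + 8*a^3*T^12 + 17*a^3*T^11 + 25*a^3*T^10
      + 16*a^3*T^9 + 21*a^3*T^8 + 18*a^3*T^7 - 8*a^3*T^6 - 27*a^3*T^5 - 4*a^3*T^4 + 2*a^2*T^12 + 6*a^2*T^11 +
      16*a^2*T^10 + 21*a^2*T^9 + 21*a^2*T^8 + 26*a^2*T^7 + 25*a^2*T^6 + 3*a^2*T^5 - 4*a^2*T^4 + a*T^11 +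
      a*T^10 + 7*a*T^9 + 5*a*T^8 + 8*a*T^7 + 9*a*T^6 + 9*a*T^5 + a*T^4 + T^8 + T^6 + T^5 + T^4)"
  unfolding assms GG_def DD_def BB_def CC_def by Groebner_Basis.algebra

text \<open>Likewise cleared of denominators: the element two steps after b, given by CC / DD at b,
  is (b - T) / a.\<close>

lemma CC_next_identity:
  fixes T a B D :: "complex"
  assumes "B = BB T a" "D = DD T a"
  shows "((T)*D^3 + (T^4 + 3*T^2 + T)*B*D^2 + (T^4 + T^3 + 2*T^2 - T)*B^2*D + (0 - T^2 - T)*B^3) * (B - T*D)
      - a * ((0 - T^4 - T^2 - T - 1)*D^4 + (0 - T^5 - T^4 - T^3 - 2*T^2 - 3*T)*B*D^3 + (T^4 - T^2 + T +
      2)*B^2*D^2 + (3*T)*B^3*D + (0 - 1)*B^4) = GG T a * (a^10*T^4 + a^9*T^7 - a^9*T^6 - 5*a^9*T^5 +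
      3*a^9*T^4 - 3*a^8*T^9 - 6*a^8*T^8 + 2*a^8*T^7 + 5*a^8*T^6 - 18*a^8*T^5 + 3*a^7*T^11 + 11*a^7*T^10 +
      13*a^7*T^9 - 3*a^7*T^8 + 3*a^7*T^7 + 33*a^7*T^6 - 10*a^7*T^5 - 8*a^7*T^4 - a^6*T^13 - 5*a^6*T^12 -
      10*a^6*T^11 - a^6*T^10 + 23*a^6*T^9 + 11*a^6*T^8 - 7*a^6*T^7 + 39*a^6*T^6 + 30*a^6*T^5 - 6*a^6*T^4 -
      4*a^5*T^12 - 20*a^5*T^11 - 37*a^5*T^10 - 20*a^5*T^9 - 10*a^5*T^8 - 26*a^5*T^7 - 19*a^5*T^6 + 36*a^5*T^5
      + 6*a^5*T^4 + 2*a^4*T^13 + 4*a^4*T^12 + a^4*T^11 - 20*a^4*T^10 - 28*a^4*T^9 - 29*a^4*T^8 - 18*a^4*T^7 -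
      49*a^4*T^6 - 6*a^4*T^5 + 8*a^4*T^4 + a^3*T^13 + 4*a^3*T^12 + 8*a^3*T^11 + 8*a^3*T^10 - 8*a^3*T^8 -
      3*a^3*T^7 - 13*a^3*T^6 - 22*a^3*T^5 + a^2*T^12 + a^2*T^11 + 6*a^2*T^10 + 3*a^2*T^9 + 5*a^2*T^8 -
      a^2*T^7 + 5*a^2*T^6 - 6*a^2*T^5 - 3*a^2*T^4 + a*T^9 + a*T^7 + a*T^5 - a*T^4)"
  unfolding assms GG_def DD_def BB_def CC_def by Groebner_Basis.algebra

text \<open>With d = (b - T) / a this expresses a through its next three conjugates as b d - T b + T
  c + T, the relation that drives \<open>next_root\<close>.\<close>

lemma square_identity:
  fixes T a B C D :: "complex"
  assumes "B = BB T a" "D = DD T a" "C = CC T a"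
  shows "a^2*D^2 - (B*(B - T*D) - T*a*B*D + T*a*C*D + T*a*D^2) = GG T a * (0 - a*T^2)"
  unfolding assms GG_def DD_def BB_def CC_def by Groebner_Basis.algebra

text \<open>Together with the three-step recursion of the orbit this yields the formula for the
  third conjugate that closes the orbit in \<open>orbit_period\<close>.\<close>

lemma product_identity:
  fixes T a B C D :: "complex"
  assumes "B = BB T a" "D = DD T a" "C = CC T a"
  shows "B*(B - T*D)*D - a*(C*a*(C - T*D) + T*B*C + T*B*D)*D = GG T a * (a^2*T^2 + a^2*T + a^2 - a^3) * D"
  unfolding assms GG_def DD_def BB_def CC_def by Groebner_Basis.algebra

text \<open>Meant to be read backwards: if the left side vanishes, then \<open>a\<close> is a root
  of \<open>GG\<close> or of a quadratic cofactor. This certifies the next conjugate without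
  substituting BB / DD into \<open>GG\<close>.\<close>

lemma next_root_identity:
  fixes T a B C D :: "complex"
  assumes "B = BB T a" "D = DD T a" "C = CC T a"
  shows "a*D^2 - (C*(a*C - T*a*D + T*B + T*D) + T*D^2) = GG T a * (a*T^2 + a*T + a - T^2 - a^2)"
  unfolding assms GG_def DD_def BB_def CC_def by Groebner_Basis.algebra

lemma kappa_identity:
  fixes T a B D :: "complex"
  assumes "B = BB T a" "D = DD T a"
  shows "(T^2 + T + 1)*B*D - B^2 - T^2*D^2 = GG T a * (0 - a*T^2 - 2*T^5 - T^4 - T^3 - 2*T^2) + (0 -
      2*a^6*T^8 - a^6*T^7 - 7*a^6*T^6 - 2*a^6*T^5 - 8*a^6*T^4 - a^6*T^3 - 2*a^6*T^2 + 3*a^5*T^8 + 12*a^5*T^7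
      - 9*a^5*T^6 + 21*a^5*T^5 - 15*a^5*T^4 + 5*a^5*T^3 - 4*a^5*T^2 + 2*a^4*T^12 + 3*a^4*T^11 + 19*a^4*T^10 +
      2*a^4*T^9 + 25*a^4*T^8 + 47*a^4*T^7 - 2*a^4*T^6 + 63*a^4*T^5 + 3*a^4*T^4 + 16*a^4*T^3 + 2*a^4*T^2 -
      2*a^3*T^13 - 3*a^3*T^12 - 18*a^3*T^11 + 11*a^3*T^10 - 25*a^3*T^9 - 15*a^3*T^8 + 25*a^3*T^7 - 25*a^3*T^6
      + 26*a^3*T^5 + 16*a^3*T^4 + 6*a^3*T^3 + 8*a^3*T^2 - 2*a^2*T^13 - 5*a^2*T^12 - 25*a^2*T^11 - 24*a^2*T^10
      - 38*a^2*T^9 - 66*a^2*T^8 - 42*a^2*T^7 - 45*a^2*T^6 - 47*a^2*T^5 - 4*a^2*T^4 - 13*a^2*T^3 + 2*a^2*T^2 -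
      2*a*T^12 - 5*a*T^11 - 19*a*T^10 - 16*a*T^9 - 35*a*T^8 - 41*a*T^7 - 27*a*T^6 - 39*a*T^5 - 17*a*T^4 -
      11*a*T^3 - 4*a*T^2 - 2*T^10 - 3*T^9 - 4*T^8 - 8*T^7 - 7*T^6 - 6*T^5 - 7*T^4 - 2*T^3 - 2*T^2)"
  unfolding assms GG_def DD_def BB_def by Groebner_Basis.algebra

text \<open>The constants \<open>26353376 = 2\<^sup>5 7\<^sup>7\<close> and \<open>2744 = 2\<^sup>3 7\<^sup>3\<close> come from resultants: away from \<open>2\<close> and
  \<open>7\<close> the polynomial \<open>gg\<close> is separable and coprime to \<open>hh _ 0\<close>.\<close>

lemma bezout_g_h0:
  fixes T :: int
  shows "(0 - 150*T^14 - 492*T^13 + 5035*T^12 + 7709*T^11 + 43169*T^10 + 6075*T^9 - 61261*T^8 - 3409*T^7 -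
      53980*T^6 + 1520256*T^5 + 1587001*T^4 - 1436918*T^3 - 5167741*T^2 - 16768814*T - 14725412) * gg T + (0
      - 25*T^5 - 7*T^4 - 119*T^3 + 376*T^2 - 155*T - 1738) * hh T 0 = 26353376"
  (is "?l = _")
proof -
  have "y * complex_of_int ?l = y * complex_of_int 26353376" for y
    unfolding gg_def hh_def nth_Cons_0
    by (simp only: of_int_add of_int_mult of_int_diff of_int_power of_int_numeral of_int_0)
      Groebner_Basis.algebra
  from this[of 1] show ?thesis by (simp only: mult_1_left of_int_eq_iff)
qed

definition gg' :: "int \<Rightarrow> int" where
  "gg' T = 6*T^5 + 10*T^4 + 44*T^3 + 3*T^2 + 32*T + 4"

lemma bezout_g_deriv:
  fixes T :: int
  shows "(6*T^4 - 92*T^3 - 102*T^2 - 633*T + 277) * gg T + (0 - T^5 + 15*T^4 + 19*T^3 + 166*T^2 - 67*T + 132)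
      * gg' T = 2744"
  (is "?l = _")
proof -
  have "y * complex_of_int ?l = y * complex_of_int 2744" for y
    unfolding gg_def gg'_def
    by (simp only: of_int_add of_int_mult of_int_diff of_int_power of_int_numeral of_int_0)
      Groebner_Basis.algebra
  from this[of 1] show ?thesis by (simp only: mult_1_left of_int_eq_iff)
qed

lemma next_homogeneous:
  fixes T B D :: complex
  assumes "D \<noteq> 0"
  shows "DD T (B / D) * D^3 = (T)*D^3 + (T^4 + 3*T^2 + T)*B*D^2 + (T^4 + T^3 + 2*T^2 - T)*B^2*D + (0 - T^2 - T)*B^3"
    "BB T (B / D) * D^4 = (T^2)*D^4 + (2*T^3 + T^2 - T)*B*D^3 + (T^4 + 2*T^3 - 3*T^2 - T)*B^2*D^2 + (0 - T^3
        - 3*T^2 + T)*B^3*D + (T)*B^4"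
    "CC T (B / D) * D^4 = (0 - T^4 - T^2 - T - 1)*D^4 + (0 - T^5 - T^4 - T^3 - 2*T^2 - 3*T)*B*D^3 + (T^4 -
        T^2 + T + 2)*B^2*D^2 + (3*T)*B^3*D + (0 - 1)*B^4"
proof -
  define x where "x = B / D"
  have B: "B = x * D" using assms by (simp add: x_def)
  show "DD T (B / D) * D^3 = (T)*D^3 + (T^4 + 3*T^2 + T)*B*D^2 + (T^4 + T^3 + 2*T^2 - T)*B^2*D + (0 - T^2 - T)*B^3"
    unfolding x_def[symmetric] unfolding B DD_def by Groebner_Basis.algebra
  show "BB T (B / D) * D^4 = (T^2)*D^4 + (2*T^3 + T^2 - T)*B*D^3 + (T^4 + 2*T^3 - 3*T^2 - T)*B^2*D^2 + (0 -
      T^3 - 3*T^2 + T)*B^3*D + (T)*B^4"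
    unfolding x_def[symmetric] unfolding B BB_def by Groebner_Basis.algebra
  show "CC T (B / D) * D^4 = (0 - T^4 - T^2 - T - 1)*D^4 + (0 - T^5 - T^4 - T^3 - 2*T^2 - 3*T)*B*D^3 + (T^4 -
      T^2 + T + 2)*B^2*D^2 + (3*T)*B^3*D + (0 - 1)*B^4"
    unfolding x_def[symmetric] unfolding B CC_def by Groebner_Basis.algebra
qed

text \<open>The remainder modulo \<open>GG T\<close> of the numerator of the cofactor in \<open>next_root_identity\<close> at the next
  conjugate of \<open>a\<close>.\<close>

definition kappa_rem :: "'a::comm_ring_1 \<Rightarrow> 'a \<Rightarrow> 'a" where
  "kappa_rem T a = 0 - 2*a^6*T^8 - a^6*T^7 - 7*a^6*T^6 - 2*a^6*T^5 - 8*a^6*T^4 - a^6*T^3 - 2*a^6*T^2 +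
      3*a^5*T^8 + 12*a^5*T^7 - 9*a^5*T^6 + 21*a^5*T^5 - 15*a^5*T^4 + 5*a^5*T^3 - 4*a^5*T^2 + 2*a^4*T^12 +
      3*a^4*T^11 + 19*a^4*T^10 + 2*a^4*T^9 + 25*a^4*T^8 + 47*a^4*T^7 - 2*a^4*T^6 + 63*a^4*T^5 + 3*a^4*T^4 +
      16*a^4*T^3 + 2*a^4*T^2 - 2*a^3*T^13 - 3*a^3*T^12 - 18*a^3*T^11 + 11*a^3*T^10 - 25*a^3*T^9 - 15*a^3*T^8
      + 25*a^3*T^7 - 25*a^3*T^6 + 26*a^3*T^5 + 16*a^3*T^4 + 6*a^3*T^3 + 8*a^3*T^2 - 2*a^2*T^13 - 5*a^2*T^12 -
      25*a^2*T^11 - 24*a^2*T^10 - 38*a^2*T^9 - 66*a^2*T^8 - 42*a^2*T^7 - 45*a^2*T^6 - 47*a^2*T^5 - 4*a^2*T^4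
      - 13*a^2*T^3 + 2*a^2*T^2 - 2*a*T^12 - 5*a*T^11 - 19*a*T^10 - 16*a*T^9 - 35*a*T^8 - 41*a*T^7 - 27*a*T^6
      - 39*a*T^5 - 17*a*T^4 - 11*a*T^3 - 4*a*T^2 - 2*T^10 - 3*T^9 - 4*T^8 - 8*T^7 - 7*T^6 - 6*T^5 - 7*T^4 -
      2*T^3 - 2*T^2"

lemma next_root_relations:
  fixes T a :: complex
  assumes G: "GG T a = 0" and D: "DD T a \<noteq> 0" and b: "b = BB T a / DD T a" and c: "c = CC T a / DD T a"
  shows "DD T b * c = BB T b" "DD T b * (b - T) = a * CC T b"
    "a^2 = b * (b - T) - T * a * b + T * a * c + T * a"
    "b * (b - T) = a * (c * a * (c - T) + T * b * c + T * b)"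
proof -
  define B C E where "B = BB T a" and "C = CC T a" and "E = DD T a"
  have E: "E \<noteq> 0" using D by (simp add: E_def)
  have b: "b = B / E" and c: "c = C / E" using b c by (simp_all add: B_def C_def E_def)
  note h = next_homogeneous[OF E, of T B, folded b]
  have "DD T b * E^3 * C = BB T b * E^4"
    using DD_next_identity[OF B_def E_def] unfolding G h C_def by simp
  moreover have "C = c * E" using E by (simp add: c)
  ultimately have "(DD T b * c) * E^4 = BB T b * E^4" by (simp add: eval_nat_numeral mult_ac)
  thus "DD T b * c = BB T b" using E by simp
  have "DD T b * E^3 * (B - T * E) = a * (CC T b * E^4)"
    using CC_next_identity[OF B_def E_def] unfolding G h by simp
  moreover have B: "B = b * E" using E by (simp add: b)
  ultimately have "(DD T b * (b - T)) * E^4 = (a * CC T b) * E^4" by (simp add: eval_nat_numeral algebra_simps)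
  thus "DD T b * (b - T) = a * CC T b" using E by simp
  have C: "C = c * E" using E by (simp add: c)
  have "a^2 * E^2 = (b * (b - T) - T * a * b + T * a * c + T * a) * E^2"
    using square_identity[OF B_def E_def C_def] unfolding G B C by (simp add: eval_nat_numeral algebra_simps)
  thus "a^2 = b * (b - T) - T * a * b + T * a * c + T * a" using E by simp
  have "b * (b - T) * E^3 = a * (c * a * (c - T) + T * b * c + T * b) * E^3"
    using product_identity[OF B_def E_def C_def] unfolding G B C by (simp add: eval_nat_numeral algebra_simps)
  thus "b * (b - T) = a * (c * a * (c - T) + T * b * c + T * b)" using E by simp
qed

text \<open>Inserting the expression of a by b, c, d into d a = b - T gives the left side of
  \<open>next_root_identity\<close> at b. So \<open>GG\<close> vanishes at b unless the quadratic
  cofactor does, which the hypothesis on \<open>kappa_rem\<close> excludes.\<close>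

lemma next_root:
  fixes T a :: complex
  assumes G: "GG T a = 0" and D: "DD T a \<noteq> 0" and a: "a \<noteq> 0" and k: "kappa_rem T a \<noteq> 0"
  shows "GG T (BB T a / DD T a) = 0"
proof -
  define b c d where "b = BB T a / DD T a" and "c = CC T a / DD T a" and "d = (b - T) / a"
  note rel = next_root_relations[OF G D b_def c_def]
  have da: "d * a = b - T" using a by (simp add: d_def)
  have "a * a = a * (b * d - T * b + T * c + T)"
    using rel(3) unfolding da[symmetric] by (simp add: power2_eq_square algebra_simps)
  hence a_eq: "a = b * d - T * b + T * c + T" using a by simp
  define E where "E = DD T b"
  have B: "BB T b = E * c" using rel(1) by (simp add: E_def)
  have "a * CC T b = a * (E * d)"
    unfolding rel(2)[symmetric] unfolding da[symmetric] E_def by (simp only: mult_ac)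
  hence C: "CC T b = E * d" using a by simp
  have "b = d * (b * d - T * b + T * c + T) + T" using da a_eq by (simp add: algebra_simps)
  hence "b * E^2 - ((E * d) * (b * (E * d) - T * b * E + T * (E * c) + T * E) + T * E^2) = 0"
    by Groebner_Basis.algebra
  hence "GG T b * (b * T^2 + b * T + b - T^2 - b^2) = 0"
    using next_root_identity[OF B[symmetric] E_def C[symmetric]] by simp
  moreover have "(b * T^2 + b * T + b - T^2 - b^2) * DD T a ^ 2 = kappa_rem T a"
    using kappa_identity[of _ T a, OF refl refl] D unfolding G kappa_rem_def[symmetric] b_def
    by (simp add: field_simps power2_eq_square)
  ultimately show ?thesis using k by (auto simp: b_def)
qed

text \<open>The orbit satisfies y(k+3) y(k) = y(k+1) - T. With the product relation this gives y(5)
  = y(0) y(4) + T, while the recursion at \<open>4\<close> gives y(7) y(4) = y(5) - T.\<close>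

lemma orbit_period:
  fixes T :: complex and y :: "nat \<Rightarrow> complex"
  assumes G: "\<And>k. GG T (y k) = 0" and D: "\<And>k. DD T (y k) \<noteq> 0" and nz: "\<And>k. y k \<noteq> 0"
    and step: "\<And>k. y (Suc k) = BB T (y k) / DD T (y k)"
  shows "y 7 = y 0"
proof -
  note rel = next_root_relations[OF G D step refl]
  have c: "CC T (y k) / DD T (y k) = y (Suc (Suc k))" for k
  proof -
    have "DD T (y (Suc k)) * (CC T (y k) / DD T (y k)) = DD T (y (Suc k)) * y (Suc (Suc k))"
      unfolding rel(1) step[of "Suc k"] using D[of "Suc k"] by simp
    thus ?thesis using D[of "Suc k"] by (simp only: mult_cancel_left) simp
  qed
  have three: "y (Suc (Suc (Suc k))) * y k = y (Suc k) - T" for k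
  proof -
    have "CC T (y (Suc k)) = DD T (y (Suc k)) * y (Suc (Suc (Suc k)))"
      unfolding c[of "Suc k", symmetric] using D[of "Suc k"] by simp
    hence "DD T (y (Suc k)) * (y (Suc (Suc (Suc k))) * y k) = DD T (y (Suc k)) * (y (Suc k) - T)"
      unfolding rel(2) by (simp only: mult_ac)
    thus ?thesis using D[of "Suc k"] by (simp only: mult_cancel_left) simp
  qed
  have y3: "y 3 = y 2 * (y 0 * y 4 + T) + T"
  proof -
    have "y 1 * (y 3 * y 0) = y 0 * (y 2 * y 0 * (y 2 - T) + T * y 1 * y 2 + T * y 1)"
      using rel(4)[of 0] unfolding c three[of 0, symmetric]
      by (simp only: eval_nat_numeral One_nat_def BitM.simps)
    moreover have "y 2 - T = y 4 * y 1" using three[of 1] by (simp only: eval_nat_numeral One_nat_def BitM.simps)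
    ultimately have "y 1 * (y 3 * y 0) = y 0 * (y 2 * y 0 * (y 4 * y 1) + T * y 1 * y 2 + T * y 1)"
      by (simp only:)
    hence "(y 0 * y 1) * y 3 = (y 0 * y 1) * (y 2 * (y 0 * y 4 + T) + T)"
      by (simp only: algebra_simps)
    thus ?thesis using nz[of 0] nz[of 1] by (simp only: mult_cancel_left mult_eq_0_iff) simp
  qed
  have "y 5 * y 2 = y 3 - T" using three[of 2] by (simp only: eval_nat_numeral One_nat_def BitM.simps)
  hence "y 2 * y 5 = y 2 * (y 0 * y 4 + T)" unfolding y3 by (simp only: mult.commute add_diff_cancel_right')
  hence "y 5 = y 0 * y 4 + T" using nz[of 2] by (simp only: mult_cancel_left) simp
  moreover have "y 7 * y 4 = y 5 - T" using three[of 4] by (simp only: eval_nat_numeral One_nat_def BitM.simps)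
  ultimately have "y 7 * y 4 = y 0 * y 4" by (simp only: add_diff_cancel_right')
  thus ?thesis using nz[of 4] by (simp only: mult_cancel_right) simp
qed

section \<open>Hashimoto--Hoshi fields\<close>

lemma sum_lessThan_7:
  fixes g :: "nat \<Rightarrow> 'a :: comm_monoid_add"
  shows "(\<Sum>i<7. g i) = g 0 + g 1 + g 2 + g 3 + g 4 + g 5 + g 6"
  by (simp add: eval_nat_numeral)

lemma hh_simps:
  "hh t 0 = 0 - 6*t^15 - 30*t^14 + 133*t^13 + 504*t^12 + 3255*t^11 + 6244*t^10 + 12033*t^9 + 8438*t^8 -
      19620*t^7 - 52892*t^6 - 136787*t^5 - 167671*t^4 - 179676*t^3 - 206640*t^2 - 103680*t - 82944"
  "hh t 1 = 0 - 35*t^12 - 140*t^11 + 462*t^10 + 1134*t^9 + 7882*t^8 + 10087*t^7 + 17738*t^6 + 11487*t^5 -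
      12999*t^4 - 2982*t^3 - 39018*t^2 - 24192*t - 24192"
  "hh t 2 = 0 - 84*t^9 - 252*t^8 + 546*t^7 + 588*t^6 + 6027*t^5 + 4116*t^4 + 8085*t^3 + 8498*t^2 + 2268*t + 3024"
  "hh t 3 = 0 - 105*t^6 - 210*t^5 + 217*t^4 - 105*t^3 + 1407*t^2 + 609*t + 1218"
  "hh t 4 = 0 - 70*t^3 - 70*t^2 - 7*t - 28"
  "hh t 5 = 0 - 21"
  by (simp_all add: hh_def)

lemma rat_eval_numeral [simp]: "rat_eval (numeral n) z = numeral n"
  by (simp add: numeral_poly)

lemma rat_eval_next:
  "rat_eval (DD p r) z = DD (rat_eval p z) (rat_eval r z)"
  "rat_eval (BB p r) z = BB (rat_eval p z) (rat_eval r z)"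
  by (simp_all add: DD_def BB_def)

definition good_prime :: "int \<Rightarrow> nat \<Rightarrow> bool" where
  "good_prime t q \<longleftrightarrow> prime q \<and> \<not> q dvd 14 \<and> int q dvd gg t \<and> \<not> (int q)\<^sup>2 dvd gg t"

text \<open>The lower coefficients of the Eisenstein polynomial with one factor \<open>q\<close>
  removed. The value \<open>0\<close> at index \<open>6\<close> is the vanishing trace; it also
  keeps the access to the six-element list in \<open>hh\<close> within range.\<close>

definition hb :: "int \<Rightarrow> nat \<Rightarrow> nat \<Rightarrow> int" where
  "hb t q i = gg t div int q * (if i < 6 then hh t i else 0)"

text \<open>That \<open>q\<close> divides \<open>gg t\<close> only once keeps it out of
  \<open>gg t div int q\<close>, and \<open>bezout_g_h0\<close> leaves only \<open>2\<close> and
  \<open>7\<close> as common prime divisors of \<open>gg t\<close> and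
  \<open>hh t 0\<close>.\<close>

lemma hb_0: "\<not> int q dvd hb t q 0" if "good_prime t q"
proof
  assume dvd: "int q dvd hb t q 0"
  have q: "prime q" "\<not> q dvd 14" "int q dvd gg t" "\<not> (int q)\<^sup>2 dvd gg t"
    using that by (auto simp: good_prime_def)
  have p: "prime (int q)" using q(1) by simp
  consider "int q dvd gg t div int q" | "int q dvd hh t 0"
    using dvd p by (auto simp: hb_def prime_dvd_mult_iff)
  thus False
  proof cases
    case 1
    hence "int q * int q dvd int q * (gg t div int q)" by (rule mult_dvd_mono[OF dvd_refl])
    thus False using q(3,4) by (simp add: power2_eq_square)
  next
    case 2
    have "int q dvd 26353376"
      unfolding bezout_g_h0[of t, symmetric] using q(3) 2 by (intro dvd_add dvd_mult)
    hence "int q dvd 2 ^ 5 * 7 ^ 7" by simp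
    hence "int q dvd 2 \<or> int q dvd 7"
      using p by (meson prime_dvd_mult_iff prime_dvd_power)
    hence "int q dvd int 14" using dvd_mult2[of "int q" 2 7] dvd_mult2[of "int q" 7 2] by auto
    hence "q dvd 14" by (simp only: int_dvd_int_iff)
    thus False using q(2) by simp
  qed
qed

text \<open>Positivity of \<open>t\<close> makes the coefficients inspected in the nonvanishing
  lemmas nonzero.\<close>

locale hashimoto_hoshi =
  fixes t :: int and q :: nat
  assumes t_pos: "t \<ge> 1" and good: "good_prime t q"
begin

sublocale E: eisenstein_septic q "hb t q"
  using good hb_0 by unfold_locales (auto simp: good_prime_def)

abbreviation "T \<equiv> complex_of_int t"

text \<open>The inverse of the affine map a \<mapsto> 7 a + 7 - e, which recovers the root of
  \<open>GG\<close> from the root of the Eisenstein polynomial.\<close>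

definition A :: "rat poly" where
  "A = [: (of_int (t^3 + t^2 + 5*t + 6) - 7) / 7, 1 / 7 :]"

lemma rat_eval_A: "rat_eval A z = (z + (T^3 + T^2 + 5*T + 6) - 7) / 7"
  by (simp add: A_def rat_eval_pCons of_rat_divide of_rat_diff of_rat_add of_rat_mult of_rat_power field_simps)

lemma A_inverse: "7 * rat_eval A z + 7 - (T^3 + T^2 + 5*T + 6) = z"
proof -
  have 7: "7 * (x / 7) = x" for x :: complex by simp
  show ?thesis unfolding rat_eval_A 7 by simp
qed

lemma root_iff_GG: "E.root z \<longleftrightarrow> GG T (rat_eval A z) = 0"
proof -
  have dvd: "int q dvd gg t" using good by (simp add: good_prime_def)
  have "of_nat q * complex_of_int (gg t div int q) = complex_of_int (int q * (gg t div int q))" by simp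
  also have "\<dots> = complex_of_int (gg t)" by (simp only: dvd_mult_div_cancel[OF dvd])
  also have "\<dots> = gg T" by (simp add: gg_def)
  finally have g: "of_nat q * complex_of_int (gg t div int q) = gg T" .
  have H: "complex_of_int (hh t 0) = 0 - 6*T^15 - 30*T^14 + 133*T^13 + 504*T^12 + 3255*T^11 + 6244*T^10 +
      12033*T^9 + 8438*T^8 - 19620*T^7 - 52892*T^6 - 136787*T^5 - 167671*T^4 - 179676*T^3 - 206640*T^2 -
      103680*T - 82944" "complex_of_int (hh t 1) = 0 - 35*T^12 - 140*T^11 + 462*T^10 + 1134*T^9 + 7882*T^8 +
      10087*T^7 + 17738*T^6 + 11487*T^5 - 12999*T^4 - 2982*T^3 - 39018*T^2 - 24192*T - 24192" "complex_of_int
      (hh t 2) = 0 - 84*T^9 - 252*T^8 + 546*T^7 + 588*T^6 + 6027*T^5 + 4116*T^4 + 8085*T^3 + 8498*T^2 +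
      2268*T + 3024" "complex_of_int (hh t 3) = 0 - 105*T^6 - 210*T^5 + 217*T^4 - 105*T^3 + 1407*T^2 + 609*T
      + 1218" "complex_of_int (hh t 4) = 0 - 70*T^3 - 70*T^2 - 7*T - 28" "complex_of_int (hh t 5) = 0 - 21"
    by (simp_all only: hh_simps of_int_add of_int_mult of_int_diff of_int_power of_int_numeral of_int_0)
  have "of_nat q * of_int (hb t q i) = gg T * (if i < 6 then of_int (hh t i) else 0)" for i
    by (simp add: hb_def g[symmetric])
  hence "of_nat q * (\<Sum>i<7. of_int (hb t q i) * z ^ i) = (\<Sum>i<7. gg T * (if i < 6 then of_int (hh t i) else 0) * z ^ i)"
    by (simp only: sum_distrib_left mult.assoc[symmetric])
  also have "z ^ 7 + \<dots> = 7^7 * GG T (rat_eval A z)"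
    unfolding eisenstein_form[of "rat_eval A z" T, symmetric] A_inverse sum_lessThan_7 H[symmetric]
    by (simp add: distrib_left mult.assoc)
  finally show ?thesis by (simp add: E.root_def eq_neg_iff_add_eq_0)
qed

text \<open>As \<open>A\<close> is linear, a polynomial of degree at most six in
  \<open>rat_eval A z\<close> has degree at most six in \<open>z\<close>. By
  \<open>rat_eval_eq_0_imp\<close> a single nonzero coefficient then suffices. The Horner form
  matches evaluation of a coefficient list.\<close>

lemma rat_combination_nonzero:
  assumes z: "E.root z"
    and x: "x = of_rat ca + rat_eval A z * (of_rat cb + rat_eval A z * (of_rat cc + rat_eval A z * (of_rat cd
      + rat_eval A z * (of_rat ce + rat_eval A z * (of_rat cf + rat_eval A z * of_rat cg)))))"
    and c: "ca \<noteq> 0 \<or> cb \<noteq> 0 \<or> cc \<noteq> 0 \<or> cd \<noteq> 0 \<or> ce \<noteq> 0 \<or> cf \<noteq> 0 \<or> cg \<noteq> 0"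
  shows "x \<noteq> 0"
proof
  assume "x = 0"
  let ?p = "[:ca, cb, cc, cd, ce, cf, cg:]"
  have d: "Polynomial.degree A = 1" by (simp add: A_def)
  have "rat_eval (pcompose ?p A) z = 0" 
    unfolding rat_eval_pcompose rat_eval_pCons rat_eval_0 using x \<open>x = 0\<close> by simp
  moreover have "Polynomial.degree (pcompose ?p A) < 7"
    unfolding degree_pcompose d by (simp add: Polynomial.degree_pCons_eq_if)
  ultimately have "pcompose ?p A = 0" by (intro E.rat_eval_eq_0_imp[OF z])
  hence "?p = 0" by (rule pcompose_eq_0) (simp add: d)
  thus False using c by simp
qed

lemma root_nonzero: "rat_eval A z \<noteq> 0" if "E.root z"
  by (rule rat_combination_nonzero[OF that, of _ 0 1 0 0 0 0 0]) simp_all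

lemma DD_nonzero: "DD T (rat_eval A z) \<noteq> 0" if "E.root z"
proof (rule rat_combination_nonzero[OF that, where ca = "of_int t" and cb = "of_int t^4 + 3*of_int t^2 +
    of_int t" and cc = "of_int t^4 + of_int t^3 + 2*of_int t^2 - of_int t" and cd = "0 - of_int t^2 - of_int
    t" and ce = "0" and cf = "0" and cg = "0"], goal_cases)
  case 1
  show ?case unfolding DD_def by (simp only: of_rat_add of_rat_mult of_rat_diff of_rat_power of_rat_of_int_eq
      of_rat_numeral_eq of_rat_0 of_rat_1) Groebner_Basis.algebra
next
  case 2
  have "of_int t \<noteq> (0 :: rat)" using t_pos by simp
  thus ?case by blast
qed

lemma kappa_nonzero: "kappa_rem T (rat_eval A z) \<noteq> 0" if "E.root z"
proof (rule rat_combination_nonzero[OF that, where ca = "0 - 2*of_int t^10 - 3*of_int t^9 - 4*of_int t^8 -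
    8*of_int t^7 - 7*of_int t^6 - 6*of_int t^5 - 7*of_int t^4 - 2*of_int t^3 - 2*of_int t^2" and cb = "0 -
    2*of_int t^12 - 5*of_int t^11 - 19*of_int t^10 - 16*of_int t^9 - 35*of_int t^8 - 41*of_int t^7 -
    27*of_int t^6 - 39*of_int t^5 - 17*of_int t^4 - 11*of_int t^3 - 4*of_int t^2" and cc = "0 - 2*of_int t^13
    - 5*of_int t^12 - 25*of_int t^11 - 24*of_int t^10 - 38*of_int t^9 - 66*of_int t^8 - 42*of_int t^7 -
    45*of_int t^6 - 47*of_int t^5 - 4*of_int t^4 - 13*of_int t^3 + 2*of_int t^2" and cd = "0 - 2*of_int t^13
    - 3*of_int t^12 - 18*of_int t^11 + 11*of_int t^10 - 25*of_int t^9 - 15*of_int t^8 + 25*of_int t^7 -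
    25*of_int t^6 + 26*of_int t^5 + 16*of_int t^4 + 6*of_int t^3 + 8*of_int t^2" and ce = "2*of_int t^12 +
    3*of_int t^11 + 19*of_int t^10 + 2*of_int t^9 + 25*of_int t^8 + 47*of_int t^7 - 2*of_int t^6 + 63*of_int
    t^5 + 3*of_int t^4 + 16*of_int t^3 + 2*of_int t^2" and cf = "3*of_int t^8 + 12*of_int t^7 - 9*of_int t^6
    + 21*of_int t^5 - 15*of_int t^4 + 5*of_int t^3 - 4*of_int t^2" and cg = "0 - 2*of_int t^8 - of_int t^7 -
    7*of_int t^6 - 2*of_int t^5 - 8*of_int t^4 - of_int t^3 - 2*of_int t^2"], goal_cases)
  case 1
  show ?case unfolding kappa_rem_def by (simp only: of_rat_add of_rat_mult of_rat_diff of_rat_power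
      of_rat_of_int_eq of_rat_numeral_eq of_rat_0 of_rat_1) Groebner_Basis.algebra
next
  case 2
  have t: "of_int t > (0 :: rat)" using t_pos by simp
  \<comment> \<open>The coefficient of degree six is, up to sign, this product of positive
    factors.\<close>
  have "0 < (of_int t :: rat)^2 * (2 * of_int t^6 + of_int t^5 + 7 * of_int t^4 + 2 * of_int t^3
      + 8 * of_int t^2 + of_int t + 2)"
    using t by (intro mult_pos_pos add_pos_pos) simp_all
  also have "\<dots> = - (0 - 2*of_int t^8 - of_int t^7 - 7*of_int t^6 - 2*of_int t^5 - 8*of_int t^4 - of_int
      t^3 - 2*of_int t^2)" by (simp add: algebra_simps eval_nat_numeral)
  finally have "0 - 2*of_int t^8 - of_int t^7 - 7*of_int t^6 - 2*of_int t^5 - 8*of_int t^4 - of_int t^3 -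
      2*of_int t^2 \<noteq> (0 :: rat)" by linarith
  thus ?case by blast
qed

lemma next_neq: "BB T (rat_eval A z) / DD T (rat_eval A z) \<noteq> rat_eval A z" if "E.root z"
proof -
  have "BB T (rat_eval A z) - rat_eval A z * DD T (rat_eval A z) \<noteq> 0"
  proof (rule rat_combination_nonzero[OF that, where ca = "of_int t^2" and cb = "2*of_int t^3 + of_int t^2 -
      2*of_int t" and cc = "2*of_int t^3 - 6*of_int t^2 - 2*of_int t" and cd = "0 - of_int t^4 - 2*of_int t^3
      - 5*of_int t^2 + 2*of_int t" and ce = "of_int t^2 + 2*of_int t" and cf = "0" and cg = "0"], goal_cases)
    case 1
    show ?case unfolding DD_def BB_def by (simp only: of_rat_add of_rat_mult of_rat_diff of_rat_power
        of_rat_of_int_eq of_rat_numeral_eq of_rat_0 of_rat_1) Groebner_Basis.algebra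
  next
    case 2
    have t: "of_int t > (0 :: rat)" using t_pos by simp
    have "of_int t^2 + 2 * of_int t > (0::rat)" using t by (intro add_pos_pos) simp_all
    hence "of_int t^2 + 2 * of_int t \<noteq> (0::rat)" by linarith
    thus ?case by blast
  qed
  thus ?thesis using DD_nonzero[OF that] by (auto simp: divide_eq_eq)
qed

text \<open>\<open>DD\<close> is inverted by a polynomial at one root \<open>z0\<close>; by transfer
  the same polynomial works at every root, as iteration requires. The outer affine map in
  \<open>R\<close> undoes \<open>A\<close>.\<close>

lemma next_ex:
  assumes "E.root z0"
  obtains R where "\<And>z. E.root z \<Longrightarrow> rat_eval A (rat_eval R z) = BB T (rat_eval A z) / DD T (rat_eval A z)"
proof -
  let ?T = "[:of_int t:] :: rat poly"
  have D: "rat_eval (DD ?T A) z = DD T (rat_eval A z)" and B: "rat_eval (BB ?T A) z = BB T (rat_eval A z)" for z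
    by (simp_all add: rat_eval_next)
  obtain p where p: "inverse (rat_eval (DD ?T A) z0) = rat_eval p z0"
    using E.inverse_rat_eval[OF assms] by blast
  define P where "P = BB ?T A * p"
  define R where "R = [:7:] * P + [:7 - of_int (t^3 + t^2 + 5*t + 6):]"
  have "rat_eval (DD ?T A * P) z0 = rat_eval (BB ?T A) z0"
    using DD_nonzero[OF assms] by (simp only: P_def rat_eval_mult p[symmetric] D) simp
  hence P: "rat_eval (DD ?T A * P) z = rat_eval (BB ?T A) z" if "E.root z" for z
    by (rule E.rat_eval_transfer_eq[OF assms that])
  have R: "rat_eval A (rat_eval R z) = rat_eval P z" for z
    by (simp add: rat_eval_A R_def rat_eval_pCons of_rat_minus of_rat_diff of_rat_add of_rat_mult of_rat_power)
  have "rat_eval P z = BB T (rat_eval A z) / DD T (rat_eval A z)" if "E.root z" for z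
    using P[OF that] DD_nonzero[OF that] by (simp only: rat_eval_mult D B) (simp add: eq_divide_eq mult.commute)
  thus ?thesis by (intro that[of R]) (simp only: R)
qed

lemma eisenstein_automorphism:
  assumes z0: "E.root z0"
  obtains R where "eisenstein_automorphism q (hb t q) z0 R"
proof -
  obtain R where R: "\<And>z. E.root z \<Longrightarrow> rat_eval A (rat_eval R z) = BB T (rat_eval A z) / DD T (rat_eval A z)"
    using next_ex[OF z0] by blast
  have root_R: "E.root (rat_eval R z)" if z: "E.root z" for z
    using z root_nonzero[OF z] DD_nonzero[OF z] kappa_nonzero[OF z] unfolding root_iff_GG R[OF z]
    by (intro next_root)
  have root: "E.root ((rat_eval R ^^ k) z0)" for k
    using z0 root_R by (induction k) simp_all
  define y where "y k = rat_eval A ((rat_eval R ^^ k) z0)" for k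
  have "y 7 = y 0"
    using root by (intro orbit_period[of T y])
      (auto simp: y_def root_iff_GG DD_nonzero root_nonzero R)
  hence "(rat_eval R ^^ 7) z0 = z0"
    using A_inverse[of "(rat_eval R ^^ 7) z0"] A_inverse[of z0] by (simp add: y_def)
  moreover have "rat_eval R z0 \<noteq> z0" using R[OF z0] next_neq[OF z0] by auto
  ultimately have "eisenstein_automorphism q (hb t q) z0 R"
    using z0 root_R by unfold_locales auto
  thus ?thesis by (rule that)
qed

end

lemma poly_hashimoto_hoshi:
  "poly (map_poly of_int (hashimoto_hoshi_poly t)) \<theta> = GG (complex_of_int t) (\<theta> - 1)"
  unfolding hashimoto_hoshi_poly_def GG_def
  by (simp add: Polynomial.map_poly_pCons del: mult_minus_left) Groebner_Basis.algebra

text \<open>One good prime suffices to build the cyclic field. Since \<open>z\<close> depends only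
  on \<open>t\<close> and \<open>\<theta>\<close>, the same element is a root of an Eisenstein
  polynomial at every other good prime, which then ramifies in the field already built.\<close>

lemma hashimoto_hoshi_ramified:
  assumes "t \<ge> 1" "good_prime t q" "poly (map_poly of_int (hashimoto_hoshi_poly t)) \<theta> = 0"
  shows "\<exists>f z \<sigma>. cyclic_septic f z (rat_adjoin \<theta>) \<sigma> \<and>
    (\<forall>q'. good_prime t q' \<longrightarrow> ramified_prime f z (rat_adjoin \<theta>) \<sigma> q' z (hb t q'))"
proof -
  interpret H: hashimoto_hoshi t q using assms(1,2) by unfold_locales
  define e where "e = complex_of_int (t^3 + t^2 + 5*t + 6)"
  define z where "z = 7 * \<theta> - e"
  have A: "rat_eval H.A z = \<theta> - 1" by (simp add: z_def e_def H.rat_eval_A)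
  have G: "GG (complex_of_int t) (\<theta> - 1) = 0" using assms(3) by (simp only: poly_hashimoto_hoshi)
  have root: "eisenstein_septic.root q' (hb t q') z" if "good_prime t q'" for q'
  proof -
    interpret H': hashimoto_hoshi t q' using assms(1) that by unfold_locales
    have "H'.A = H.A" by (simp only: H.A_def H'.A_def)
    thus ?thesis using G by (simp only: H'.root_iff_GG A)
  qed
  have root_z: "H.E.root z" by (rule root[OF assms(2)])
  obtain R where "eisenstein_automorphism q (hb t q) z R"
    by (rule H.eisenstein_automorphism[OF root_z])
  then interpret Au: eisenstein_automorphism q "hb t q" z R .
  have K: "rat_adjoin \<theta> = range (\<lambda>p. rat_eval p z)"
  proof (rule H.E.rat_adjoin_eq[OF root_z])
    show "\<theta> = rat_eval (H.A + 1) z" by (simp add: A)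
    show "z = rat_eval [:- of_int (t^3 + t^2 + 5*t + 6), 7:] \<theta>"
      by (simp add: z_def e_def rat_eval_pCons of_rat_minus of_rat_diff of_rat_add of_rat_mult of_rat_power)
  qed
  have cyc: "cyclic_septic (\<lambda>i. - int q * hb t q i) z (rat_adjoin \<theta>) Au.auto"
    unfolding K by (rule Au.cyclic_septic)
  moreover have "ramified_prime (\<lambda>i. - int q * hb t q i) z (rat_adjoin \<theta>) Au.auto q' z (hb t q')"
    if q': "good_prime t q'" for q'
  proof -
    interpret H': hashimoto_hoshi t q' using assms(1) q' by unfold_locales
    have rt: "H'.E.root z" by (rule root[OF q'])
    have "z = rat_eval [:0, 1:] z" by (simp add: rat_eval_pCons)
    hence zK: "z \<in> rat_adjoin \<theta>" unfolding K by blast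
    show ?thesis
      unfolding ramified_prime_def ramified_prime_axioms_def
    proof (intro conjI allI impI)
      show "z \<in> ring_of_integers (rat_adjoin \<theta>)"
        using zK H'.E.algebraic_int_root[OF rt] by (simp add: ring_of_integers_def)
      show "z ^ 7 = - of_nat q' * (\<Sum>i<7. of_int (hb t q' i) * z ^ i)"
        using rt by (simp only: H'.E.root_def)
      fix x assume "x \<in> rat_adjoin \<theta>"
      thus "\<exists>c :: nat \<Rightarrow> rat. x = (\<Sum>i<7. of_rat (c i) * z ^ i)"
        unfolding K H.E.range_rat_eval[OF root_z] by blast
    qed (use cyc H'.E.q_prime H'.E.b0 in auto)
  qed
  ultimately show ?thesis by blast
qed

section \<open>Prescribed ramification in blocks of parameters\<close>

text \<open>Taylor's formula: modulo x^2 only the derivative \<open>gg'\<close> remains.\<close>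

lemma gg_shift: "gg (t + x) = gg t + x * gg' t + x^2 * (x^4 + 6*x^3*t + 2*x^3 + 15*x^2*t^2 + 10*x^2*t +
    11*x^2 + 20*x*t^3 + 20*x*t^2 + 44*x*t + x + 15*t^4 + 20*t^3 + 66*t^2 + 3*t + 16)" for t x :: int
proof -
  have "complex_of_int (gg (t + x)) = complex_of_int (gg t + x * gg' t + x^2 * (x^4 + 6*x^3*t + 2*x^3 +
      15*x^2*t^2 + 10*x^2*t + 11*x^2 + 20*x*t^3 + 20*x*t^2 + 44*x*t + x + 15*t^4 + 20*t^3 + 66*t^2 + 3*t + 16))"
    unfolding gg_def gg'_def
    by (simp only: of_int_add of_int_mult of_int_diff of_int_power of_int_numeral of_int_0)
      Groebner_Basis.algebra
  thus ?thesis by (simp only: of_int_eq_iff)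
qed

lemma gg_multiple_8:
  "gg (8 * x) = 8 * (1 + x * (32768*x^5 + 8192*x^4 + 5632*x^3 + 64*x^2 + 128*x + 4))" for x :: int
  by (simp add: gg_def eval_nat_numeral algebra_simps)

definition admissible_primes :: "nat set" where
  "admissible_primes = {q. prime q \<and> \<not> q dvd 14 \<and> (\<exists>t. int q dvd gg t)}"

text \<open>Euclid's argument: \<open>gg (8 * x) / 8\<close> is coprime to \<open>x\<close>.\<close>

lemma infinite_admissible_primes: "infinite admissible_primes"
proof
  assume "finite admissible_primes"
  then obtain M where M: "\<And>q. q \<in> admissible_primes \<Longrightarrow> q \<le> M"
    by (auto simp: finite_nat_set_iff_bounded_le)
  \<comment> \<open>The bound \<open>14\<close> ensures that the new prime does not divide
    \<open>14\<close>.\<close>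
  define N where "N = max M 14"
  define x where "x = (fact N :: nat)"
  define w where "w = 32768*x^5 + 8192*x^4 + 5632*x^3 + 64*x^2 + 128*x + 4"
  have "x > 0" by (simp add: x_def)
  hence "1 + x * w \<noteq> 1" by (simp add: w_def)
  then obtain q where q: "prime q" "q dvd 1 + x * w" by (meson prime_factor_nat)
  have "q > N"
  proof (rule ccontr)
    assume "\<not> q > N"
    hence "q dvd x" unfolding x_def using q(1) by (intro dvd_fact) (auto dest: prime_ge_1_nat)
    hence "q dvd x * w" by simp
    hence "q dvd 1" using q(2) by (simp only: dvd_add_left_iff)
    thus False using q(1) by simp
  qed
  have "int q dvd int (1 + x * w)" using q(2) by (simp only: int_dvd_int_iff)
  hence "int q dvd gg (8 * int x)" unfolding gg_multiple_8 by (intro dvd_mult) (simp add: w_def)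
  moreover have "\<not> q dvd 14" using \<open>q > N\<close> by (auto simp: N_def dest: dvd_imp_le)
  ultimately have "q \<in> admissible_primes" using q(1) by (auto simp: admissible_primes_def)
  thus False using M \<open>q > N\<close> by (fastforce simp: N_def)
qed

text \<open>If q^2 divides \<open>gg t\<close>, passing to \<open>t + int q\<close> changes the
  value by q times \<open>gg' t\<close> modulo q^2, and \<open>q\<close> does not divide
  \<open>gg' t\<close> because \<open>gg\<close> is separable modulo \<open>q\<close>.\<close>

lemma admissible_imp_good:
  assumes "q \<in> admissible_primes"
  shows "\<exists>t. good_prime t q"
proof -
  obtain t where q: "prime q" "\<not> q dvd 14" and t: "int q dvd gg t"
    using assms by (auto simp: admissible_primes_def)
  have p: "prime (int q)" using q(1) by simp
  show ?thesis
  proof (cases "(int q)\<^sup>2 dvd gg t")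
    case False
    thus ?thesis using q t by (auto simp: good_prime_def)
  next
    case sq: True
    have "\<not> int q dvd gg' t"
    proof
      assume "int q dvd gg' t"
      hence "int q dvd 2744" unfolding bezout_g_deriv[of t, symmetric] using t by (intro dvd_add dvd_mult)
      hence "int q dvd 2 ^ 3 * 7 ^ 3" by simp
      hence "int q dvd 2 \<or> int q dvd 7"
        using p by (meson prime_dvd_mult_iff prime_dvd_power)
      hence "int q dvd int 14" using dvd_mult2[of "int q" 2 7] dvd_mult2[of "int q" 7 2] by auto
      thus False using q(2) by (simp only: int_dvd_int_iff)
    qed
    define s where "s = gg t + (int q)^2 * (int q^4 + 6*int q^3*t + 2*int q^3 + 15*int q^2*t^2 + 10*int q^2*t
        + 11*int q^2 + 20*int q*t^3 + 20*int q*t^2 + 44*int q*t + int q + 15*t^4 + 20*t^3 + 66*t^2 + 3*t + 16)"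
    have eq: "gg (t + int q) = int q * gg' t + s" unfolding gg_shift s_def by simp
    have s: "(int q)^2 dvd s" unfolding s_def using sq by simp
    have "int q dvd s" using s by (rule dvd_trans[rotated]) (simp add: power2_eq_square)
    hence "int q dvd gg (t + int q)" unfolding eq by simp
    moreover have "\<not> (int q)\<^sup>2 dvd gg (t + int q)"
    proof
      assume "(int q)\<^sup>2 dvd gg (t + int q)"
      hence "int q * int q dvd int q * gg' t"
        unfolding eq using s by (simp only: dvd_add_left_iff power2_eq_square)
      hence "int q dvd gg' t" using q(1) by (simp add: prime_gt_0_nat)
      thus False using \<open>\<not> int q dvd gg' t\<close> by simp
    qed
    ultimately show ?thesis using q by (auto simp: good_prime_def)
  qed
qed

lemma good_prime_cong:
  assumes "good_prime t q" "[t' = t] (mod (int q)\<^sup>2)"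
  shows "good_prime t' q"
proof -
  have c: "[gg t' = gg t] (mod (int q)\<^sup>2)"
    unfolding gg_def by (intro cong_add cong_mult cong_pow cong_refl assms(2))
  hence "[gg t' = gg t] (mod int q)" by (rule cong_dvd_modulus) (simp add: power2_eq_square)
  thus ?thesis using assms(1) cong_dvd_iff[OF c] c by (auto simp: good_prime_def cong_dvd_iff)
qed

lemma blocks_of_good_primes:
  fixes N m r :: nat
  shows "\<exists>t \<ge> int N. \<forall>i<m. \<exists>S. finite S \<and> card S = r \<and> (\<forall>q\<in>S. good_prime (t + int i) q)"
proof -
  obtain P where P: "finite P" "card P = m * r" "P \<subseteq> admissible_primes"
    using infinite_arbitrarily_large[OF infinite_admissible_primes] by metis
  obtain e where e: "bij_betw e {..<m * r} P"
    using ex_bij_betw_nat_finite[OF P(1)] by (auto simp: P(2) atLeast0LessThan)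
  have eP: "e k \<in> admissible_primes" if "k < m * r" for k
    using e P(3) that by (auto simp: bij_betw_def)
  have inj: "inj_on e {..<m * r}" using e by (simp add: bij_betw_def)
  define \<tau> where "\<tau> k = (SOME t. good_prime t (e k))" for k
  have \<tau>: "good_prime (\<tau> k) (e k)" if "k < m * r" for k
    unfolding \<tau>_def using admissible_imp_good[OF eP[OF that]] by (rule someI_ex)
  have pr: "prime (e k)" if "k < m * r" for k using eP[OF that] by (simp add: admissible_primes_def)
  \<comment> \<open>The prime \<open>e k\<close> is reserved for the parameter
    \<open>t + k div r\<close>, so each of the \<open>m\<close> parameters receives \<open>r\<close>
    primes; the congruence on \<open>t\<close> is shifted accordingly.\<close>
  define u where "u k = nat ((\<tau> k - int (k div r)) mod int ((e k)\<^sup>2))" for k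
  have "\<exists>x. \<forall>k\<in>{..<m * r}. [x = u k] (mod (e k)\<^sup>2)"
  proof (rule chinese_remainder_nat)
    show "\<forall>i\<in>{..<m*r}. \<forall>j\<in>{..<m*r}. i \<noteq> j \<longrightarrow> coprime ((e i)\<^sup>2) ((e j)\<^sup>2)"
      using pr inj by (auto intro!: primes_coprime dest: inj_onD)
  qed simp
  then obtain x where x: "\<And>k. k < m * r \<Longrightarrow> [x = u k] (mod (e k)\<^sup>2)" by auto
  define L where "L = (\<Prod>k<m*r. (e k)\<^sup>2)"
  have "L > 0" unfolding L_def using pr by (intro prod_pos) (auto simp: prime_gt_0_nat)
  \<comment> \<open>\<open>L\<close> is a common multiple of the moduli, so adding
    \<open>N * L\<close> keeps the congruences and makes \<open>t\<close> large.\<close>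
  define t where "t = int (x + N * L)"
  have "N \<le> N * L" using \<open>L > 0\<close> by simp
  hence "N \<le> x + N * L" by linarith
  hence "t \<ge> int N" by (simp only: t_def of_nat_le_iff)
  moreover have good: "good_prime (t + int (k div r)) (e k)" if k: "k < m * r" for k
  proof (rule good_prime_cong[OF \<tau>[OF k]])
    have "(e k)\<^sup>2 dvd N * L" unfolding L_def using k by (intro dvd_mult dvd_prodI) auto
    hence "[N * L = 0] (mod (e k)\<^sup>2)" by (simp add: cong_0_iff)
    hence "[x + N * L = u k + 0] (mod (e k)\<^sup>2)" by (intro cong_add x[OF k])
    hence "[t = int (u k)] (mod int ((e k)\<^sup>2))" unfolding t_def by (simp only: cong_int_iff add_0_right)
    also have "int (u k) = (\<tau> k - int (k div r)) mod int ((e k)\<^sup>2)"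
      unfolding u_def using pr[OF k] by (simp add: prime_gt_0_nat)
    also have "[\<dots> = \<tau> k - int (k div r)] (mod int ((e k)\<^sup>2))" by (simp add: cong_def)
    finally have "[t + int (k div r) = \<tau> k - int (k div r) + int (k div r)] (mod int ((e k)\<^sup>2))"
      by (intro cong_add cong_refl)
    thus "[t + int (k div r) = \<tau> k] (mod (int (e k))\<^sup>2)" by simp
  qed
  have "\<exists>S. finite S \<and> card S = r \<and> (\<forall>q\<in>S. good_prime (t + int i) q)" if i: "i < m" for i
  proof -
    define J where "J = {i * r..<i * r + r}"
    have "Suc i * r \<le> m * r" using i by (intro mult_le_mono1) simp
    hence J: "J \<subseteq> {..<m * r}" by (auto simp: J_def)
    have "k div r = i" if "k \<in> J" for k
      using that by (intro div_nat_eqI) (auto simp: J_def mult.commute)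
    hence "\<forall>q\<in>e ` J. good_prime (t + int i) q" using good J by fastforce
    moreover have "card (e ` J) = r"
      using card_image[OF inj_on_subset[OF inj J]] by (simp add: J_def)
    ultimately show ?thesis by (intro exI[of _ "e ` J"]) (simp add: J_def)
  qed
  ultimately show ?thesis by blast
qed

section \<open>From single parameters to infinitely many blocks\<close>

lemma infinite_int_if_unbounded:
  assumes "\<And>N. \<exists>t \<ge> int N. P t"
  shows "infinite {t :: int. P t}"
proof
  assume fin: "finite {t. P t}"
  define M where "M = Max (insert 0 {t. P t})"
  obtain t where "t \<ge> int (nat (M + 1))" "P t" using assms by blast
  moreover have "t \<le> M" unfolding M_def using fin \<open>P t\<close> by (intro Max_ge) auto
  moreover have "M + 1 \<le> int (nat (M + 1))" by simp
  ultimately show False by linarith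
qed

lemma hashimoto_hoshi_polya:
  assumes t: "t \<ge> 1" and \<theta>: "poly (map_poly of_int (hashimoto_hoshi_poly t)) \<theta> = 0"
    and S: "finite S" "card S = Suc r" "\<And>q. q \<in> S \<Longrightarrow> good_prime t q"
  shows "contains_elementary (polya_group (rat_adjoin \<theta>)) 7 r"
    and "finite (carrier (polya_group (rat_adjoin \<theta>)))"
proof -
  obtain q where "q \<in> S" using S(2) by fastforce
  from hashimoto_hoshi_ramified[OF t S(3)[OF this] \<theta>]
  obtain f z \<sigma> where cyc: "cyclic_septic f z (rat_adjoin \<theta>) \<sigma>"
    and ram: "\<And>q. good_prime t q \<Longrightarrow> ramified_prime f z (rat_adjoin \<theta>) \<sigma> q z (hb t q)" by blast
  interpret cyclic_septic f z "rat_adjoin \<theta>" \<sigma> by (rule cyc)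
  show "finite (carrier (polya_group (rat_adjoin \<theta>)))" by (rule finite_polya_group)
  show "contains_elementary (polya_group (rat_adjoin \<theta>)) 7 r"
  proof (rule polya_contains_elementary[OF S(1)])
    show "Suc r \<le> card S" using S(2) by simp
    show "prime p" if "p \<in> S" for p using S(3)[OF that] by (simp add: good_prime_def)
    show "\<exists>I. frac I \<and> I [^]\<^bsub>FG\<^esub> (7::nat) = (*) (of_nat p) ` \<O> \<and>
        ideal_class (rat_adjoin \<theta>) I \<in> carrier (polya_group (rat_adjoin \<theta>))" if "p \<in> S" for p
      by (rule ramified_prime.ramified_ideal_ex[OF ram[OF S(3)[OF that]]])
  qed
qed

theorem theorem1p2:
  fixes m r :: nat and \<theta> :: "int \<Rightarrow> complex" and K :: "int \<Rightarrow> complex set"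
  assumes "m \<ge> 2" and "r > 1"
    and "\<And>t. poly (map_poly of_int (hashimoto_hoshi_poly t)) (\<theta> t) = 0"
    and "\<And>t. K t = rat_adjoin (\<theta> t)"
  shows "infinite {t :: int. \<forall>i<m. contains_elementary (polya_group (K (t + int i))) 7 r} \<and>
         infinite {B. \<exists>t :: int. B = {t..t + int m - 1} \<and>
                      (\<forall>s\<in>B. contains_elementary (polya_group (K s)) 7 r)} \<and>
         infinite {t :: int. \<forall>i<m. p_rank 7 (polya_group (K (t + int i))) \<ge> r}"
proof -
  define A where "A = {t :: int. \<forall>i<m. contains_elementary (polya_group (K (t + int i))) 7 r \<and>
    p_rank 7 (polya_group (K (t + int i))) \<ge> r}"
  have "\<exists>t \<ge> int N. \<forall>i<m. contains_elementary (polya_group (K (t + int i))) 7 r \<and>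
    p_rank 7 (polya_group (K (t + int i))) \<ge> r" for N
  proof -
    \<comment> \<open>\<open>Suc N\<close> forces \<open>t \<ge> 1\<close>; \<open>Suc r\<close>
      primes per parameter allow for the one given up in
      \<open>polya_contains_elementary\<close>.\<close>
    obtain t where t: "t \<ge> int (Suc N)"
      and good: "\<And>i. i < m \<Longrightarrow> \<exists>S. finite S \<and> card S = Suc r \<and> (\<forall>q\<in>S. good_prime (t + int i) q)"
      using blocks_of_good_primes[of "Suc N" m "Suc r"] by blast
    have "contains_elementary (polya_group (K (t + int i))) 7 r \<and>
        p_rank 7 (polya_group (K (t + int i))) \<ge> r" if i: "i < m" for i
    proof -
      obtain S where S: "finite S" "card S = Suc r" "\<And>q. q \<in> S \<Longrightarrow> good_prime (t + int i) q"
        using good[OF i] by blast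
      have "t + int i \<ge> 1" using t by simp
      note H = hashimoto_hoshi_polya[OF this assms(3) S, folded assms(4)]
      show ?thesis
        using H(1) contains_elementary_le_p_rank[OF H(2) _ H(1)] by simp
    qed
    thus ?thesis using t by (intro exI[of _ t]) simp
  qed
  hence A: "infinite A" unfolding A_def by (rule infinite_int_if_unbounded)
  have "inj_on (\<lambda>t. {t..t + int m - 1}) A"
  proof (rule inj_onI)
    fix s t assume "{s..s + int m - 1} = {t..t + int m - 1}"
    \<comment> \<open>The blocks are nonempty intervals, so each determines its first
      element.\<close>
    moreover have "s \<le> s + int m - 1" using assms(1) by simp
    ultimately show "s = t" by (simp add: Icc_eq_Icc)
  qed
  hence "infinite ((\<lambda>t. {t..t + int m - 1}) ` A)" using A by (simp add: finite_image_iff)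
  moreover have "(\<lambda>t. {t..t + int m - 1}) ` A \<subseteq> {B. \<exists>t :: int. B = {t..t + int m - 1} \<and>
      (\<forall>s\<in>B. contains_elementary (polya_group (K s)) 7 r)}"
  proof (rule image_subsetI)
    fix t assume "t \<in> A"
    have "contains_elementary (polya_group (K s)) 7 r" if "s \<in> {t..t + int m - 1}" for s
    proof -
      have "nat (s - t) < m" "s = t + int (nat (s - t))" using that by auto
      thus ?thesis using \<open>t \<in> A\<close> unfolding A_def by force
    qed
    thus "{t..t + int m - 1} \<in> {B. \<exists>t :: int. B = {t..t + int m - 1} \<and>
      (\<forall>s\<in>B. contains_elementary (polya_group (K s)) 7 r)}" by blast
  qed
  ultimately have "infinite {B. \<exists>t :: int. B = {t..t + int m - 1} \<and>
      (\<forall>s\<in>B. contains_elementary (polya_group (K s)) 7 r)}" by (rule infinite_super[rotated])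
  moreover have "infinite {t :: int. \<forall>i<m. contains_elementary (polya_group (K (t + int i))) 7 r}"
    by (rule infinite_super[OF _ A]) (auto simp: A_def)
  moreover have "infinite {t :: int. \<forall>i<m. p_rank 7 (polya_group (K (t + int i))) \<ge> r}"
    by (rule infinite_super[OF _ A]) (auto simp: A_def)
  ultimately show ?thesis by blast
qed

end
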